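(* Let $n \geq 2$ be an integer and let $\Omega \subset \mathbb{R}^n$ be a bounded domain containing the origin. For any $\varepsilon > 0$ there exist positive constants $A_{n,\varepsilon}$, depending only on $n$ and $\varepsilon$, and $B_n$, depending only on $n$ (in particular neither depends on $\Omega$), such that $$\int_\Omega e^{A_{n,\varepsilon} \left[|u(x)| X^\varepsilon (|x|/R_\Omega)\right]^{n/(n-1)}} \, \mathrm{d}x \leq B_n \,\mathrm{vol}(\Omega) \quad \text{for all } u \in C_c^\infty(\Omega \setminus \{0\}) \text{ satisfying } I_n[u;\Omega] \leq 1.$$ Moreover, such an estimate fails for $\varepsilon = 0$; that is, there do not exist positive constants $A, B$ such that $$\int_\Omega e^{A |u(x)|^{n/(n-1)}} \, \mathrm{d}x \leq B \,\mathrm{vol}(\Omega) \quad \text{for all } u \in C_c^\infty(\Omega \setminus \{0\}) \text{ satisfying } I_n[u;\Omega] \leq 1.$$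
   Context: A domain is an open connected set. $\mathrm{vol}(\Omega)$ is the Lebesgue measure of $\Omega$, and $R_\Omega := \sup_{x\in\Omega}|x|$. The function $X$ is defined by $X(t) := (1-\log t)^{-1}$ for $t \in (0,1]$, and $X^\gamma(t) := (X(t))^\gamma$ for $\gamma\in\mathbb{R}$. $C_c^\infty(\Omega\setminus\{0\})$ denotes the smooth real-valued functions with compact support in $\Omega\setminus\{0\}$. For $u \in C_c^\infty(\Omega\setminus\{0\})$, $$I_n[u;\Omega] := \int_\Omega |\nabla u|^n \,\mathrm{d}x - \left(\frac{n-1}{n}\right)^n \int_\Omega \frac{|u|^n}{|x|^n} X^n(|x|/R_\Omega)\,\mathrm{d}x.$$ *)

theory Defs
  imports "HOL-Analysis.Analysis"
begin

definition bounded_domain :: "'a::metric_space set \<Rightarrow> bool" where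
  "bounded_domain \<Omega> \<longleftrightarrow> bounded \<Omega> \<and> open \<Omega> \<and> connected \<Omega>"

definition radius :: "'a::real_normed_vector set \<Rightarrow> real" where
  "radius \<Omega> = (SUP x\<in>\<Omega>. norm x)"

text \<open>
  Only the values on \<open>(0, 1]\<close> matter. (At \<open>0\<close> the convention \<open>ln 0 = 0\<close> gives the value \<open>1\<close>; below,
  the argument is \<open>0\<close> only at the origin, a null set near which \<open>u\<close> vanishes.)
\<close>
definition X :: "real \<Rightarrow> real" where
  "X t = inverse (1 - ln t)"

definition pderivative :: "'n \<Rightarrow> (real^'n \<Rightarrow> real) \<Rightarrow> real^'n \<Rightarrow> real" where
  "pderivative i u x = frechet_derivative u (at x) (axis i 1)"

definition grad :: "(real^'n \<Rightarrow> real) \<Rightarrow> real^'n \<Rightarrow> real^'n" where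
  "grad u x = (\<chi> i. pderivative i u x)"

primrec C_class :: "nat \<Rightarrow> (real^'n \<Rightarrow> real) \<Rightarrow> bool" where
  "C_class 0 u \<longleftrightarrow> continuous_on UNIV u"
| "C_class (Suc k) u \<longleftrightarrow> u differentiable_on UNIV \<and> (\<forall>i. C_class k (pderivative i u))"

definition smooth :: "(real^'n \<Rightarrow> real) \<Rightarrow> bool" where
  "smooth u \<longleftrightarrow> (\<forall>k. C_class k u)"

text \<open>
  Elements of \<open>C\<^sub>c\<^sup>\<infinity>(U)\<close>, for open \<open>U\<close>, are represented by their extensions by zero to the
  whole space.
\<close>
definition test_functions :: "(real^'n) set \<Rightarrow> (real^'n \<Rightarrow> real) set" where
  "test_functions U =
     {u. smooth u \<and> compact (closure {x. u x \<noteq> 0}) \<and> closure {x. u x \<noteq> 0} \<subseteq> U}"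

text \<open>
  For \<open>u \<in> test_functions (\<Omega> - {0})\<close> with \<open>\<Omega>\<close> a bounded domain, both integrands are bounded,
  measurable and vanish near the origin, so the Lebesgue integrals are genuine.
\<close>
definition hardy_functional :: "(real^'n \<Rightarrow> real) \<Rightarrow> (real^'n) set \<Rightarrow> real" where
  "hardy_functional u \<Omega> =
     (LINT x:\<Omega>|lebesgue. norm (grad u x) ^ CARD('n))
     - ((real CARD('n) - 1) / real CARD('n)) ^ CARD('n) *
       (LINT x:\<Omega>|lebesgue.
          \<bar>u x\<bar> ^ CARD('n) / norm x ^ CARD('n) * X (norm x / radius \<Omega>) ^ CARD('n))"

end

theory Submission
  imports Defs
begin

text \<open>
  Write \<open>n\<close> for the dimension, \<open>a = (n - 1) / n\<close> and \<open>\<xi>(x) = X(|x| / R)\<close>.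

  For the positive part, set \<open>p = \<nabla>u + a u \<xi> x / |x|\<^sup>2\<close>; this is \<open>\<phi> \<nabla>(u / \<phi>)\<close> for the ground state
  \<open>\<phi> = \<xi> powr (-a)\<close>. Uniform convexity of \<open>|.|\<^sup>n\<close> together with the identity
  \<open>\<integral> (\<nabla>f \<bullet> x) / |x|\<^sup>n = 0\<close>, i.e. the dilation invariance of \<open>dx / |x|\<^sup>n\<close>, shows that the Hardy deficit
  controls \<open>\<integral> |p|\<^sup>n\<close>. The same identity with one more power of \<open>\<xi>\<close> gives a weighted Hardy inequality, and
  thus \<open>w = u \<xi> powr \<epsilon>\<close> satisfies \<open>\<integral> |\<nabla>w|\<^sup>n \<le> C(n, \<epsilon>)\<close>. The claim becomes Trudinger's inequality
  for \<open>w\<close>. For the latter, \<open>|w(x)| \<le> \<integral> |\<nabla>w(x + t z)| dt\<close> is averaged over a level set \<open>x \<in> E\<close> and over \<open>z\<close>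
  in a shell; Young's inequality applied separately for \<open>t\<close> below and above \<open>|E| powr (1 / n)\<close> bounds \<open>|E|\<close>
  by \<open>|\<Omega>| exp (n - n \<tau> powr (n / (n - 1)) / K)\<close>, where \<open>\<tau>\<close> is the level.

  For the negative part, put \<open>s = 1 / \<xi>\<close> and \<open>u = c s powr a \<chi>(\<delta> ln s)\<close> with a fixed bump \<open>\<chi>\<close>. Since \<open>ln s\<close>
  ranges over an interval of length of order \<open>1 / \<delta>\<close> and the integrand of the deficit is of order \<open>\<delta>\<^sup>2\<close>,
  the deficit tends to zero with \<open>\<delta>\<close>, for each fixed \<open>c\<close>. Choosing \<open>c\<close> such that the integrand is at
  least \<open>exp ((n + 1) s)\<close>, while the shell \<open>s \<approx> s\<^sub>1\<close> has volume of order \<open>exp (-n s\<^sub>1)\<close>, makes the exponential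
  integral unbounded.
\<close>

section \<open>Elementary inequalities\<close>

lemma power_split2:
  fixes x :: "'a::comm_monoid_mult"
  assumes "n \<ge> 2"
  shows "x ^ n = x ^ (n - 2) * x\<^sup>2" "x ^ (n - 1) = x ^ (n - 2) * x" "x ^ n = x ^ (n - 1) * x"
proof -
  obtain k where "n = k + 2" using assms by (metis add.commute le_Suc_ex)
  then show "x ^ n = x ^ (n - 2) * x\<^sup>2" "x ^ (n - 1) = x ^ (n - 2) * x" "x ^ n = x ^ (n - 1) * x"
    by (simp_all add: power2_eq_square mult_ac)
qed

text \<open>This is the tangent line of the convex function \<open>t powr (n / 2)\<close> at
  \<open>A^2\<close>, evaluated at \<open>B^2\<close> and doubled. The induction avoids calculus:
  from \<open>A * g n\<close> to \<open>g (Suc n)\<close> the increment is a product of two factors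
  of equal sign.\<close>

lemma power_tangent_square:
  fixes A B :: real
  assumes "n \<ge> 2" "A \<ge> 0" "B \<ge> 0"
  shows "2 * B ^ n + (real n - 2) * A ^ n \<ge> real n * A ^ (n - 2) * B\<^sup>2"
  using assms(1)
proof (induction n rule: dec_induct)
  case base
  then show ?case by simp
next
  case (step n)
  define g where "g m = 2 * B ^ m + (real m - 2) * A ^ m - real m * A ^ (m - 2) * B\<^sup>2" for m
  have A1: "A ^ n = A * A ^ (n - 1)" "A ^ (n - 1) = A * A ^ (n - 2)" "Suc n - 2 = n - 1"
    using step power_split2[of n A] by (auto simp: mult.commute)
  have "g (Suc n) - A * g n = (B - A) * (2 * B ^ n - A ^ (n - 1) * (A + B))"
    unfolding g_def A1 using A1 by (simp add: algebra_simps power2_eq_square)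
  moreover have "(B - A) * (2 * B ^ n - A ^ (n - 1) * (A + B)) \<ge> 0"
  proof (cases "B \<ge> A")
    case True
    have "A ^ n \<le> B ^ n" "A ^ (n - 1) \<le> B ^ (n-1)" using True assms by (auto intro!: power_mono)
    moreover have "B ^ n = B ^ (n - 1) * B" using step by (cases n) auto
    ultimately have "A ^ (n-1) * (A + B) \<le> 2 * B ^ n"
      using A1 assms mult_right_mono[of "A^(n-1)" "B^(n-1)" B] by (simp add: algebra_simps)
    then show ?thesis using True by simp
  next
    case False
    have "B ^ n \<le> A ^ n" "B ^ (n - 1) \<le> A ^ (n-1)" using False assms by (auto intro!: power_mono)
    moreover have "B ^ n = B ^ (n - 1) * B" using step by (cases n) auto
    ultimately have "A ^ (n-1) * (A + B) \<ge> 2 * B ^ n"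
      using A1 assms mult_right_mono[of "B^(n-1)" "A^(n-1)" B] by (simp add: algebra_simps)
    then show ?thesis using False by (simp add: mult_nonpos_nonpos)
  qed
  ultimately have "g (Suc n) \<ge> A * g n" by simp
  moreover have "A * g n \<ge> 0" using step assms by (auto simp: g_def)
  ultimately show ?case by (simp add: g_def)
qed

text \<open>The two entries serve the two cases of \<open>norm_add_power_lower\<close>:
  \<open>q\<close> small against \<open>p\<close>, and \<open>q\<close> at least comparable to
  \<open>p\<close>.\<close>

definition conv_const :: "nat \<Rightarrow> real" where
  "conv_const n = min (1/4) ((1 / (4 * real n)) ^ (n - 2))"

lemma conv_const_pos: "n \<ge> 2 \<Longrightarrow> conv_const n > 0"
  by (auto simp: conv_const_def)

text \<open>If \<open>|q| \<ge> l |p|\<close>, polarisation turns \<open>q \<bullet> p\<close> into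
  squared norms, and \<open>power_tangent_square\<close> leaves the surplus
  \<open>n / 2 * |q|^(n-2) * |p|^2\<close>, which dominates a multiple of \<open>|p|^n\<close>.
  Otherwise \<open>q\<close> is a small perturbation of \<open>p\<close>, and
  \<open>|p + q|^n\<close> alone outweighs all other terms.\<close>

lemma norm_add_power_lower:
  fixes p q :: "'a::real_inner"
  assumes n: "n \<ge> 2"
  shows "norm (p + q) ^ n \<ge> norm q ^ n + real n * norm q ^ (n - 2) * (q \<bullet> p) + conv_const n * norm p ^ n"
proof -
  define A B P where "A = norm q" and "B = norm (p + q)" and "P = norm p"
  \<comment> \<open>With \<open>n * l = 1/4\<close>, in the second case Bernoulli's inequality loses
    a quarter of \<open>P ^ n\<close>, the cross term costs at most another quarter, and
    \<open>A ^ n\<close> at most an eighth.\<close>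
  define l where "l = 1 / (4 * real n)"
  have nn: "A \<ge> 0" "B \<ge> 0" "P \<ge> 0" by (auto simp: A_def B_def P_def)
  have l: "l > 0" "real n * l = 1/4" "l \<le> 1/8" using n by (auto simp: l_def field_simps)
  have An: "A ^ n = A ^ (n - 2) * A\<^sup>2" and Pn: "P ^ n = P ^ (n - 2) * P\<^sup>2"
    and An1: "A ^ (n - 1) = A ^ (n - 2) * A"
    using power_split2[OF n] by auto
  have qp: "q \<bullet> p = (B\<^sup>2 - A\<^sup>2 - P\<^sup>2) / 2"
    unfolding A_def B_def P_def power2_norm_eq_inner by (simp add: inner_simps inner_commute)
  show ?thesis
  proof (cases "l * P \<le> A")
    case True
    have "2 * B ^ n + (real n - 2) * A ^ n \<ge> real n * A ^ (n - 2) * B\<^sup>2"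
      using power_tangent_square[OF n nn(1,2)] .
    then have "2 * (B ^ n - A ^ n - real n * A ^ (n - 2) * (q \<bullet> p)) \<ge> real n * A ^ (n - 2) * P\<^sup>2"
      unfolding qp An by (simp add: algebra_simps add_divide_distrib diff_divide_distrib)
    moreover have "2 * (conv_const n * P ^ n) \<le> real n * A ^ (n - 2) * P\<^sup>2"
    proof -
      have "conv_const n * P ^ n \<le> l ^ (n - 2) * P ^ n"
        unfolding conv_const_def l_def using nn by (intro mult_right_mono) auto
      then have "2 * (conv_const n * P ^ n) \<le> 2 * (l * P) ^ (n - 2) * P\<^sup>2"
        unfolding Pn by (simp add: power_mult_distrib mult.assoc)
      also have "A ^ (n - 2) \<ge> (l * P) ^ (n - 2)" using True l nn by (intro power_mono) auto
      then have "2 * (l * P) ^ (n - 2) * P\<^sup>2 \<le> real n * A ^ (n - 2) * P\<^sup>2"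
        using n l nn by (intro mult_right_mono mult_mono) auto
      finally show ?thesis .
    qed
    ultimately have "2 * (conv_const n * P ^ n) \<le> 2 * (B ^ n - A ^ n - real n * A ^ (n - 2) * (q \<bullet> p))"
      by (rule order_trans[rotated])
    then show ?thesis unfolding A_def[symmetric] B_def[symmetric] P_def[symmetric] by (simp add: algebra_simps)
  next
    case False
    then have lt: "A < l * P" by simp
    with nn l have P: "P > 0" by (metis less_le_trans less_eq_real_def mult_zero_right order_less_irrefl not_le)
    have "B \<ge> P - A" unfolding A_def B_def P_def by (metis norm_diff_ineq)
    then have "B \<ge> (1 - l) * P" using lt by (simp add: algebra_simps)
    then have "B ^ n \<ge> ((1 - l) * P) ^ n" using l P by (intro power_mono) auto
    moreover have "(1 + (- l)) ^ n \<ge> 1 + of_nat n * (- l)" using l by (intro Bernoulli_inequality) auto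
    then have "((1 - l) * P) ^ n \<ge> 3/4 * P ^ n" using l P unfolding power_mult_distrib
      by (intro mult_right_mono) auto
    moreover have "A ^ (n-1) \<le> (l * P) ^ (n - 1)" using lt nn by (intro power_mono) auto
    moreover have "(l * P) ^ (n - 1) \<le> l * P ^ (n - 1)"
      unfolding power_mult_distrib using l P n power_decreasing[of 1 "n-1" l] by (intro mult_right_mono) auto
    moreover have "real n * A ^ (n - 2) * (q \<bullet> p) \<le> real n * A ^ (n - 1) * P"
      using norm_cauchy_schwarz[of q p] nn n unfolding An1 A_def[symmetric] P_def[symmetric]
      by (auto simp: mult.assoc intro!: mult_left_mono)
    ultimately have *: "real n * A ^ (n - 2) * (q \<bullet> p) \<le> real n * l * P ^ (n - 1) * P"
      using P n by (smt (verit) mult_left_mono mult_right_mono of_nat_0_le_iff mult.assoc)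
    have Pn1: "P ^ (n - 1) * P = P ^ n" using n by (simp flip: power_Suc2)
    have **: "real n * A ^ (n - 2) * (q \<bullet> p) \<le> 1/4 * P ^ n"
      using * unfolding l Pn1[symmetric] by (simp add: mult.assoc)
    have "A ^ n \<le> (l * P) ^ n" using lt nn by (intro power_mono) auto
    also have "(l * P) ^ n \<le> l * P ^ n"
      unfolding power_mult_distrib using l P n power_decreasing[of 1 "n" l] by (intro mult_right_mono) auto
    finally have "A ^ n \<le> 1/8 * P ^ n" using l P by (smt (verit) mult_right_mono zero_le_power)
    moreover have "conv_const n * P ^ n \<le> 1/4 * P ^ n"
      unfolding conv_const_def using nn by (intro mult_right_mono) auto
    ultimately show ?thesis using ** \<open>B ^ n \<ge> ((1 - l) * P) ^ n\<close> \<open>((1 - l) * P) ^ n \<ge> 3/4 * P ^ n\<close> zero_le_power[OF nn(3), of n]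
      unfolding A_def[symmetric] B_def[symmetric] P_def[symmetric] using n by linarith
  qed
qed

text \<open>A second-order Taylor bound with crude remainder. Multiplication by \<open>Q + P\<close>
  creates the quadratic term \<open>n Q^(n-1) P^2\<close>, at most \<open>4^n d^2 m^(n+1)\<close>
  because \<open>n < 2^n\<close>, and at most doubles the old remainder times \<open>m\<close>; and
  \<open>1 + 2 \<le> 4\<close>.\<close>

lemma power_add_upper_nonneg:
  fixes Q P m d :: real
  assumes "0 \<le> Q" "Q \<le> m" "\<bar>P\<bar> \<le> d * m" "0 \<le> d" "d \<le> 1" "0 \<le> Q + P"
  shows "(Q + P) ^ n \<le> Q ^ n + real n * Q ^ (n - 1) * P + 4 ^ n * d\<^sup>2 * m ^ n"
proof (induction n)
  case (Suc n)
  have m: "m \<ge> 0" using assms by linarith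
  have "(Q + P) ^ Suc n \<le> (Q + P) * (Q ^ n + real n * Q ^ (n - 1) * P + 4 ^ n * d\<^sup>2 * m ^ n)"
    using Suc assms by (simp add: mult_left_mono)
  also have "\<dots> = Q ^ Suc n + real (Suc n) * Q ^ n * P + real n * Q ^ (n - 1) * P\<^sup>2 + (Q + P) * (4 ^ n * d\<^sup>2 * m ^ n)"
    by (cases n) (auto simp: algebra_simps power2_eq_square)
  also have "real n * Q ^ (n - 1) * P\<^sup>2 \<le> 4 ^ n * d\<^sup>2 * m ^ Suc n"
  proof (cases n)
    case (Suc k)
    have P: "P\<^sup>2 \<le> (d * m)\<^sup>2" using assms m by (metis abs_ge_zero power2_abs power_mono)
    have "Q ^ (n - 1) \<le> m ^ (n - 1)" using assms by (intro power_mono) auto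
    then have "real n * Q ^ (n - 1) * P\<^sup>2 \<le> 4 ^ n * m ^ (n - 1) * (d * m)\<^sup>2"
      using P m assms of_nat_less_two_power[of n, where 'a=real] power_mono[of 2 "4::real" n] by (intro mult_mono) auto
    also have "\<dots> = 4 ^ n * d\<^sup>2 * m ^ Suc n" using Suc by (simp add: power2_eq_square)
    finally show ?thesis .
  qed (use m in auto)
  also have "(Q + P) * (4 ^ n * d\<^sup>2 * m ^ n) \<le> (2 * m) * (4 ^ n * d\<^sup>2 * m ^ n)"
  proof -
    have "d * m \<le> 1 * m" using m assms by (intro mult_right_mono) auto
    then have "Q + P \<le> 2 * m" using assms by linarith
    then show ?thesis using m by (intro mult_right_mono) auto
  qed
  finally have "(Q + P) ^ Suc n \<le> Q ^ Suc n + real (Suc n) * Q ^ n * P + 3 * (4 ^ n * d\<^sup>2 * m ^ Suc n)"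
    by (simp add: algebra_simps)
  also have "3 * (4 ^ n * d\<^sup>2 * m ^ Suc n) \<le> 4 ^ Suc n * d\<^sup>2 * m ^ Suc n"
    using m by (simp add: mult_right_mono)
  finally show ?case by simp
qed simp

text \<open>Changing both signs reduces the claim to \<open>Q \<ge> 0\<close>. If then
  \<open>Q + P < 0\<close>, \<open>Q\<close> is smaller than \<open>|P|\<close>, so every term is of
  size \<open>(d m)^n\<close>, which is at most \<open>d^2 m^n\<close> because
  \<open>n \<ge> 2\<close>. For the trial functions, \<open>d\<close> is the small
  parameter.\<close>

lemma abs_add_power_upper:
  fixes Q P m d :: real
  assumes n: "n \<ge> 2" and "\<bar>Q\<bar> \<le> m" "\<bar>P\<bar> \<le> d * m" "0 \<le> d" "d \<le> 1"
  shows "\<bar>Q + P\<bar> ^ n \<le> \<bar>Q\<bar> ^ n + real n * \<bar>Q\<bar> ^ (n - 2) * (Q * P) + 4 ^ n * d\<^sup>2 * m ^ n"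
proof -
  have main: "\<bar>Q + P\<bar> ^ n \<le> Q ^ n + real n * Q ^ (n - 2) * (Q * P) + 4 ^ n * d\<^sup>2 * m ^ n"
    if Q: "0 \<le> Q" "Q \<le> m" and P: "\<bar>P\<bar> \<le> d * m" for Q P
  proof -
    have m: "m \<ge> 0" using Q by simp
    have e: "Q ^ (n - 2) * (Q * P) = Q ^ (n - 1) * P"
      using n by (cases n; cases "n - 1") (auto simp: numeral_2_eq_2)
    show ?thesis
    proof (cases "Q + P \<ge> 0")
      case True
      then show ?thesis using power_add_upper_nonneg[OF Q P assms(4,5) True, of n] by (simp add: mult.assoc e)
    next
      case False
      have dn: "(d * m) ^ n \<le> d\<^sup>2 * m ^ n"
        unfolding power_mult_distrib using n m assms by (intro mult_right_mono power_decreasing) auto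
      have "\<bar>Q + P\<bar> ^ n \<le> (d * m) ^ n" using False Q P by (intro power_mono) auto
      moreover have "real n * (Q ^ (n - 1) * - P) \<le> real n * (d * m) ^ n"
      proof -
        have "Q ^ (n - 1) * - P \<le> (d * m) ^ (n - 1) * (d * m)"
          using False Q P by (intro mult_mono power_mono) auto
        also have "\<dots> = (d * m) ^ n" using n by (simp flip: power_Suc2)
        finally show ?thesis by (rule mult_left_mono) simp
      qed
      ultimately have "\<bar>Q + P\<bar> ^ n + real n * (Q ^ (n - 1) * - P) \<le> (d * m) ^ n + real n * (d * m) ^ n"
        by (rule add_mono)
      then have "\<bar>Q + P\<bar> ^ n - real n * (Q ^ (n - 1) * P) \<le> (1 + real n) * (d * m) ^ n"
        unfolding distrib_right by simp
      also have "\<dots> \<le> (1 + real n) * (d\<^sup>2 * m ^ n)" by (intro mult_left_mono dn) auto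
      also have "\<dots> \<le> 4 ^ n * (d\<^sup>2 * m ^ n)"
      proof (intro mult_right_mono)
        have "1 + real n * 3 \<le> (1 + 3) ^ n" by (rule Bernoulli_inequality) auto
        then show "1 + real n \<le> 4 ^ n" by simp
      qed (use m in auto)
      finally have "\<bar>Q + P\<bar> ^ n \<le> real n * (Q ^ (n - 1) * P) + 4 ^ n * (d\<^sup>2 * m ^ n)" by simp
      moreover have "Q ^ n \<ge> 0" using Q by simp
      ultimately show ?thesis unfolding mult.assoc e by linarith
    qed
  qed
  show ?thesis
  proof (cases "Q \<ge> 0")
    case True
    then show ?thesis using main[of Q P] assms by simp
  next
    case False
    have "\<bar>- Q + - P\<bar> = \<bar>Q + P\<bar>" by linarith
    then show ?thesis using main[of "- Q" "- P"] False assms by simp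
  qed
qed

section \<open>The Hardy deficit\<close>

lemma lborel_integral_scaleR:
  fixes f :: "'a::euclidean_space \<Rightarrow> real"
  assumes "c > 0" and [measurable]: "f \<in> borel_measurable borel"
  shows "(\<integral>x. f (c *\<^sub>R x) \<partial>lborel) = (\<integral>x. f x \<partial>lborel) / c ^ DIM('a)"
proof -
  have "(\<integral>x. f x \<partial>lborel) = (\<integral>x. f x \<partial>density (distr lborel borel (\<lambda>x. 0 + c *\<^sub>R x)) (\<lambda>_. \<bar>c\<bar>^DIM('a)))"
    using lborel_affine[of c "0::'a"] assms by simp
  also have "\<dots> = \<bar>c\<bar>^DIM('a) * (\<integral>x. f (c *\<^sub>R x) \<partial>lborel)"
    using assms by (subst integral_density) (auto simp: integral_distr)
  finally show ?thesis using assms by simp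
qed

lemma continuous_on_zero_extend:
  fixes f :: "'a::t2_space \<Rightarrow> 'b::real_normed_vector"
  assumes "compact K" "K \<subseteq> U" "open U" "continuous_on U f" "\<And>x. x \<notin> K \<Longrightarrow> f x = 0"
  shows "continuous_on UNIV f"
proof -
  have "continuous_on (U \<union> - K) f"
  proof (rule continuous_on_open_Un)
    show "continuous_on (- K) f" using assms by (subst continuous_on_cong[of _ _ _ "\<lambda>_. 0"]) auto
  qed (use assms compact_imp_closed in auto)
  moreover have "U \<union> - K = UNIV" using assms by auto
  ultimately show ?thesis by simp
qed

lemma integrable_continuous_compact_support:
  fixes f :: "'a::euclidean_space \<Rightarrow> real"
  assumes "compact K" "continuous_on UNIV f" "\<And>x. x \<notin> K \<Longrightarrow> f x = 0"
  shows "integrable lborel f"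
proof -
  have "integrable lborel (\<lambda>x. indicator K x *\<^sub>R f x)"
    using assms by (intro borel_integrable_compact) (auto intro: continuous_on_subset)
  also have "(\<lambda>x. indicator K x *\<^sub>R f x) = f" using assms(3) by (auto simp: indicator_def fun_eq_iff)
  finally show ?thesis .
qed

text \<open>This takes the place of the divergence theorem for the field
  \<open>f(x) x / |x|^n\<close>. The function \<open>l^(n-1) Hf(l x)\<close> on
  \<open>1 \<le> l \<le> 2\<close> is integrated in both orders. Over \<open>x\<close> first,
  scaling yields \<open>ln 2\<close> times the integral in question; over \<open>l\<close> first,
  the fundamental theorem yields a difference whose integral vanishes by dilation
  invariance.\<close>

lemma euler_field_integral_zero:
  fixes f :: "'a::euclidean_space \<Rightarrow> real" and G :: "'a \<Rightarrow> 'a"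
  assumes K: "compact K" "0 \<notin> K"
    and f0: "\<And>x. x \<notin> K \<Longrightarrow> f x = 0"
    and G0: "\<And>x. x \<notin> K \<Longrightarrow> G x = 0"
    and der: "\<And>x. (f has_derivative (\<lambda>h. G x \<bullet> h)) (at x)"
    and cont: "continuous_on UNIV G"
  shows "(\<integral>x. (G x \<bullet> x) / norm x ^ DIM('a) \<partial>lborel) = 0"
proof -
  let ?n = "DIM('a)"
  define Hf where "Hf x = (G x \<bullet> x) / norm x ^ ?n" for x
  define gf where "gf x = f x / norm x ^ ?n" for x
  have U: "open (- {0::'a})" by auto
  have Kc: "K \<subseteq> - {0}" using K by auto
  have fcont: "continuous_on UNIV f" using der by (auto intro!: has_derivative_continuous_on)
  have Hcont: "continuous_on UNIV Hf"
    by (rule continuous_on_zero_extend[OF K(1) Kc U])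
       (auto simp: Hf_def G0 intro!: continuous_intros continuous_on_subset[OF cont])
  have gcont: "continuous_on UNIV gf"
    by (rule continuous_on_zero_extend[OF K(1) Kc U])
       (auto simp: gf_def f0 intro!: continuous_intros continuous_on_subset[OF fcont])
  have H0: "Hf x = 0" if "x \<notin> K" for x using that G0 by (auto simp: Hf_def)
  have g0: "gf x = 0" if "x \<notin> K" for x using that f0 by (auto simp: gf_def)
  have Hmeas[measurable]: "Hf \<in> borel_measurable borel" using Hcont by (rule borel_measurable_continuous_onI)
  have gmeas[measurable]: "gf \<in> borel_measurable borel" using gcont by (rule borel_measurable_continuous_onI)
  obtain b where b: "\<And>x. x \<in> K \<Longrightarrow> norm x \<le> b" using compact_imp_bounded[OF K(1)] bounded_iff by metis
  \<comment> \<open>The weight \<open>l ^ (n - 1)\<close> turns \<open>Hf (l x)\<close> into the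
    \<open>l\<close>-derivative of \<open>f (l x) / |x| ^ n\<close>.\<close>
  define P where "P = (\<lambda>(l::real, x). indicator {1..2} l * (l ^ (?n - 1) * Hf (l *\<^sub>R x)))"
  have Pint: "integrable (lborel \<Otimes>\<^sub>M lborel) P"
  proof -
    have "integrable lborel (\<lambda>z. indicator ({1..2} \<times> cball 0 b) z *\<^sub>R (fst z ^ (?n - 1) * Hf (fst z *\<^sub>R snd z)))"
      by (intro borel_integrable_compact compact_Times continuous_intros continuous_on_compose2[OF Hcont]) auto
    also have "(\<lambda>z. indicator ({1..2} \<times> cball 0 b) z *\<^sub>R (fst z ^ (?n - 1) * Hf (fst z *\<^sub>R snd z))) = P"
    proof (rule ext, clarify)
      fix l :: real and x :: 'a
      have "Hf (l *\<^sub>R x) = 0" if "l \<in> {1..2}" "norm x > b"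
      proof (rule H0, rule notI)
        assume "l *\<^sub>R x \<in> K"
        from b[OF this] that have "l * norm x \<le> b" by simp
        moreover have "1 * norm x \<le> l * norm x" using that by (intro mult_right_mono) auto
        ultimately show False using that by simp
      qed
      then show "indicator ({1..2} \<times> cball 0 b) (l, x) *\<^sub>R (fst (l, x) ^ (?n - 1) * Hf (fst (l, x) *\<^sub>R snd (l, x))) = P (l, x)"
        by (auto simp: P_def indicator_def split: if_splits)
    qed
    finally show ?thesis by (simp add: lborel_prod)
  qed
  have n0: "?n > 0" by simp
  have 1: "(\<integral>x. P (l, x) \<partial>lborel) = (indicator {1..2} l / l) * (\<integral>x. Hf x \<partial>lborel)" for l
  proof (cases "l \<in> {1..2}")
    case True
    have "l ^ ?n = l ^ (?n - 1) * l" using n0 by (metis power_minus_mult)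
    then show ?thesis using True by (simp add: P_def lborel_integral_scaleR field_simps)
  qed (simp add: P_def)
  have 2: "(\<integral>l. P (l, x) \<partial>lborel) = 2 ^ ?n * gf (2 *\<^sub>R x) - gf x" for x
  proof (cases "x = 0")
    case True
    then show ?thesis using H0[of 0] g0[of 0] K by (simp add: P_def)
  next
    case False
    have "(\<integral>l. (l ^ (?n - 1) * Hf (l *\<^sub>R x)) * indicator {1..2} l \<partial>lborel) = f (2 *\<^sub>R x) / norm x ^ ?n - f (1 *\<^sub>R x) / norm x ^ ?n"
    proof (rule integral_FTC_Icc_real)
      fix l :: real assume l: "1 \<le> l" "l \<le> 2"
      have "((\<lambda>l. f (l *\<^sub>R x)) has_derivative (\<lambda>h. G (l *\<^sub>R x) \<bullet> (h *\<^sub>R x))) (at l)"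
        by (rule has_derivative_compose[OF _ der, of "\<lambda>l. l *\<^sub>R x"]) (auto intro!: derivative_eq_intros)
      then have "((\<lambda>l. f (l *\<^sub>R x)) has_real_derivative (G (l *\<^sub>R x) \<bullet> x)) (at l)"
        by (simp add: has_field_derivative_def mult_commute_abs)
      then have "((\<lambda>l. f (l *\<^sub>R x) / norm x ^ ?n) has_real_derivative (G (l *\<^sub>R x) \<bullet> x) / norm x ^ ?n) (at l)"
        by (rule DERIV_cdivide)
      moreover have "(G (l *\<^sub>R x) \<bullet> x) / norm x ^ ?n = l ^ (?n - 1) * Hf (l *\<^sub>R x)"
      proof -
        have "l ^ ?n = l ^ (?n - 1) * l" using n0 by (metis power_minus_mult)
        then show ?thesis using l False by (simp add: Hf_def power_mult_distrib field_simps)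
      qed
      ultimately show "((\<lambda>l. f (l *\<^sub>R x) / norm x ^ ?n) has_real_derivative l ^ (?n - 1) * Hf (l *\<^sub>R x)) (at l)"
        by simp
      show "isCont (\<lambda>l. l ^ (?n - 1) * Hf (l *\<^sub>R x)) l"
        using continuous_on_compose2[OF Hcont, of UNIV "\<lambda>l. l *\<^sub>R x"]
        by (intro continuous_intros) (auto simp: continuous_on_eq_continuous_at intro!: continuous_intros)
    qed simp
    then show ?thesis using False by (simp add: P_def gf_def power_mult_distrib mult.commute[of "indicator _ _"])
  qed
  have gint: "integrable lborel gf" using integrable_continuous_compact_support[OF K(1) gcont g0] .
  have gint2: "integrable lborel (\<lambda>x. gf (2 *\<^sub>R x))"
  proof (rule integrable_continuous_compact_support[of "cball 0 b"])
    show "continuous_on UNIV (\<lambda>x. gf (2 *\<^sub>R x))"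
      by (intro continuous_on_compose2[OF gcont] continuous_intros) auto
    show "gf (2 *\<^sub>R x) = 0" if "x \<notin> cball 0 b" for x
      using b[of "2 *\<^sub>R x"] that by (intro g0) (auto, metis norm_ge_zero add_increasing2 mult_2 not_le order_trans less_imp_le)
  qed auto
  have "(\<integral>l. (\<integral>x. P (l, x) \<partial>lborel) \<partial>lborel) = (\<integral>x. (\<integral>l. P (l, x) \<partial>lborel) \<partial>lborel)"
    using lborel_pair.Fubini_integral[of "\<lambda>l x. P (l, x)"] Pint by simp
  also have "\<dots> = 2 ^ ?n * (\<integral>x. gf (2 *\<^sub>R x) \<partial>lborel) - (\<integral>x. gf x \<partial>lborel)"
    unfolding 2 using gint gint2 by simp
  also have "\<dots> = 0" by (simp add: lborel_integral_scaleR)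
  finally have "(\<integral>l. indicator {1..2} l / l \<partial>lborel) * (\<integral>x. Hf x \<partial>lborel) = 0"
    unfolding 1 integral_mult_left_zero .
  moreover have "(\<integral>l. inverse l * indicator {1..2} l \<partial>lborel) = ln 2 - ln (1::real)"
    by (rule integral_FTC_Icc_real) (auto intro!: derivative_eq_intros continuous_intros simp: divide_inverse)
  ultimately show ?thesis unfolding Hf_def by (auto simp: divide_inverse mult.commute)
qed

text \<open>Away from 0 the sign is locally constant, so \<open>|z|\<close> is linear there. At 0
  the difference quotient is bounded by \<open>|h| ^ (n - 1)\<close>, which tends to 0 because
  \<open>n \<ge> 2\<close>.\<close>

lemma abs_power_has_derivative:
  fixes y :: real
  assumes n: "n \<ge> 2"
  shows "((\<lambda>y. \<bar>y\<bar> ^ n) has_real_derivative real n * \<bar>y\<bar> ^ (n - 2) * y) (at y)"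
proof (cases "y = 0")
  case True
  have "(\<lambda>h::real. \<bar>h\<bar> ^ n / h) \<midarrow>0\<rightarrow> 0"
  proof (rule Lim_null_comparison)
    show "\<forall>\<^sub>F h in at (0::real). norm (\<bar>h\<bar> ^ n / h) \<le> \<bar>h\<bar> ^ (n - 1)"
    proof (intro always_eventually allI)
      fix h :: real
      show "norm (\<bar>h\<bar> ^ n / h) \<le> \<bar>h\<bar> ^ (n - 1)"
        using power_split2(3)[OF n, of "\<bar>h\<bar>"] by (cases "h = 0") auto
    qed
    have "(\<lambda>h::real. \<bar>h\<bar> ^ (n - 1)) \<midarrow>0\<rightarrow> \<bar>0\<bar> ^ (n - 1)" by (intro tendsto_intros)
    then show "(\<lambda>h::real. \<bar>h\<bar> ^ (n - 1)) \<midarrow>0\<rightarrow> 0" using n by (simp add: power_0_left)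
  qed
  then show ?thesis using True n by (simp add: DERIV_def power_0_left)
next
  case False
  have "\<forall>\<^sub>F z in nhds y. sgn z = sgn y"
  proof (cases "y > 0")
    case True
    then have "\<forall>\<^sub>F z in nhds y. z \<in> {0<..}" by (intro eventually_nhds_in_open) auto
    then show ?thesis by (rule eventually_mono) (use True in auto)
  next
    case f: False
    with False have "\<forall>\<^sub>F z in nhds y. z \<in> {..<0}" by (intro eventually_nhds_in_open) auto
    then show ?thesis by (rule eventually_mono) (use f False in auto)
  qed
  then have ev: "\<forall>\<^sub>F z in nhds y. (sgn y * z) ^ n = \<bar>z\<bar> ^ n"
    by eventually_elim (metis abs_sgn mult.commute)
  have sy: "sgn y * y = \<bar>y\<bar>" by (metis abs_sgn mult.commute)
  have "((\<lambda>z. (sgn y * z) ^ n) has_real_derivative real n * (sgn y * y) ^ (n - 1) * sgn y) (at y)"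
    by (auto intro!: derivative_eq_intros)
  also have "real n * (sgn y * y) ^ (n - 1) * sgn y = real n * \<bar>y\<bar> ^ (n - 2) * y"
    unfolding sy power_split2(2)[OF n] using abs_mult_sgn[of y] by (simp add: mult_ac)
  finally show ?thesis using DERIV_cong_ev[OF refl ev refl] by blast
qed

section \<open>Ground state substitution in a punctured ball\<close>

text \<open>\<open>G\<close> is the gradient of \<open>u\<close>, represented through the inner
  product. A support inside the open ball without its centre keeps \<open>X (|x| / R)\<close>
  differentiable and in \<open>(0, 1]\<close> there, so the integrands below extend by zero to
  continuous functions on the whole space.\<close>

locale punctured_function =
  fixes u :: "'a::euclidean_space \<Rightarrow> real" and G :: "'a \<Rightarrow> 'a" and K :: "'a set" and R :: real and n :: nat
  assumes n: "n = DIM('a)" and dim: "n \<ge> 2"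
    and K: "compact K" "K \<subseteq> ball 0 R - {0}"
    and R: "R > 0"
    and u0: "\<And>x. x \<notin> K \<Longrightarrow> u x = 0"
    and der: "\<And>x. (u has_derivative (\<lambda>h. G x \<bullet> h)) (at x)"
    and cont: "continuous_on UNIV G"
begin

lemma n_pos [simp]: "n > 0" "n \<noteq> 0" using dim by auto

definition xi :: "'a \<Rightarrow> real" where "xi x = X (norm x / R)"

abbreviation "V \<equiv> ball 0 R - {0::'a}"

definition a :: real where "a = (real n - 1) / real n"

lemma na: "real n * a = real n - 1" and a_nonneg: "a \<ge> 0" and a_le: "a \<le> 1"
  using dim by (auto simp: a_def)

lemma openV: "open V" by auto

lemma s_gt: "x \<in> V \<Longrightarrow> 1 - ln (norm x / R) > 1"
  using R by (auto simp: ln_less_zero)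

lemma xi_pos: "x \<in> V \<Longrightarrow> xi x > 0" and xi_le: "x \<in> V \<Longrightarrow> xi x \<le> 1"
  using s_gt[of x] by (auto simp: xi_def X_def inverse_le_1_iff)

lemma ucont: "continuous_on UNIV u"
  using der by (auto intro!: has_derivative_continuous_on)

lemma G0: "G x = 0" if "x \<notin> K"
proof -
  have "open (- K)" using K compact_imp_closed by auto
  then have "(u has_derivative (\<lambda>h. 0)) (at x)"
    using has_derivative_transform_within_open[of "\<lambda>_. 0" "\<lambda>_. 0" x UNIV "- K" u] that u0 by auto
  then have "(\<lambda>h. G x \<bullet> h) = (\<lambda>h. 0)" using der has_derivative_unique by blast
  then show ?thesis by (metis inner_eq_zero_iff)
qed

text \<open>The identity \<open>t X'(t) = X(t)^2\<close> is behind this formula; as a consequence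
  each differentiation of a power of \<open>xi\<close> gains one power of \<open>xi\<close>.\<close>

lemma xi_der:
  assumes "x \<in> V"
  shows "(xi has_derivative (\<lambda>h. ((xi x)\<^sup>2 / (norm x)\<^sup>2) *\<^sub>R x \<bullet> h)) (at x)"
proof -
  have x: "x \<noteq> 0" "norm x / R > 0" "ln (norm x / R) \<noteq> 1" using assms R s_gt[OF assms] by (simp, simp, linarith)
  have "(xi has_derivative (\<lambda>h. - (inverse (1 - ln (norm x / R)) * (0 - (sgn x \<bullet> h) / R * inverse (norm x / R)) * inverse (1 - ln (norm x / R))))) (at x)"
    unfolding xi_def[abs_def] X_def using x s_gt[OF assms] R
    by (auto intro!: derivative_eq_intros has_derivative_norm simp: inner_commute)
       (use x(3) in blast)
  also have "(\<lambda>h. - (inverse (1 - ln (norm x / R)) * (0 - (sgn x \<bullet> h) / R * inverse (norm x / R)) * inverse (1 - ln (norm x / R))))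
     = (\<lambda>h. ((xi x)\<^sup>2 / (norm x)\<^sup>2) *\<^sub>R x \<bullet> h)"
    using x R by (auto simp: xi_def X_def sgn_div_norm power2_eq_square field_simps fun_eq_iff)
  finally show ?thesis .
qed

lemma xi_powr_der:
  assumes "x \<in> V"
  shows "((\<lambda>x. xi x powr b) has_derivative (\<lambda>h. (b * xi x powr (b + 1) / (norm x)\<^sup>2) *\<^sub>R x \<bullet> h)) (at x)"
proof -
  have "((\<lambda>x. xi x powr b) has_derivative (\<lambda>h. (xi x powr b) * (0 * ln (xi x) + (((xi x)\<^sup>2 / (norm x)\<^sup>2) *\<^sub>R x \<bullet> h) * b / xi x))) (at x)"
    using xi_pos[OF assms] by (intro has_derivative_powr xi_der[OF assms] derivative_intros) auto
  also have "(\<lambda>h. (xi x powr b) * (0 * ln (xi x) + (((xi x)\<^sup>2 / (norm x)\<^sup>2) *\<^sub>R x \<bullet> h) * b / xi x)) =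
     (\<lambda>h. (b * xi x powr (b + 1) / (norm x)\<^sup>2) *\<^sub>R x \<bullet> h)"
    using xi_pos[OF assms] by (auto simp: powr_add power2_eq_square)
  finally show ?thesis .
qed

lemma xi_cont [continuous_intros]: "continuous_on V xi"
  using xi_der by (meson continuous_at_imp_continuous_on has_derivative_continuous)

lemma contV: "continuous_on V u" "continuous_on V G"
  using ucont cont continuous_on_subset by blast+

lemma cont_extend:
  fixes h :: "'a \<Rightarrow> 'b::real_normed_vector"
  assumes "continuous_on V h" "\<And>x. x \<notin> K \<Longrightarrow> h x = 0"
  shows "continuous_on UNIV h"
  using continuous_on_zero_extend[OF K(1) _ openV assms] K by auto

lemma integrableI:
  fixes h :: "'a \<Rightarrow> real"
  assumes "continuous_on V h" "\<And>x. x \<notin> K \<Longrightarrow> h x = 0"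
  shows "integrable lborel h"
  using integrable_continuous_compact_support[OF K(1) cont_extend] assms by auto

lemma xi_cont_powr [continuous_intros]: "continuous_on V (\<lambda>x. xi x powr b)"
  by (intro continuous_intros) (use xi_pos in force)

text \<open>\<open>J b\<close> is the divergence of the vector field \<open>|u|\<^sup>n \<xi> powr b x / |x|\<^sup>n\<close>.\<close>

definition J :: "real \<Rightarrow> 'a \<Rightarrow> real" where
  "J b x = (real n * \<bar>u x\<bar> ^ (n - 2) * u x * xi x powr b * (G x \<bullet> x) + b * \<bar>u x\<bar> ^ n * xi x powr (b + 1)) / norm x ^ n"

lemma u0_pow: "x \<notin> K \<Longrightarrow> \<bar>u x\<bar> ^ n = 0"
  using u0 dim by (auto simp: power_0_left)

lemma product_integrable:
  "integrable lborel (\<lambda>x. \<bar>u x\<bar> ^ n * xi x powr b / norm x ^ n)"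
  by (rule integrableI) (auto intro!: continuous_intros contV simp: u0 power_0_left)

lemma J_integrable: "integrable lborel (J b)"
  unfolding J_def[abs_def]
  by (rule integrableI) (auto intro!: continuous_intros contV simp: u0 power_0_left)

text \<open>Apply \<open>euler_field_integral_zero\<close> to \<open>|u|^n xi powr b\<close>: its
  derivative in the direction \<open>x\<close>, divided by \<open>|x|^n\<close>, is
  \<open>J b\<close>. The deficit uses \<open>b = n - 1\<close>, the weighted Hardy inequality a
  larger \<open>b\<close>.\<close>

lemma J_integral: "(\<integral>x. J b x \<partial>lborel) = 0"
proof -
  define f where "f x = \<bar>u x\<bar> ^ n * xi x powr b" for x
  define F where "F x = (real n * \<bar>u x\<bar> ^ (n - 2) * u x * xi x powr b) *\<^sub>R G x
       + (b * \<bar>u x\<bar> ^ n * xi x powr (b + 1) / (norm x)\<^sup>2) *\<^sub>R x" for x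
  have f0: "f x = 0" if "x \<notin> K" for x using that by (simp add: f_def u0_pow)
  have F0: "F x = 0" if "x \<notin> K" for x using that by (simp add: F_def u0 power_0_left)
  have "(f has_derivative (\<lambda>h. F x \<bullet> h)) (at x)" for x
  proof (cases "x \<in> K")
    case True
    then have x: "x \<in> V" using K by auto
    have "((\<lambda>x. \<bar>u x\<bar> ^ n) has_derivative (\<lambda>h. (real n * \<bar>u x\<bar> ^ (n - 2) * u x) * (G x \<bullet> h))) (at x)"
      using has_derivative_compose[OF der abs_power_has_derivative[OF dim, THEN has_field_derivative_imp_has_derivative]]
      by simp
    from has_derivative_mult[OF this xi_powr_der[OF x, of b]]
    show ?thesis unfolding f_def[abs_def] F_def
      by (simp add: inner_simps algebra_simps)
  next
    case False
    have "open (- K)" using K compact_imp_closed by auto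
    then have "(f has_derivative (\<lambda>h. 0)) (at x)"
      using has_derivative_transform_within_open[of "\<lambda>_. 0" "\<lambda>_. 0" x UNIV "- K" f] False f0 by auto
    then show ?thesis using F0[OF False] by simp
  qed
  moreover have "continuous_on UNIV F"
    unfolding F_def[abs_def] using F0 unfolding F_def[abs_def]
    by (intro cont_extend) (auto intro!: continuous_intros contV simp: u0)
  ultimately have "(\<integral>x. (F x \<bullet> x) / norm x ^ n \<partial>lborel) = 0"
    using K f0 F0 unfolding n by (intro euler_field_integral_zero[of K f F]) auto
  moreover have "(F x \<bullet> x) / norm x ^ n = J b x" for x
    by (auto simp: F_def J_def inner_simps power2_norm_eq_inner[symmetric] field_simps)
  ultimately show ?thesis by simp
qed

definition p :: "'a \<Rightarrow> 'a" where
  "p x = G x + (a * u x * xi x / (norm x)\<^sup>2) *\<^sub>R x"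

text \<open>This is \<open>u (\<nabla>\<phi>) / \<phi>\<close> for the ground state
  \<open>\<phi>\<close>; together with \<open>p\<close> it is the product rule for
  \<open>u = \<phi> (u / \<phi>)\<close>.\<close>

definition q :: "'a \<Rightarrow> 'a" where
  "q x = - (a * u x * xi x / (norm x)\<^sup>2) *\<^sub>R x"

lemma p_plus_q: "p x + q x = G x" by (simp add: p_def q_def)

lemma norm_q: "x \<in> V \<Longrightarrow> norm (q x) = a * \<bar>u x\<bar> * xi x / norm x"
  using xi_pos[of x] a_nonneg by (auto simp: q_def abs_mult power2_eq_square)

text \<open>The left side is the first-order expansion of \<open>|p + q|^n\<close> at
  \<open>q\<close>. Writing \<open>p\<close> in terms of \<open>G\<close> produces the terms of
  \<open>J (n - 1)\<close>, and the coefficient of \<open>|u|^n xi^n\<close> fits exactly because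
  \<open>n a = n - 1\<close>; this is what singles out the constant \<open>a ^ n\<close> of the
  Hardy functional.\<close>

lemma cross_term:
  assumes "x \<in> V"
  shows "norm (q x) ^ n + real n * norm (q x) ^ (n - 2) * (q x \<bullet> p x)
     = a ^ n * (\<bar>u x\<bar> ^ n / norm x ^ n * xi x ^ n) - a ^ (n - 1) * J (real n - 1) x"
proof -
  have x: "norm x > 0" "xi x > 0" using assms xi_pos by auto
  define t where "t = a * u x * xi x"
  have qp: "q x \<bullet> p x = - t * ((G x \<bullet> x) + t) / (norm x)\<^sup>2"
    using x by (simp add: q_def p_def inner_simps power2_norm_eq_inner[symmetric] inner_commute[of x] t_def[symmetric] distrib_left add_divide_distrib diff_divide_distrib)
  have pw: "xi x powr (real n - 1) = xi x ^ (n - 2) * xi x"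
    using x dim powr_realpow[of "xi x" "n - 1"] power_split2(2)[OF dim, of "xi x"] by (simp add: of_nat_diff)
  have pw': "xi x powr (real n - 1 + 1) = xi x ^ (n - 2) * (xi x)\<^sup>2"
    using x powr_realpow[of "xi x" "n"] power_split2(1)[OF dim, of "xi x"] by simp
  have na': "real n * a = real n - 1" by (rule na)
  have "norm (q x) ^ (n - 2) = a ^ (n - 2) * \<bar>u x\<bar> ^ (n - 2) * xi x ^ (n - 2) / norm x ^ (n - 2)"
    by (simp add: norm_q[OF assms] power_mult_distrib power_divide)
  then have "real n * norm (q x) ^ (n - 2) * (q x \<bullet> p x) =
     - (a ^ (n - 2)) * \<bar>u x\<bar> ^ (n - 2) * xi x ^ (n - 2) * (real n * t * ((G x \<bullet> x) + t)) / (norm x ^ (n - 2) * (norm x)\<^sup>2)"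
    unfolding qp by simp
  also have "real n * t * ((G x \<bullet> x) + t) = a * (real n * u x * xi x * (G x \<bullet> x) + (real n * a) * (u x)\<^sup>2 * (xi x)\<^sup>2)"
    by (simp add: t_def power2_eq_square algebra_simps)
  also have "- (a ^ (n - 2)) * \<bar>u x\<bar> ^ (n - 2) * xi x ^ (n - 2) * (a * (real n * u x * xi x * (G x \<bullet> x) + (real n * a) * (u x)\<^sup>2 * (xi x)\<^sup>2)) / (norm x ^ (n - 2) * (norm x)\<^sup>2)
     = - (a ^ (n - 1)) * J (real n - 1) x"
    unfolding J_def pw pw' na' power_split2(1)[OF dim, of "norm x"] power_split2(1)[OF dim, of "\<bar>u x\<bar>"]
       power_split2(2)[OF dim, of a]
    by (simp add: algebra_simps power2_eq_square add_divide_distrib diff_divide_distrib)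
  finally show ?thesis
    by (simp add: norm_q[OF assms] power_mult_distrib power_divide)
qed

lemma p0: "x \<notin> K \<Longrightarrow> p x = 0" using u0 G0 by (simp add: p_def)

lemma p_cont: "continuous_on V p"
  unfolding p_def[abs_def] by (intro continuous_intros contV) auto

lemma p_integrable: "integrable lborel (\<lambda>x. norm (p x) ^ n)"
  by (rule integrableI) (auto intro!: continuous_intros p_cont simp: p0)

lemma G_integrable: "integrable lborel (\<lambda>x. norm (G x) ^ n)"
  by (rule integrableI) (auto intro!: continuous_intros contV simp: G0)

lemma potential_integrable: "integrable lborel (\<lambda>x. \<bar>u x\<bar> ^ n / norm x ^ n * xi x ^ n)"
  by (rule integrableI) (auto intro!: continuous_intros contV simp: u0 power_0_left)

definition hardy_deficit :: real where
  "hardy_deficit = (\<integral>x. norm (G x) ^ n \<partial>lborel) - a ^ n * (\<integral>x. \<bar>u x\<bar> ^ n / norm x ^ n * xi x ^ n \<partial>lborel)"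

text \<open>Adding a multiple of \<open>J (n - 1)\<close>, whose integral is zero, makes the
  integrand on \<open>V\<close> equal to \<open>|p + q|^n\<close> minus its first-order expansion at
  \<open>q\<close>, by \<open>cross_term\<close>. It can then be estimated pointwise: from below by
  convexity, and from above for the trial functions.\<close>

lemma hardy_deficit_eq:
  "hardy_deficit = (\<integral>x. norm (G x) ^ n - a ^ n * (\<bar>u x\<bar> ^ n / norm x ^ n * xi x ^ n) + a ^ (n - 1) * J (real n - 1) x \<partial>lborel)"
  unfolding hardy_deficit_def
  using G_integrable potential_integrable J_integrable[of "real n - 1"] J_integral[of "real n - 1"]
  by (simp only: integrable_mult_right Bochner_Integration.integral_add Bochner_Integration.integral_diff
      Bochner_Integration.integrable_add Bochner_Integration.integrable_diff integral_mult_right_zero)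

lemma hardy_deficit_lower: "hardy_deficit \<ge> conv_const n * (\<integral>x. norm (p x) ^ n \<partial>lborel)"
proof -
  have "(\<integral>x. conv_const n * norm (p x) ^ n \<partial>lborel) \<le> hardy_deficit"
    unfolding hardy_deficit_eq
  proof (rule integral_mono)
    fix x
    show "conv_const n * norm (p x) ^ n \<le> norm (G x) ^ n - a ^ n * (\<bar>u x\<bar> ^ n / norm x ^ n * xi x ^ n) + a ^ (n - 1) * J (real n - 1) x"
    proof (cases "x \<in> K")
      case True
      then have "x \<in> V" using K by auto
      from cross_term[OF this] norm_add_power_lower[OF dim, of "q x" "p x"] show ?thesis
        unfolding p_plus_q by linarith
    next
      case False
      then show ?thesis by (simp add: p0 G0 u0 J_def power_0_left)
    qed
    show "integrable lborel (\<lambda>x. norm (G x) ^ n - a ^ n * (\<bar>u x\<bar> ^ n / norm x ^ n * xi x ^ n) + a ^ (n - 1) * J (real n - 1) x)"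
      by (intro Bochner_Integration.integrable_add Bochner_Integration.integrable_diff
          integrable_mult_right G_integrable potential_integrable J_integrable)
  qed (use p_integrable in auto)
  then show ?thesis by simp
qed

section \<open>Weighted Hardy inequality and the energy of \<open>w\<close>\<close>

text \<open>Expressing \<open>G\<close> through \<open>p\<close> in \<open>J b\<close> leaves a
  positive multiple of the weighted potential plus a term linear in \<open>p\<close>. Since
  \<open>J b\<close> integrates to zero, Young's inequality bounds the potential by the energy of
  \<open>p\<close>; on that energy the weight is dropped, as it is at most 1.\<close>

lemma weighted_hardy:
  assumes "e > 0"
  shows "(\<integral>x. \<bar>u x\<bar> ^ n * xi x powr (real n + e * real n) / norm x ^ n \<partial>lborel)
    \<le> (2 / e) ^ n * (\<integral>x. norm (p x) ^ n \<partial>lborel)"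
proof -
  define h where "h x = \<bar>u x\<bar> ^ n * xi x powr (real n + e * real n) / norm x ^ n" for x
  \<comment> \<open>This exceeds the exponent \<open>n - 1\<close> of \<open>cross_term\<close> by
    \<open>e n\<close>, so that \<open>b - n a = e n\<close> is positive.\<close>
  define b where "b = real n - 1 + e * real n"
  \<comment> \<open>Half of the coefficient \<open>e\<close> of \<open>h\<close> absorbs the
    \<open>A ^ n\<close> part of Young's inequality; the other half remains on the left.\<close>
  define d where "d = e / 2"
  have d: "d > 0" using assms by (simp add: d_def)
  have hint: "integrable lborel h" unfolding h_def[abs_def] by (rule product_integrable)
  have pt: "d * h x - (1 / d) ^ (n - 1) * norm (p x) ^ n \<le> J b x / real n" for x
  proof (cases "x \<in> K")
    case False
    then show ?thesis by (simp add: p0 G0 u0 J_def h_def power_0_left)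
  next
    case True
    then have x: "x \<in> V" using K by auto
    have pos: "norm x > 0" "xi x > 0" "xi x \<le> 1" using x xi_pos xi_le by auto
    define A where "A = \<bar>u x\<bar> * xi x / norm x"
    have A0: "A \<ge> 0" using pos by (simp add: A_def)
    define z where "z = xi x powr (e * real n)"
    have z: "0 \<le> z" "z \<le> 1" using pos assms by (auto simp: z_def powr_le1)
    have hz: "h x = z * A ^ n"
      using pos by (simp add: h_def z_def A_def powr_add powr_realpow power_mult_distrib power_divide)
    have pw: "xi x powr (real n - 1) = xi x ^ (n - 1)"
      using pos dim powr_realpow[of "xi x" "n - 1"] by (simp add: of_nat_diff)
    have Gx: "G x \<bullet> x = p x \<bullet> x - a * u x * xi x"
      using pos by (simp add: p_def inner_simps power2_norm_eq_inner[symmetric])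
    have "xi x powr b = xi x powr (real n - 1) * z" "xi x powr (b + 1) = xi x powr (real n) * z"
      unfolding b_def z_def powr_add[symmetric] by (simp_all add: algebra_simps)
    then have b1: "xi x powr b = xi x ^ (n - 1) * z" "xi x powr (b + 1) = xi x ^ n * z"
      using pos pw powr_realpow[of "xi x" n] by simp_all
    have uu: "\<bar>u x\<bar> ^ n = \<bar>u x\<bar> ^ (n - 2) * u x * u x" using power_split2(1)[OF dim, of "\<bar>u x\<bar>"] by (simp add: power2_eq_square)
    have ba: "b - real n * a = e * real n" by (simp add: na b_def)
    have "J b x = (real n * (\<bar>u x\<bar> ^ (n - 2) * u x * (xi x ^ (n - 1) * z) * (p x \<bullet> x)) + (b - real n * a) * \<bar>u x\<bar> ^ n * (xi x ^ n * z)) / norm x ^ n"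
      unfolding J_def b1 Gx uu power_split2(3)[OF dim, of "xi x"] by (simp add: algebra_simps)
    also have "\<dots> = real n * (z * (\<bar>u x\<bar> ^ (n - 2) * u x * xi x ^ (n - 1) * (p x \<bullet> x) / norm x ^ n) + e * h x)"
      unfolding ba hz using pos by (simp add: A_def power_mult_distrib power_divide field_simps)
    finally have Jn: "J b x / real n = z * (\<bar>u x\<bar> ^ (n - 2) * u x * xi x ^ (n - 1) * (p x \<bullet> x) / norm x ^ n) + e * h x"
      using dim by simp
    have "\<bar>\<bar>u x\<bar> ^ (n - 2) * u x * xi x ^ (n - 1) * (p x \<bullet> x) / norm x ^ n\<bar> \<le> \<bar>u x\<bar> ^ (n - 2) * \<bar>u x\<bar> * xi x ^ (n - 1) * (norm (p x) * norm x) / norm x ^ n"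
      using pos Cauchy_Schwarz_ineq2[of "p x" x] by (auto simp: abs_mult intro!: divide_right_mono mult_left_mono)
    also have "\<dots> = A ^ (n - 1) * norm (p x)"
      using pos unfolding power_split2(3)[OF dim, of "norm x"] A_def power_divide power_mult_distrib power_split2(2)[OF dim, of "\<bar>u x\<bar>"] by simp
    also have "\<dots> \<le> d * A ^ n + (1 / d) ^ (n - 1) * norm (p x) ^ n"
    proof (cases "norm (p x) \<le> d * A")
      case True
      then have "A ^ (n - 1) * norm (p x) \<le> A ^ (n - 1) * (d * A)" using A0 by (intro mult_left_mono) auto
      also have "\<dots> = d * A ^ n" by (simp add: power_split2(3)[OF dim, of A])
      finally show ?thesis using d by (simp add: add_increasing2)
    next
      case False
      then have "A \<le> norm (p x) / d" using d by (simp add: field_simps)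
      then have "A ^ (n - 1) \<le> (norm (p x) / d) ^ (n - 1)" using A0 by (rule power_mono)
      then have "A ^ (n - 1) * norm (p x) \<le> (norm (p x) / d) ^ (n - 1) * norm (p x)" by (rule mult_right_mono) auto
      also have "\<dots> = (1 / d) ^ (n - 1) * norm (p x) ^ n"
        by (simp add: power_split2(3)[OF dim, of "norm (p x)"] power_divide)
      finally show ?thesis using d A0 by (simp add: add_increasing)
    qed
    finally have "- (\<bar>u x\<bar> ^ (n - 2) * u x * xi x ^ (n - 1) * (p x \<bullet> x) / norm x ^ n) \<le> d * A ^ n + (1 / d) ^ (n - 1) * norm (p x) ^ n"
      by (rule order_trans[OF abs_ge_minus_self])
    then have "z * (- (\<bar>u x\<bar> ^ (n - 2) * u x * xi x ^ (n - 1) * (p x \<bullet> x) / norm x ^ n)) \<le> z * (d * A ^ n + (1 / d) ^ (n - 1) * norm (p x) ^ n)"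
      using z(1) by (rule mult_left_mono)
    also have "\<dots> \<le> d * h x + (1 / d) ^ (n - 1) * norm (p x) ^ n"
      using z d mult_right_mono[of z 1 "(1 / d) ^ (n - 1) * norm (p x) ^ n"] by (simp add: hz algebra_simps)
    finally show ?thesis unfolding Jn d_def by simp
  qed
  have "(\<integral>x. d * h x - (1 / d) ^ (n - 1) * norm (p x) ^ n \<partial>lborel) \<le> (\<integral>x. J b x / real n \<partial>lborel)"
    by (rule integral_mono[OF _ _ pt]) (use hint p_integrable J_integrable in auto)
  then have "d * integral\<^sup>L lborel h \<le> (1 / d) ^ (n - 1) * (\<integral>x. norm (p x) ^ n \<partial>lborel)"
    using hint p_integrable by (simp add: J_integral)
  then have "integral\<^sup>L lborel h \<le> (1 / d) ^ n * (\<integral>x. norm (p x) ^ n \<partial>lborel)"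
    unfolding power_split2(3)[OF dim, of "1 / d"] using d by (simp add: field_simps)
  then show ?thesis by (simp add: h_def[abs_def] d_def)
qed

definition w_grad :: "real \<Rightarrow> 'a \<Rightarrow> 'a" where
  "w_grad e x = xi x powr e *\<^sub>R (G x + (e * u x * xi x / (norm x)\<^sup>2) *\<^sub>R x)"

lemma w_der: "((\<lambda>x. u x * xi x powr e) has_derivative (\<lambda>h. w_grad e x \<bullet> h)) (at x)"
proof (cases "x \<in> K")
  case True
  then have x: "x \<in> V" using K by auto
  from has_derivative_mult[OF der xi_powr_der[OF x, of e]] show ?thesis
    unfolding w_grad_def using xi_pos[OF x] by (simp add: inner_simps algebra_simps powr_add)
next
  case False
  have "open (- K)" using K compact_imp_closed by auto
  then have "((\<lambda>x. u x * xi x powr e) has_derivative (\<lambda>h. 0)) (at x)"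
    using has_derivative_transform_within_open[of "\<lambda>_. 0" "\<lambda>_. 0" x UNIV "- K" "\<lambda>x. u x * xi x powr e"] False u0 by auto
  then show ?thesis using u0[OF False] G0[OF False] by (simp add: w_grad_def)
qed

lemma w_grad0: "x \<notin> K \<Longrightarrow> w_grad e x = 0" by (simp add: w_grad_def u0 G0)

lemma w_grad_cont: "continuous_on UNIV (w_grad e)"
proof (rule cont_extend)
  show "continuous_on V (w_grad e)" unfolding w_grad_def[abs_def] by (intro continuous_intros contV) auto
qed (rule w_grad0)

text \<open>Written with \<open>p\<close>, the gradient of \<open>w\<close> has the remainder
  \<open>(e - a) u xi x / |x|^2\<close> besides \<open>p\<close>, both times
  \<open>xi powr e\<close>. The \<open>n\<close>-th power of the weighted remainder is a multiple of
  the integrand of \<open>weighted_hardy\<close>.\<close>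

lemma w_energy:
  assumes "e > 0"
  shows "(\<integral>x. norm (w_grad e x) ^ n \<partial>lborel) \<le> 2 ^ n * (1 + \<bar>e - a\<bar> ^ n * (2 / e) ^ n) * (\<integral>x. norm (p x) ^ n \<partial>lborel)"
proof -
  define h where "h x = \<bar>u x\<bar> ^ n * xi x powr (real n + e * real n) / norm x ^ n" for x
  have hint: "integrable lborel h" unfolding h_def[abs_def] by (rule product_integrable)
  have "(\<integral>x. norm (w_grad e x) ^ n \<partial>lborel) \<le> (\<integral>x. 2 ^ n * (norm (p x) ^ n + \<bar>e - a\<bar> ^ n * h x) \<partial>lborel)"
  proof (rule integral_mono)
    show "integrable lborel (\<lambda>x. norm (w_grad e x) ^ n)"
      by (rule integrableI) (auto intro!: continuous_intros continuous_on_subset[OF w_grad_cont] simp: w_grad0)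
    show "integrable lborel (\<lambda>x. 2 ^ n * (norm (p x) ^ n + \<bar>e - a\<bar> ^ n * h x))"
      using hint p_integrable by simp
    fix x
    show "norm (w_grad e x) ^ n \<le> 2 ^ n * (norm (p x) ^ n + \<bar>e - a\<bar> ^ n * h x)"
    proof (cases "x \<in> K")
      case False
      then show ?thesis by (simp add: w_grad0 p0 h_def u0 power_0_left)
    next
      case True
      then have x: "x \<in> V" using K by auto
      have pos: "norm x > 0" "xi x > 0" "xi x \<le> 1" using x xi_pos xi_le by auto
      define A where "A = \<bar>u x\<bar> * xi x / norm x"
      have A0: "A \<ge> 0" using pos by (simp add: A_def)
      define z where "z = xi x powr (e * real n)"
      have z: "0 \<le> z" "z \<le> 1" using pos assms by (auto simp: z_def powr_le1)
      have zz: "(xi x powr e) ^ n = z" using pos by (simp add: z_def powr_powr flip: powr_realpow)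
      have hz: "h x = z * A ^ n"
        using pos by (simp add: h_def z_def A_def powr_add powr_realpow power_mult_distrib power_divide)
      \<comment> \<open>A sum is at most twice the maximum, and the \<open>n\<close>-th power of a
        maximum is at most the sum of the \<open>n\<close>-th powers; this is the origin of the
        factor \<open>2 ^ n\<close>.\<close>
      define m where "m = max (norm (p x)) (\<bar>e - a\<bar> * A)"
      have w: "w_grad e x = xi x powr e *\<^sub>R (p x + ((e - a) * u x * xi x / (norm x)\<^sup>2) *\<^sub>R x)"
        by (simp add: w_grad_def p_def algebra_simps diff_divide_distrib)
      have "norm (((e - a) * u x * xi x / (norm x)\<^sup>2) *\<^sub>R x) = \<bar>e - a\<bar> * A"
        using pos by (simp add: A_def abs_mult power2_eq_square)
      then have "norm (w_grad e x) \<le> xi x powr e * (norm (p x) + \<bar>e - a\<bar> * A)"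
        unfolding w using norm_triangle_ineq[of "p x" "((e - a) * u x * xi x / (norm x)\<^sup>2) *\<^sub>R x"] by (simp add: mult_left_mono)
      also have "\<dots> \<le> xi x powr e * (2 * m)" by (intro mult_left_mono) (auto simp: m_def)
      finally have "norm (w_grad e x) ^ n \<le> (xi x powr e * (2 * m)) ^ n" by (intro power_mono) auto
      also have "\<dots> = 2 ^ n * (z * m ^ n)" by (simp add: power_mult_distrib zz)
      also have "m ^ n \<le> norm (p x) ^ n + (\<bar>e - a\<bar> * A) ^ n"
        using A0 by (auto simp: m_def max_def)
      also have "z * (norm (p x) ^ n + (\<bar>e - a\<bar> * A) ^ n) \<le> norm (p x) ^ n + \<bar>e - a\<bar> ^ n * h x"
        using z mult_right_mono[of z 1 "norm (p x) ^ n"] by (simp add: hz power_mult_distrib algebra_simps)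
      finally show ?thesis using z by (simp add: mult_left_mono)
    qed
  qed
  also have "\<dots> = 2 ^ n * ((\<integral>x. norm (p x) ^ n \<partial>lborel) + \<bar>e - a\<bar> ^ n * integral\<^sup>L lborel h)"
    using hint p_integrable by simp
  also have "\<dots> \<le> 2 ^ n * ((\<integral>x. norm (p x) ^ n \<partial>lborel) + \<bar>e - a\<bar> ^ n * ((2 / e) ^ n * (\<integral>x. norm (p x) ^ n \<partial>lborel)))"
    using weighted_hardy[OF assms] by (intro mult_left_mono add_left_mono) (auto simp: h_def[abs_def])
  finally show ?thesis by (simp add: algebra_simps)
qed

end

section \<open>Trudinger's inequality\<close>

lemma nn_integral_lborel_affine:
  fixes f :: "'a::euclidean_space \<Rightarrow> ennreal"
  assumes "c > 0" and [measurable]: "f \<in> borel_measurable borel"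
  shows "(\<integral>\<^sup>+x. f x \<partial>lborel) = ennreal (c ^ DIM('a)) * (\<integral>\<^sup>+x. f (t + c *\<^sub>R x) \<partial>lborel)"
proof -
  have "(\<integral>\<^sup>+x. f x \<partial>lborel) = (\<integral>\<^sup>+x. f x \<partial>density (distr lborel borel (\<lambda>x. t + c *\<^sub>R x)) (\<lambda>_. \<bar>c\<bar>^DIM('a)))"
    using lborel_affine[of c t] assms by simp
  also have "\<dots> = ennreal (c ^ DIM('a)) * (\<integral>\<^sup>+x. f (t + c *\<^sub>R x) \<partial>lborel)"
    using assms by (subst nn_integral_density) (auto simp: nn_integral_distr nn_integral_cmult)
  finally show ?thesis .
qed

lemma nn_integral_lborel_translate:
  fixes f :: "'a::euclidean_space \<Rightarrow> ennreal"
  assumes [measurable]: "f \<in> borel_measurable borel"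
  shows "(\<integral>\<^sup>+x. f (x + t) \<partial>lborel) = (\<integral>\<^sup>+x. f x \<partial>lborel)"
  using nn_integral_lborel_affine[of 1 f t] by (simp add: add.commute)

text \<open>Either \<open>x \<le> l\<close>, or \<open>1 \<le> (x / l)^(n-1)\<close>. The parameter
  \<open>l\<close> will be \<open>1 / \<rho>\<close> near the base point of a ray and
  \<open>\<mu> / t\<close> far from it.\<close>

lemma young_power:
  fixes l x :: real
  assumes "l > 0" "x \<ge> 0" "n \<ge> 1"
  shows "x \<le> l + (1 / l) ^ (n - 1) * x ^ n"
proof (cases "x \<le> l")
  case True
  then show ?thesis using assms by (simp add: add_increasing2)
next
  case False
  then have "1 ^ (n - 1) \<le> (x / l) ^ (n - 1)" using assms by (intro power_mono) auto
  then have "1 * x \<le> (x / l) ^ (n - 1) * x" using assms by (intro mult_right_mono) auto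
  also have "\<dots> = (1 / l) ^ (n - 1) * x ^ n" using assms by (cases n) (auto simp: power_divide)
  finally show ?thesis using assms by simp
qed

text \<open>Directions are averaged over a solid shell rather than the unit sphere, so that only
  Lebesgue measure occurs. The bound 1 gives \<open>|G \<bullet> z| \<le> |G|\<close>; the bound 1/2
  confines the \<open>t\<close> with \<open>y / t\<close> in the shell to a dyadic interval.\<close>

definition shell :: "'a::euclidean_space set" where
  "shell = {z. 1 / 2 < norm z \<and> norm z \<le> 1}"

lemma shell_borel [measurable]: "shell \<in> sets borel"
  unfolding shell_def by measurable

lemma emeasure_shell: "emeasure lborel (shell :: 'a::euclidean_space set) = ennreal (measure lborel (shell :: 'a set))"
proof -
  have "emeasure lborel (shell :: 'a set) \<le> emeasure lborel (cball (0::'a) 1)"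
    by (rule emeasure_mono) (auto simp: shell_def)
  also have "\<dots> < \<infinity>" by (rule emeasure_bounded_finite) simp
  finally show ?thesis by (simp add: emeasure_eq_ennreal_measure)
qed

lemma shell_vol_pos: "measure lborel (shell :: 'a::euclidean_space set) > 0"
proof -
  obtain b :: 'a where b: "b \<in> Basis" using nonempty_Basis by blast
  have "ball ((3/4) *\<^sub>R b) (1/4) \<subseteq> shell"
  proof
    fix z assume "z \<in> ball ((3/4) *\<^sub>R b) (1/4)"
    then have 1: "norm (z - (3/4) *\<^sub>R b) < 1/4" by (simp add: dist_norm norm_minus_commute)
    have 2: "norm ((3/4) *\<^sub>R b) = 3/4" using b by simp
    show "z \<in> shell"
      using norm_triangle_ineq2[of "(3/4) *\<^sub>R b" z] norm_triangle_ineq2[of z "(3/4) *\<^sub>R b"] 1 2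
      by (simp add: shell_def norm_minus_commute)
  qed
  then have "emeasure lborel (ball ((3/4) *\<^sub>R b) (1/4)) \<le> emeasure lborel (shell :: 'a set)"
    by (intro emeasure_mono) auto
  moreover have "emeasure lborel (ball ((3/4) *\<^sub>R b) (1/4)) > 0"
    by (simp add: emeasure_ball unit_ball_vol_pos)
  ultimately have "ennreal (measure lborel (shell :: 'a set)) > 0" unfolding emeasure_shell by (rule order.strict_trans2[rotated])
  then show ?thesis by simp
qed

text \<open>Here \<open>s\<close> stands for the volume of the shell. The base is the factor in
  \<open>level_bound_log\<close>; the exponent inverts the power \<open>(n - 1) / n\<close> of the
  logarithm there.\<close>

definition trudinger_const :: "nat \<Rightarrow> real \<Rightarrow> real" where
  "trudinger_const n s = ((3 * s + 2) / s) powr (real n / (real n - 1))"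

lemma trudinger_const_pos:
  assumes "s > 0"
  shows "trudinger_const n s > 0"
proof -
  have "(3 * s + 2) / s > 0" using assms by (intro divide_pos_pos add_nonneg_pos) auto
  then show ?thesis unfolding trudinger_const_def powr_gt_zero by (rule less_imp_neq[symmetric])
qed

section \<open>Averaging along rays for functions of unit energy\<close>

locale compact_C1 =
  fixes w :: "'a::euclidean_space \<Rightarrow> real" and G :: "'a \<Rightarrow> 'a" and K \<Omega> :: "'a set" and n :: nat and \<sigma> :: real
  assumes \<sigma>: "\<sigma> = measure lborel (shell :: 'a set)" and n: "n = DIM('a)" and dim: "n \<ge> 2"
    and K: "compact K" "K \<subseteq> \<Omega>"
    and \<Omega>: "open \<Omega>" "bounded \<Omega>"
    and w0: "\<And>x. x \<notin> K \<Longrightarrow> w x = 0"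
    and G0: "\<And>x. x \<notin> K \<Longrightarrow> G x = 0"
    and der: "\<And>x. (w has_derivative (\<lambda>h. G x \<bullet> h)) (at x)"
    and cont: "continuous_on UNIV G"
    and energy: "(\<integral>x. norm (G x) ^ n \<partial>lborel) \<le> 1"
begin

lemma \<sigma>_pos [simp]: "\<sigma> > 0" "\<sigma> \<ge> 0" using shell_vol_pos[where 'a='a] by (auto simp: \<sigma>)

lemma G_meas [measurable]: "G \<in> borel_measurable borel"
  using cont by (rule borel_measurable_continuous_onI)

lemma w_meas [measurable]: "w \<in> borel_measurable borel"
  using der by (intro borel_measurable_continuous_onI has_derivative_continuous_on) auto

lemma \<Omega>_meas [measurable]: "\<Omega> \<in> sets borel" using \<Omega> by auto

lemma nn_energy: "(\<integral>\<^sup>+x. ennreal (norm (G x) ^ n) \<partial>lborel) \<le> 1"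
proof -
  have "integrable lborel (\<lambda>x. norm (G x) ^ n)"
    using dim by (intro integrable_continuous_compact_support[OF K(1)] continuous_intros cont) (simp add: G0)
  then have "(\<integral>\<^sup>+x. ennreal (norm (G x) ^ n) \<partial>lborel) = ennreal (\<integral>x. norm (G x) ^ n \<partial>lborel)"
    by (intro nn_integral_eq_integral) auto
  then show ?thesis using energy by simp
qed

lemma ray_bound:
  assumes "norm z \<le> 1" "z \<noteq> 0"
  shows "ennreal \<bar>w x\<bar> \<le> (\<integral>\<^sup>+t. ennreal (norm (G (x + t *\<^sub>R z))) * indicator {0..} t \<partial>lborel)"
proof -
  obtain b where b: "\<And>x. x \<in> K \<Longrightarrow> norm x \<le> b" "b > 0" using compact_imp_bounded[OF K(1)] bounded_pos by metis
  \<comment> \<open>Chosen so that \<open>|T z| = |x| + b + 1\<close>, which puts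
    \<open>x + T z\<close> outside the support.\<close>
  define T where "T = (norm x + b + 1) / norm z"
  have T: "T \<ge> 0" using b by (auto simp: T_def)
  have "x + T *\<^sub>R z \<notin> K"
  proof
    assume "x + T *\<^sub>R z \<in> K"
    then have "norm (x + T *\<^sub>R z) \<le> b" using b by auto
    moreover have "norm (T *\<^sub>R z) \<le> norm (x + T *\<^sub>R z) + norm x"
      using norm_triangle_ineq4[of "x + T *\<^sub>R z" x] by simp
    moreover have "norm (T *\<^sub>R z) = norm x + b + 1" using T assms b by (simp add: T_def)
    ultimately show False by simp
  qed
  then have wT: "w (x + T *\<^sub>R z) = 0" by (rule w0)
  define f where "f t = (G (x + t *\<^sub>R z) \<bullet> z) * indicator {0..T} t" for t
  have "(\<integral>t. f t \<partial>lborel) = w (x + T *\<^sub>R z) - w (x + 0 *\<^sub>R z)"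
    unfolding f_def
  proof (rule integral_FTC_Icc_real)
    fix t
    have "((\<lambda>t. w (x + t *\<^sub>R z)) has_derivative (\<lambda>h. G (x + t *\<^sub>R z) \<bullet> (h *\<^sub>R z))) (at t)"
      by (rule has_derivative_compose[OF _ der, of "\<lambda>t. x + t *\<^sub>R z"]) (auto intro!: derivative_eq_intros)
    then show "((\<lambda>t. w (x + t *\<^sub>R z)) has_real_derivative (G (x + t *\<^sub>R z) \<bullet> z)) (at t)"
      by (simp add: has_field_derivative_def mult_commute_abs)
    show "isCont (\<lambda>t. G (x + t *\<^sub>R z) \<bullet> z) t"
      using continuous_on_compose2[OF cont, of UNIV "\<lambda>t. x + t *\<^sub>R z"]
      by (intro continuous_intros) (auto simp: continuous_on_eq_continuous_at intro!: continuous_intros)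
  qed (use T in auto)
  then have "\<bar>w x\<bar> = norm (\<integral>t. f t \<partial>lborel)" by (simp add: wT)
  also have "ennreal \<dots> \<le> (\<integral>\<^sup>+t. ennreal (norm (f t)) \<partial>lborel)"
  \<comment> \<open>A non-integrable \<open>f\<close> has integral 0 by convention, and the bound is
    then trivial.\<close>
  proof (cases "integrable lborel f")
    case True
    then show ?thesis by (rule integral_norm_bound_ennreal)
  qed (simp add: not_integrable_integral_eq)
  also have "\<dots> \<le> (\<integral>\<^sup>+t. ennreal (norm (G (x + t *\<^sub>R z))) * indicator {0..} t \<partial>lborel)"
  proof (rule nn_integral_mono)
    fix t
    have "\<bar>G (x + t *\<^sub>R z) \<bullet> z\<bar> \<le> norm (G (x + t *\<^sub>R z)) * norm z" by (rule Cauchy_Schwarz_ineq2)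
    also have "\<dots> \<le> norm (G (x + t *\<^sub>R z))" using assms by (simp add: mult_left_le)
    finally show "ennreal (norm (f t)) \<le> ennreal (norm (G (x + t *\<^sub>R z))) * indicator {0..} t"
      by (auto simp: f_def indicator_def abs_mult)
  qed
  finally show ?thesis .
qed

text \<open>For short \<open>t\<close> the integration over \<open>x \<in> E\<close> is done first.
  Young's inequality with parameter \<open>1 / \<rho>\<close> balances the volume
  \<open>\<rho> ^ n\<close> of \<open>E\<close> against the unit energy: each contributes
  \<open>\<rho> ^ (n - 1)\<close>. The range of \<open>t\<close> supplies the remaining factor
  \<open>\<rho>\<close>.\<close>

lemma near_part:
  assumes [measurable]: "E \<in> sets borel" and E: "emeasure lborel E = ennreal (\<rho> ^ n)" and \<rho>: "\<rho> > 0"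
  shows "(\<integral>\<^sup>+x. (\<integral>\<^sup>+z. (\<integral>\<^sup>+t. ennreal (norm (G (x + t *\<^sub>R z))) * indicator {0..<\<rho>} t \<partial>lborel) * indicator shell z \<partial>lborel) * indicator E x \<partial>lborel)
    \<le> ennreal (2 * \<sigma> * \<rho> ^ n)"
proof -
  have pn: "\<rho> ^ n = \<rho> ^ (n - 1) * \<rho>" using power_split2(3)[OF dim] .
  have in0: "(\<integral>\<^sup>+x. ennreal (norm (G (x + t *\<^sub>R z))) * indicator E x \<partial>lborel) \<le> ennreal (2 * \<rho> ^ (n - 1))" for t z
  proof -
    have "(\<integral>\<^sup>+x. ennreal (norm (G (x + t *\<^sub>R z))) * indicator E x \<partial>lborel)
       \<le> (\<integral>\<^sup>+x. ennreal (1 / \<rho>) * indicator E x + ennreal (\<rho> ^ (n - 1)) * ennreal (norm (G (x + t *\<^sub>R z)) ^ n) \<partial>lborel)"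
    proof (rule nn_integral_mono)
      fix x
      have "norm (G (x + t *\<^sub>R z)) \<le> 1 / \<rho> + (1 / (1 / \<rho>)) ^ (n - 1) * norm (G (x + t *\<^sub>R z)) ^ n"
        using \<rho> dim by (intro young_power) auto
      then show "ennreal (norm (G (x + t *\<^sub>R z))) * indicator E x \<le> ennreal (1 / \<rho>) * indicator E x + ennreal (\<rho> ^ (n - 1)) * ennreal (norm (G (x + t *\<^sub>R z)) ^ n)"
        using \<rho> by (auto simp: indicator_def simp flip: ennreal_plus ennreal_mult intro!: ennreal_leI)
    qed
    also have "\<dots> = ennreal (1 / \<rho>) * ennreal (\<rho> ^ n) + ennreal (\<rho> ^ (n - 1)) * (\<integral>\<^sup>+x. ennreal (norm (G (x + t *\<^sub>R z)) ^ n) \<partial>lborel)"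
      by (subst nn_integral_add) (auto simp: nn_integral_cmult E)
    also have "(\<integral>\<^sup>+x. ennreal (norm (G (x + t *\<^sub>R z)) ^ n) \<partial>lborel) = (\<integral>\<^sup>+x. ennreal (norm (G x) ^ n) \<partial>lborel)"
      by (rule nn_integral_lborel_translate[of "\<lambda>x. ennreal (norm (G x) ^ n)"]) auto
    also have "ennreal (1 / \<rho>) * ennreal (\<rho> ^ n) + ennreal (\<rho> ^ (n - 1)) * \<dots> \<le> ennreal (1 / \<rho>) * ennreal (\<rho> ^ n) + ennreal (\<rho> ^ (n - 1)) * 1"
      by (intro add_left_mono mult_left_mono nn_energy) auto
    also have "\<dots> = ennreal (2 * \<rho> ^ (n - 1))"
      unfolding pn using \<rho> by (simp flip: ennreal_plus ennreal_mult)
    finally show ?thesis .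
  qed
  have "(\<integral>\<^sup>+x. (\<integral>\<^sup>+z. (\<integral>\<^sup>+t. ennreal (norm (G (x + t *\<^sub>R z))) * indicator {0..<\<rho>} t \<partial>lborel) * indicator shell z \<partial>lborel) * indicator E x \<partial>lborel)
    = (\<integral>\<^sup>+x. (\<integral>\<^sup>+z. (\<integral>\<^sup>+t. ennreal (norm (G (x + t *\<^sub>R z))) * indicator {0..<\<rho>} t * indicator shell z * indicator E x \<partial>lborel) \<partial>lborel) \<partial>lborel)"
    by (simp add: nn_integral_multc)
  also have "\<dots> = (\<integral>\<^sup>+z. (\<integral>\<^sup>+x. (\<integral>\<^sup>+t. ennreal (norm (G (x + t *\<^sub>R z))) * indicator {0..<\<rho>} t * indicator shell z * indicator E x \<partial>lborel) \<partial>lborel) \<partial>lborel)"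
    by (rule lborel_pair.Fubini') measurable
  also have "\<dots> = (\<integral>\<^sup>+z. (\<integral>\<^sup>+t. (\<integral>\<^sup>+x. ennreal (norm (G (x + t *\<^sub>R z))) * indicator {0..<\<rho>} t * indicator shell z * indicator E x \<partial>lborel) \<partial>lborel) \<partial>lborel)"
    by (intro nn_integral_cong lborel_pair.Fubini') measurable
  also have "\<dots> = (\<integral>\<^sup>+z. (\<integral>\<^sup>+t. (\<integral>\<^sup>+x. ennreal (norm (G (x + t *\<^sub>R z))) * indicator E x \<partial>lborel) * indicator {0..<\<rho>} t \<partial>lborel) * indicator shell z \<partial>lborel)"
  proof (intro nn_integral_cong)
    fix z :: 'a
    define I where "I t = (\<integral>\<^sup>+x. ennreal (norm (G (x + t *\<^sub>R z))) * indicator E x \<partial>lborel)" for t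
    have [measurable]: "I \<in> borel_measurable borel" unfolding I_def by measurable
    have 1: "(\<integral>\<^sup>+x. ennreal (norm (G (x + t *\<^sub>R z))) * indicator {0..<\<rho>} t * indicator shell z * indicator E x \<partial>lborel)
        = I t * (indicator {0..<\<rho>} t * indicator shell z)" for t
      unfolding I_def by (subst nn_integral_multc[symmetric]) (auto simp: mult_ac)
    have "(\<integral>\<^sup>+t. (I t * indicator {0..<\<rho>} t) * indicator shell z \<partial>lborel) = (\<integral>\<^sup>+t. I t * indicator {0..<\<rho>} t \<partial>lborel) * indicator shell z"
      by (rule nn_integral_multc) measurable
    then show "(\<integral>\<^sup>+t. (\<integral>\<^sup>+x. ennreal (norm (G (x + t *\<^sub>R z))) * indicator {0..<\<rho>} t * indicator shell z * indicator E x \<partial>lborel) \<partial>lborel)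
       = (\<integral>\<^sup>+t. (\<integral>\<^sup>+x. ennreal (norm (G (x + t *\<^sub>R z))) * indicator E x \<partial>lborel) * indicator {0..<\<rho>} t \<partial>lborel) * indicator shell z"
      unfolding 1 I_def[symmetric] by (simp add: mult.assoc)
  qed
  also have "\<dots> \<le> (\<integral>\<^sup>+z. (\<integral>\<^sup>+t. ennreal (2 * \<rho> ^ (n - 1)) * indicator {0..<\<rho>} t \<partial>lborel) * indicator shell (z::'a) \<partial>lborel)"
    by (intro nn_integral_mono mult_right_mono in0) auto
  also have "\<dots> = ennreal (2 * \<rho> ^ (n - 1)) * ennreal \<rho> * ennreal \<sigma>"
    using \<rho> by (simp add: nn_integral_cmult emeasure_shell \<sigma>)
  also have "\<dots> = ennreal (2 * \<sigma> * \<rho> ^ n)"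
    unfolding pn using \<rho> by (simp flip: ennreal_mult add: mult_ac)
  finally show ?thesis .
qed

text \<open>The substitution \<open>y = t z\<close> turns \<open>t^(n-1) dz dt\<close> into
  \<open>dy dt / t\<close>. For fixed \<open>y\<close>, the shell confines \<open>t\<close> to
  \<open>[|y|, 2 |y|)\<close>, on which \<open>dt / t\<close> has mass at most 1.\<close>

lemma far_energy:
  "(\<integral>\<^sup>+t. (\<integral>\<^sup>+z. ennreal (norm (G (x + t *\<^sub>R z)) ^ n) * indicator shell z \<partial>lborel) * ennreal (t ^ (n - 1)) * indicator {0<..} t \<partial>lborel) \<le> 1"
proof -
  have "(\<integral>\<^sup>+t. (\<integral>\<^sup>+z. ennreal (norm (G (x + t *\<^sub>R z)) ^ n) * indicator shell z \<partial>lborel) * ennreal (t ^ (n - 1)) * indicator {0<..} t \<partial>lborel)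
      = (\<integral>\<^sup>+t. (\<integral>\<^sup>+y. ennreal (norm (G (x + y)) ^ n) * (ennreal (1 / t) * indicator {0<..} t * indicator shell ((1 / t) *\<^sub>R y)) \<partial>lborel) \<partial>lborel)"
  proof (rule nn_integral_cong)
    fix t :: real
    show "(\<integral>\<^sup>+z. ennreal (norm (G (x + t *\<^sub>R z)) ^ n) * indicator shell z \<partial>lborel) * ennreal (t ^ (n - 1)) * indicator {0<..} t
      = (\<integral>\<^sup>+y. ennreal (norm (G (x + y)) ^ n) * (ennreal (1 / t) * indicator {0<..} t * indicator shell ((1 / t) *\<^sub>R y)) \<partial>lborel)"
    proof (cases "t > 0")
      case True
      have "(\<integral>\<^sup>+y. ennreal (norm (G (x + y)) ^ n) * (ennreal (1 / t) * indicator {0<..} t * indicator shell ((1 / t) *\<^sub>R y)) \<partial>lborel)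
        = ennreal (t ^ n) * (\<integral>\<^sup>+z. ennreal (norm (G (x + (0 + t *\<^sub>R z))) ^ n) * (ennreal (1 / t) * indicator {0<..} t * indicator shell ((1 / t) *\<^sub>R (0 + t *\<^sub>R z))) \<partial>lborel)"
        unfolding n using True by (intro nn_integral_lborel_affine) auto
      also have "\<dots> = ennreal (t ^ n) * (ennreal (1 / t) * (\<integral>\<^sup>+z. ennreal (norm (G (x + t *\<^sub>R z)) ^ n) * indicator shell z \<partial>lborel))"
        using True by (simp add: nn_integral_cmult[symmetric] mult_ac)
      also have "\<dots> = (\<integral>\<^sup>+z. ennreal (norm (G (x + t *\<^sub>R z)) ^ n) * indicator shell z \<partial>lborel) * (ennreal (t ^ n) * ennreal (1 / t))"
        by (simp add: mult_ac)
      also have "ennreal (t ^ n) * ennreal (1 / t) = ennreal (t ^ (n - 1))"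
        using True by (simp flip: ennreal_mult add: power_split2(3)[OF dim])
      finally show ?thesis using True by simp
    qed simp
  qed
  also have "\<dots> = (\<integral>\<^sup>+y. (\<integral>\<^sup>+t. ennreal (norm (G (x + y)) ^ n) * (ennreal (1 / t) * indicator {0<..} t * indicator shell ((1 / t) *\<^sub>R y)) \<partial>lborel) \<partial>lborel)"
    by (rule lborel_pair.Fubini') measurable
  also have "\<dots> \<le> (\<integral>\<^sup>+y. ennreal (norm (G (x + y)) ^ n) * 1 \<partial>lborel)"
  proof (rule nn_integral_mono)
    fix y :: 'a
    have "(\<integral>\<^sup>+t. ennreal (1 / t) * indicator {0<..} t * indicator shell ((1 / t) *\<^sub>R y) \<partial>lborel) \<le> 1"
    proof (cases "y = 0")
      case True
      then show ?thesis by (simp add: shell_def)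
    next
      case False
      have "(\<integral>\<^sup>+t. ennreal (1 / t) * indicator {0<..} t * indicator shell ((1 / t) *\<^sub>R y) \<partial>lborel)
         \<le> (\<integral>\<^sup>+t. ennreal (1 / norm y) * indicator {norm y..2 * norm y} t \<partial>lborel)"
        using False by (intro nn_integral_mono)
          (auto simp: indicator_def shell_def field_simps abs_if intro!: ennreal_leI split: if_splits)
      also have "\<dots> = 1" using False by (simp add: nn_integral_cmult flip: ennreal_mult)
      finally show ?thesis .
    qed
    then show "(\<integral>\<^sup>+t. ennreal (norm (G (x + y)) ^ n) * (ennreal (1 / t) * indicator {0<..} t * indicator shell ((1 / t) *\<^sub>R y)) \<partial>lborel) \<le> ennreal (norm (G (x + y)) ^ n) * 1"
      by (subst nn_integral_cmult) (measurable, rule mult_left_mono, auto)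
  qed
  also have "\<dots> = (\<integral>\<^sup>+y. ennreal (norm (G y) ^ n) \<partial>lborel)"
    using nn_integral_lborel_translate[of "\<lambda>x. ennreal (norm (G x) ^ n)" x] by (simp add: add.commute)
  also have "\<dots> \<le> 1" by (rule nn_energy)
  finally show ?thesis .
qed

text \<open>\<open>R\<close> is the \<open>n\<close>-th root of the volume of
  \<open>\<Omega>\<close> here, not its \<open>radius\<close>. The inner integral is at most
  \<open>\<sigma>\<close> and, by scaling, at most \<open>(R / t)^n\<close>. The first bound up to
  \<open>R\<close> gives the logarithm, the second beyond \<open>R\<close> gives
  \<open>1 / n \<le> 1\<close>.\<close>

lemma far_measure:
  assumes \<rho>: "0 < \<rho>" "\<rho> \<le> R" and R: "emeasure lborel \<Omega> = ennreal (R ^ n)"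
  shows "(\<integral>\<^sup>+t. (\<integral>\<^sup>+z. indicator \<Omega> (x + t *\<^sub>R z) * indicator shell z \<partial>lborel) * ennreal (1 / t) * indicator {\<rho>..} t \<partial>lborel)
    \<le> ennreal (\<sigma> * ln (R / \<rho>) + 1)"
proof -
  have in1: "(\<integral>\<^sup>+z. indicator \<Omega> (x + t *\<^sub>R z) * indicator shell z \<partial>lborel) \<le> ennreal \<sigma>" for t
  proof -
    have "(\<integral>\<^sup>+z. indicator \<Omega> (x + t *\<^sub>R z) * indicator shell z \<partial>lborel) \<le> (\<integral>\<^sup>+z. indicator (shell::'a set) z \<partial>lborel)"
      by (intro nn_integral_mono) (auto simp: indicator_def)
    then show ?thesis by (simp add: emeasure_shell \<sigma>)
  qed
  have in2: "(\<integral>\<^sup>+z. indicator \<Omega> (x + t *\<^sub>R z) * indicator shell z \<partial>lborel) \<le> ennreal (R ^ n / t ^ n)" if "t > 0" for t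
  proof -
    have "ennreal (R ^ n) = (\<integral>\<^sup>+y. indicator \<Omega> y \<partial>lborel)" by (simp add: R)
    also have "\<dots> = ennreal (t ^ n) * (\<integral>\<^sup>+z. indicator \<Omega> (x + t *\<^sub>R z) \<partial>lborel)"
      unfolding n using that by (intro nn_integral_lborel_affine) auto
    finally have "ennreal (1 / t ^ n) * ennreal (R ^ n) = ennreal (1 / t ^ n) * ennreal (t ^ n) * (\<integral>\<^sup>+z. indicator \<Omega> (x + t *\<^sub>R z) \<partial>lborel)"
      by (simp add: mult.assoc)
    then have "(\<integral>\<^sup>+z. indicator \<Omega> (x + t *\<^sub>R z) \<partial>lborel) = ennreal (R ^ n / t ^ n)"
      using that \<rho> by (simp flip: ennreal_mult)
    moreover have "(\<integral>\<^sup>+z. indicator \<Omega> (x + t *\<^sub>R z) * indicator shell z \<partial>lborel) \<le> (\<integral>\<^sup>+z. indicator \<Omega> (x + t *\<^sub>R z) \<partial>lborel)"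
      by (intro nn_integral_mono) (auto simp: indicator_def)
    ultimately show ?thesis by simp
  qed
  have Rpos: "R > 0" using \<rho> by simp
  have "(\<integral>\<^sup>+t. (\<integral>\<^sup>+z. indicator \<Omega> (x + t *\<^sub>R z) * indicator shell z \<partial>lborel) * ennreal (1 / t) * indicator {\<rho>..} t \<partial>lborel)
    \<le> (\<integral>\<^sup>+t. ennreal (\<sigma> * (1 / t)) * indicator {\<rho>..R} t + ennreal (R ^ n / t ^ (n + 1)) * indicator {R..} t \<partial>lborel)"
  proof (rule nn_integral_mono)
    fix t :: real
    show "(\<integral>\<^sup>+z. indicator \<Omega> (x + t *\<^sub>R z) * indicator shell z \<partial>lborel) * ennreal (1 / t) * indicator {\<rho>..} t
      \<le> ennreal (\<sigma> * (1 / t)) * indicator {\<rho>..R} t + ennreal (R ^ n / t ^ (n + 1)) * indicator {R..} t"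
    proof (cases "\<rho> \<le> t")
      case True
      then have t: "t > 0" using \<rho> by simp
      show ?thesis
      proof (cases "t \<le> R")
        case le: True
        have "(\<integral>\<^sup>+z. indicator \<Omega> (x + t *\<^sub>R z) * indicator shell z \<partial>lborel) * ennreal (1 / t) \<le> ennreal \<sigma> * ennreal (1 / t)"
          by (intro mult_right_mono in1) auto
        also have "\<dots> = ennreal (\<sigma> * (1 / t))" using t by (simp flip: ennreal_mult)
        finally show ?thesis using True le by (auto simp: indicator_def intro: add_increasing2)
      next
        case False
        have "(\<integral>\<^sup>+z. indicator \<Omega> (x + t *\<^sub>R z) * indicator shell z \<partial>lborel) * ennreal (1 / t) \<le> ennreal (R ^ n / t ^ n) * ennreal (1 / t)"
          by (intro mult_right_mono in2 t) auto
        also have "\<dots> = ennreal (R ^ n / t ^ (n + 1))" using t Rpos by (simp flip: ennreal_mult add: mult.commute)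
        finally show ?thesis using True False by (auto simp: indicator_def)
      qed
    qed simp
  qed
  also have "\<dots> = (\<integral>\<^sup>+t. ennreal (\<sigma> * (1 / t)) * indicator {\<rho>..R} t \<partial>lborel) + (\<integral>\<^sup>+t. ennreal (R ^ n / t ^ (n + 1)) * indicator {R..} t \<partial>lborel)"
    by (rule nn_integral_add) auto
  also have "(\<integral>\<^sup>+t. ennreal (\<sigma> * (1 / t)) * indicator {\<rho>..R} t \<partial>lborel) = ennreal (\<sigma> * ln R - \<sigma> * ln \<rho>)"
    using \<rho> by (intro nn_integral_FTC_Icc) (auto intro!: derivative_eq_intros DERIV_subset[OF DERIV_cmult[OF DERIV_ln_divide]])
  also have "(\<integral>\<^sup>+t. ennreal (R ^ n / t ^ (n + 1)) * indicator {R..} t \<partial>lborel) = ennreal (0 - (- (R ^ n / real n / R ^ n)))"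
  proof (rule nn_integral_FTC_atLeast[where F = "\<lambda>t. - (R ^ n / real n / t ^ n)"])
    fix t assume "R \<le> t"
    then have t: "t > 0" using Rpos by simp
    have "((\<lambda>t. R ^ n / real n * inverse (t ^ n)) has_real_derivative R ^ n / real n * (- (real n * t ^ (n - 1)) / (t ^ n)\<^sup>2)) (at t)"
      using t dim by (auto intro!: derivative_eq_intros simp: field_simps power2_eq_square)
    then have "((\<lambda>t. - (R ^ n / real n * inverse (t ^ n))) has_real_derivative - (R ^ n / real n * (- (real n * t ^ (n - 1)) / (t ^ n)\<^sup>2))) (at t)"
      by (rule DERIV_minus)
    moreover have "- (R ^ n / real n * (- (real n * t ^ (n - 1)) / (t ^ n)\<^sup>2)) = R ^ n / t ^ (n + 1)"
      using t dim by (simp add: power2_eq_square power_split2(3)[OF dim, of t])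
    ultimately have "((\<lambda>t. - (R ^ n / real n * inverse (t ^ n))) has_real_derivative R ^ n / t ^ (n + 1)) (at t)"
      by (simp only:)
    then show "((\<lambda>t. - (R ^ n / real n / t ^ n)) has_real_derivative R ^ n / t ^ (n + 1)) (at t)"
      by (simp only: divide_inverse)
    show "0 \<le> R ^ n / t ^ (n + 1)" using t Rpos by simp
  next
    have "((\<lambda>t::real. inverse (t ^ n)) \<longlongrightarrow> 0) at_top"
      using dim by (intro tendsto_inverse_0_at_top filterlim_pow_at_top) (auto intro: filterlim_ident)
    then have "((\<lambda>t::real. - (R ^ n / real n * inverse (t ^ n))) \<longlongrightarrow> - (R ^ n / real n * 0)) at_top"
      by (intro tendsto_intros)
    then show "((\<lambda>t. - (R ^ n / real n / t ^ n)) \<longlongrightarrow> 0) at_top" by (simp add: divide_inverse)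
  qed auto
  also have "ennreal (\<sigma> * ln R - \<sigma> * ln \<rho>) + ennreal (0 - (- (R ^ n / real n / R ^ n))) \<le> ennreal (\<sigma> * ln (R / \<rho>)) + ennreal 1"
    using \<rho> Rpos dim by (intro add_mono ennreal_leI) (auto simp: ln_div algebra_simps)
  also have "\<dots> = ennreal (\<sigma> * ln (R / \<rho>) + 1)"
    using \<rho> by (intro ennreal_plus[symmetric]) auto
  finally show ?thesis .
qed

text \<open>Young's inequality with parameter \<open>\<mu> / t\<close> splits the integrand into a
  part controlled by \<open>far_measure\<close> and one controlled by \<open>far_energy\<close>. The
  choice of \<open>\<mu>\<close> is left to \<open>level_bound_log\<close>.\<close>

lemma far_part:
  assumes \<rho>: "0 < \<rho>" "\<rho> \<le> R" and R: "emeasure lborel \<Omega> = ennreal (R ^ n)" and \<mu>: "\<mu> > 0"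
  shows "(\<integral>\<^sup>+z. (\<integral>\<^sup>+t. ennreal (norm (G (x + t *\<^sub>R z))) * indicator {\<rho>..} t \<partial>lborel) * indicator shell z \<partial>lborel)
    \<le> ennreal (\<mu> * (\<sigma> * ln (R / \<rho>) + 1) + (1 / \<mu>) ^ (n - 1))"
proof -
  define I1 where "I1 t = (\<integral>\<^sup>+z. indicator \<Omega> (x + t *\<^sub>R z) * indicator shell z \<partial>lborel)" for t
  define I2 where "I2 t = (\<integral>\<^sup>+z. ennreal (norm (G (x + t *\<^sub>R z)) ^ n) * indicator shell z \<partial>lborel)" for t
  have [measurable]: "I1 \<in> borel_measurable borel" "I2 \<in> borel_measurable borel"
    unfolding I1_def I2_def by measurable
  have "(\<integral>\<^sup>+z. (\<integral>\<^sup>+t. ennreal (norm (G (x + t *\<^sub>R z))) * indicator {\<rho>..} t \<partial>lborel) * indicator shell z \<partial>lborel)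
    = (\<integral>\<^sup>+z. (\<integral>\<^sup>+t. ennreal (norm (G (x + t *\<^sub>R z))) * indicator {\<rho>..} t * indicator shell z \<partial>lborel) \<partial>lborel)"
    by (simp add: nn_integral_multc)
  also have "\<dots> = (\<integral>\<^sup>+t. (\<integral>\<^sup>+z. ennreal (norm (G (x + t *\<^sub>R z))) * indicator {\<rho>..} t * indicator shell z \<partial>lborel) \<partial>lborel)"
    by (rule lborel_pair.Fubini') measurable
  also have "\<dots> \<le> (\<integral>\<^sup>+t. ennreal \<mu> * (I1 t * ennreal (1 / t) * indicator {\<rho>..} t)
       + ennreal ((1 / \<mu>) ^ (n - 1)) * (I2 t * ennreal (t ^ (n - 1)) * indicator {0<..} t) \<partial>lborel)"
  proof (rule nn_integral_mono)
    fix t :: real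
    show "(\<integral>\<^sup>+z. ennreal (norm (G (x + t *\<^sub>R z))) * indicator {\<rho>..} t * indicator shell z \<partial>lborel)
      \<le> ennreal \<mu> * (I1 t * ennreal (1 / t) * indicator {\<rho>..} t)
       + ennreal ((1 / \<mu>) ^ (n - 1)) * (I2 t * ennreal (t ^ (n - 1)) * indicator {0<..} t)"
    proof (cases "\<rho> \<le> t")
      case True
      then have t: "t > 0" using \<rho> by simp
      have "(\<integral>\<^sup>+z. ennreal (norm (G (x + t *\<^sub>R z))) * indicator {\<rho>..} t * indicator shell z \<partial>lborel)
        \<le> (\<integral>\<^sup>+z. ennreal (\<mu> / t) * (indicator \<Omega> (x + t *\<^sub>R z) * indicator shell z)
             + ennreal ((t / \<mu>) ^ (n - 1)) * (ennreal (norm (G (x + t *\<^sub>R z)) ^ n) * indicator shell z) \<partial>lborel)"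
      proof (rule nn_integral_mono)
        fix z
        \<comment> \<open>The constant term of Young's inequality may carry the indicator of
          \<open>\<Omega>\<close>, since \<open>G\<close> vanishes outside \<open>\<Omega>\<close>;
          without it the integral of \<open>1 / t\<close> up to infinity would diverge.\<close>
        have "ennreal (norm (G (x + t *\<^sub>R z))) \<le> ennreal (\<mu> / t) * indicator \<Omega> (x + t *\<^sub>R z) + ennreal ((t / \<mu>) ^ (n - 1)) * ennreal (norm (G (x + t *\<^sub>R z)) ^ n)"
        proof (cases "x + t *\<^sub>R z \<in> K")
          case in_K: True
          have "norm (G (x + t *\<^sub>R z)) \<le> \<mu> / t + (1 / (\<mu> / t)) ^ (n - 1) * norm (G (x + t *\<^sub>R z)) ^ n"
            using \<mu> t dim by (intro young_power) auto
          then show ?thesis using in_K K \<mu> t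
            by (auto simp: indicator_def subset_eq simp flip: ennreal_plus ennreal_mult intro!: ennreal_leI)
        qed (simp add: G0)
        then show "ennreal (norm (G (x + t *\<^sub>R z))) * indicator {\<rho>..} t * indicator shell z
          \<le> ennreal (\<mu> / t) * (indicator \<Omega> (x + t *\<^sub>R z) * indicator shell z)
             + ennreal ((t / \<mu>) ^ (n - 1)) * (ennreal (norm (G (x + t *\<^sub>R z)) ^ n) * indicator shell z)"
          using True by (cases "z \<in> shell") auto
      qed
      also have "\<dots> = ennreal (\<mu> / t) * I1 t + ennreal ((t / \<mu>) ^ (n - 1)) * I2 t"
        unfolding I1_def I2_def by (subst nn_integral_add) (auto simp: nn_integral_cmult)
      also have "ennreal (\<mu> / t) = ennreal \<mu> * ennreal (1 / t)" using \<mu> t by (simp flip: ennreal_mult)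
      also have "ennreal ((t / \<mu>) ^ (n - 1)) = ennreal ((1 / \<mu>) ^ (n - 1)) * ennreal (t ^ (n - 1))"
        using \<mu> t by (simp flip: ennreal_mult add: power_divide)
      finally show ?thesis using True t by (simp add: mult_ac)
    qed simp
  qed
  also have "\<dots> = ennreal \<mu> * (\<integral>\<^sup>+t. I1 t * ennreal (1 / t) * indicator {\<rho>..} t \<partial>lborel)
       + ennreal ((1 / \<mu>) ^ (n - 1)) * (\<integral>\<^sup>+t. I2 t * ennreal (t ^ (n - 1)) * indicator {0<..} t \<partial>lborel)"
    by (subst nn_integral_add) (auto simp: nn_integral_cmult)
  also have "\<dots> \<le> ennreal \<mu> * ennreal (\<sigma> * ln (R / \<rho>) + 1) + ennreal ((1 / \<mu>) ^ (n - 1)) * 1"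
    using far_measure[OF \<rho> R, of x] far_energy[of x] unfolding I1_def I2_def
    by (intro add_mono mult_left_mono) auto
  also have "\<dots> = ennreal (\<mu> * (\<sigma> * ln (R / \<rho>) + 1) + (1 / \<mu>) ^ (n - 1))"
  proof -
    have "0 \<le> \<sigma> * ln (R / \<rho>) + 1" using \<rho> by (intro add_nonneg_nonneg mult_nonneg_nonneg) auto
    then show ?thesis using \<mu> by (simp flip: ennreal_plus ennreal_mult)
  qed
  finally show ?thesis .
qed

text \<open>\<open>ray_bound\<close> is integrated over the shell and split at
  \<open>t = \<rho>\<close>. The far part is bounded for each \<open>x\<close>, the near part after
  integration over \<open>E\<close>, whose volume \<open>\<rho> ^ n\<close> is divided out at the
  end.\<close>

lemma level_bound:
  assumes [measurable]: "E \<in> sets borel" and E: "emeasure lborel E = ennreal (\<rho> ^ n)" and \<rho>: "0 < \<rho>" "\<rho> \<le> R"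
    and R: "emeasure lborel \<Omega> = ennreal (R ^ n)" and \<mu>: "\<mu> > 0" and \<tau>: "\<tau> \<ge> 0" "\<And>x. x \<in> E \<Longrightarrow> \<tau> \<le> \<bar>w x\<bar>"
  shows "\<tau> * \<sigma> \<le> 2 * \<sigma> + \<mu> * (\<sigma> * ln (R / \<rho>) + 1) + (1 / \<mu>) ^ (n - 1)"
proof -
  define near where "near x = (\<integral>\<^sup>+z. (\<integral>\<^sup>+t. ennreal (norm (G (x + t *\<^sub>R z))) * indicator {0..<\<rho>} t \<partial>lborel) * indicator shell z \<partial>lborel)" for x
  define far where "far x = (\<integral>\<^sup>+z. (\<integral>\<^sup>+t. ennreal (norm (G (x + t *\<^sub>R z))) * indicator {\<rho>..} t \<partial>lborel) * indicator shell z \<partial>lborel)" for x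
  define C where "C = \<mu> * (\<sigma> * ln (R / \<rho>) + 1) + (1 / \<mu>) ^ (n - 1)"
  have C0: "C \<ge> 0" unfolding C_def using \<rho> \<mu> by (intro add_nonneg_nonneg mult_nonneg_nonneg) auto
  have [measurable]: "near \<in> borel_measurable borel" unfolding near_def by measurable
  have far: "far x \<le> ennreal C" for x using far_part[OF \<rho> R \<mu>] by (simp add: far_def C_def)
  have pt: "ennreal (\<tau> * \<sigma>) \<le> near x + ennreal C" if "x \<in> E" for x
  proof -
    have "ennreal (\<tau> * \<sigma>) = (\<integral>\<^sup>+z. ennreal \<tau> * indicator (shell::'a set) z \<partial>lborel)"
      using \<tau>(1) by (simp add: nn_integral_cmult emeasure_shell \<sigma> ennreal_mult)
    also have "\<dots> \<le> (\<integral>\<^sup>+z. (\<integral>\<^sup>+t. ennreal (norm (G (x + t *\<^sub>R z))) * indicator {0..} t \<partial>lborel) * indicator shell z \<partial>lborel)"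
    proof (rule nn_integral_mono)
      fix z :: 'a
      show "ennreal \<tau> * indicator shell z \<le> (\<integral>\<^sup>+t. ennreal (norm (G (x + t *\<^sub>R z))) * indicator {0..} t \<partial>lborel) * indicator shell z"
      proof (cases "z \<in> shell")
        case True
        have "ennreal \<tau> \<le> ennreal \<bar>w x\<bar>" using \<tau> that by (intro ennreal_leI) auto
        also have "\<dots> \<le> (\<integral>\<^sup>+t. ennreal (norm (G (x + t *\<^sub>R z))) * indicator {0..} t \<partial>lborel)"
          using True by (intro ray_bound) (auto simp: shell_def)
        finally show ?thesis using True by simp
      qed simp
    qed
    also have "\<dots> = (\<integral>\<^sup>+z. (\<integral>\<^sup>+t. ennreal (norm (G (x + t *\<^sub>R z))) * indicator {0..<\<rho>} t \<partial>lborel) * indicator shell z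
         + (\<integral>\<^sup>+t. ennreal (norm (G (x + t *\<^sub>R z))) * indicator {\<rho>..} t \<partial>lborel) * indicator shell z \<partial>lborel)"
    proof (rule nn_integral_cong)
      fix z :: 'a
      have "(\<integral>\<^sup>+t. ennreal (norm (G (x + t *\<^sub>R z))) * indicator {0..} t \<partial>lborel)
        = (\<integral>\<^sup>+t. ennreal (norm (G (x + t *\<^sub>R z))) * indicator {0..<\<rho>} t + ennreal (norm (G (x + t *\<^sub>R z))) * indicator {\<rho>..} t \<partial>lborel)"
        using \<rho> by (intro nn_integral_cong) (auto simp: indicator_def)
      also have "\<dots> = (\<integral>\<^sup>+t. ennreal (norm (G (x + t *\<^sub>R z))) * indicator {0..<\<rho>} t \<partial>lborel) + (\<integral>\<^sup>+t. ennreal (norm (G (x + t *\<^sub>R z))) * indicator {\<rho>..} t \<partial>lborel)"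
        by (rule nn_integral_add) auto
      finally show "(\<integral>\<^sup>+t. ennreal (norm (G (x + t *\<^sub>R z))) * indicator {0..} t \<partial>lborel) * indicator shell z
        = (\<integral>\<^sup>+t. ennreal (norm (G (x + t *\<^sub>R z))) * indicator {0..<\<rho>} t \<partial>lborel) * indicator shell z
         + (\<integral>\<^sup>+t. ennreal (norm (G (x + t *\<^sub>R z))) * indicator {\<rho>..} t \<partial>lborel) * indicator shell z"
        by (simp add: distrib_right)
    qed
    also have "\<dots> = near x + far x" unfolding near_def far_def by (rule nn_integral_add) measurable
    also have "\<dots> \<le> near x + ennreal C" using far by (rule add_left_mono)
    finally show ?thesis .
  qed
  have "ennreal (\<tau> * \<sigma>) * ennreal (\<rho> ^ n) = (\<integral>\<^sup>+x. ennreal (\<tau> * \<sigma>) * indicator E x \<partial>lborel)"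
    by (simp add: nn_integral_cmult E)
  also have "\<dots> \<le> (\<integral>\<^sup>+x. near x * indicator E x + ennreal C * indicator E x \<partial>lborel)"
    using pt by (intro nn_integral_mono) (auto simp: indicator_def)
  also have "\<dots> = (\<integral>\<^sup>+x. near x * indicator E x \<partial>lborel) + ennreal C * ennreal (\<rho> ^ n)"
    by (subst nn_integral_add) (auto simp: nn_integral_cmult E)
  also have "\<dots> \<le> ennreal (2 * \<sigma> * \<rho> ^ n) + ennreal C * ennreal (\<rho> ^ n)"
    using near_part[OF assms(1) E \<rho>(1)] unfolding near_def by (rule add_right_mono)
  finally have "ennreal (\<tau> * \<sigma> * \<rho> ^ n) \<le> ennreal ((2 * \<sigma> + C) * \<rho> ^ n)"
    using \<rho> C0 \<tau> by (simp add: distrib_right flip: ennreal_mult ennreal_plus)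
  then have "\<tau> * \<sigma> * \<rho> ^ n \<le> (2 * \<sigma> + C) * \<rho> ^ n"
    using \<rho> C0 by (subst (asm) ennreal_le_iff) auto
  then show ?thesis using \<rho> by (simp add: C_def)
qed

section \<open>From level sets to the exponential integral\<close>

lemma level_bound_log:
  assumes [measurable]: "E \<in> sets borel" and E: "E \<subseteq> \<Omega>" "measure lborel E > 0"
    and \<tau>: "\<tau> \<ge> 0" "\<And>x. x \<in> E \<Longrightarrow> \<tau> \<le> \<bar>w x\<bar>"
  shows "\<tau> \<le> (3 * \<sigma> + 2) / \<sigma> * (1 + ln (measure lborel \<Omega> / measure lborel E) / n) powr ((real n - 1) / real n)"
proof -
  define \<rho> R where "\<rho> = measure lborel E powr (1 / n)" and "R = measure lborel \<Omega> powr (1 / n)"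
  have fin: "emeasure lborel \<Omega> < \<infinity>" using emeasure_bounded_finite[OF \<Omega>(2)] .
  have finE: "emeasure lborel E < \<infinity>" using emeasure_bounded_finite[OF bounded_subset[OF \<Omega>(2) E(1)]] .
  have le: "measure lborel E \<le> measure lborel \<Omega>"
    using E fin by (intro measure_mono_fmeasurable) (auto simp: fmeasurable_def)
  have pow: "\<rho> ^ n = measure lborel E" "R ^ n = measure lborel \<Omega>"
    using E le dim by (auto simp: \<rho>_def R_def powr_powr simp flip: powr_realpow)
  have \<rho>: "0 < \<rho>" "\<rho> \<le> R" using E le by (auto simp: \<rho>_def R_def intro!: powr_mono2)
  have em: "emeasure lborel E = ennreal (\<rho> ^ n)" "emeasure lborel \<Omega> = ennreal (R ^ n)"
    unfolding pow using fin finE by (auto simp: emeasure_eq_ennreal_measure)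
  define L where "L = ln (R / \<rho>)"
  have L0: "L \<ge> 0" using \<rho> by (simp add: L_def)
  have L: "L = ln (measure lborel \<Omega> / measure lborel E) / n"
    using E le by (simp add: L_def \<rho>_def R_def ln_div ln_powr diff_divide_distrib)
  define M where "M = (1 + L) powr ((real n - 1) / real n)"
  \<comment> \<open>This balances the two terms: \<open>\<mu> (1 + L)\<close> and
    \<open>(1 / \<mu>) ^ (n - 1)\<close> both become \<open>M\<close>.\<close>
  define \<mu> where "\<mu> = (1 + L) powr (- (1 / real n))"
  have M1: "M \<ge> 1" using L0 dim by (auto simp: M_def intro!: ge_one_powr_ge_zero)
  have \<mu>: "0 < \<mu>" "\<mu> \<le> 1" using L0 dim by (auto simp: \<mu>_def powr_minus intro!: inverse_le_1_iff[THEN iffD2] ge_one_powr_ge_zero)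
  have \<mu>L: "\<mu> * (1 + L) = M"
  proof -
    have "\<mu> * (1 + L) = (1 + L) powr (- (1 / real n) + 1)" unfolding \<mu>_def powr_add using L0 by simp
    also have "- (1 / real n) + 1 = (real n - 1) / real n" using dim by (simp add: field_simps)
    finally show ?thesis by (simp add: M_def)
  qed
  have "1 / \<mu> = (1 + L) powr (1 / real n)" by (simp add: \<mu>_def powr_minus field_simps)
  then have \<mu>n: "(1 / \<mu>) ^ (n - 1) = M"
    using L0 dim by (simp add: M_def powr_powr of_nat_diff flip: powr_realpow)
  have "\<tau> * \<sigma> \<le> 2 * \<sigma> + \<mu> * (\<sigma> * L + 1) + (1 / \<mu>) ^ (n - 1)"
    unfolding L_def by (rule level_bound[OF assms(1) em(1) \<rho> em(2) \<mu>(1) \<tau>])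
  also have "\<mu> * (\<sigma> * L + 1) \<le> \<sigma> * M + 1"
  proof -
    have "\<mu> * L \<le> M" using \<mu>L \<mu> by (simp add: algebra_simps)
    then have "\<sigma> * (\<mu> * L) \<le> \<sigma> * M" by (intro mult_left_mono) auto
    moreover have "\<mu> * (\<sigma> * L + 1) = \<sigma> * (\<mu> * L) + \<mu>" by (simp add: algebra_simps)
    ultimately show ?thesis using \<mu> by linarith
  qed
  also have "(2 * \<sigma> + (\<sigma> * M + 1) + (1 / \<mu>) ^ (n - 1)) \<le> 2 * \<sigma> * M + (\<sigma> * M + M) + M"
    unfolding \<mu>n using M1 \<sigma>_pos by (intro add_mono) auto
  finally have "\<tau> * \<sigma> \<le> (3 * \<sigma> + 2) * M" by (simp add: algebra_simps)
  then have "\<tau> \<le> (3 * \<sigma> + 2) / \<sigma> * M" by (simp add: field_simps)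
  then show ?thesis by (simp add: M_def L)
qed

text \<open>Raised to the power \<open>n / (n - 1)\<close>, \<open>level_bound_log\<close> is linear
  in \<open>ln (|\<Omega>| / |E|)\<close>, and solving for \<open>|E|\<close> gives exponential
  decay in \<open>k\<close>. The case of a null set is separate because the logarithm requires
  \<open>|E| > 0\<close>.\<close>

lemma level_measure:
  fixes k :: real
  assumes k: "k \<ge> 0"
  shows "measure lborel {x \<in> \<Omega>. k \<le> \<bar>w x\<bar> powr (real n / (real n - 1))}
    \<le> measure lborel \<Omega> * exp (real n - real n * k / trudinger_const n \<sigma>)"
proof -
  define r where "r = real n / (real n - 1)"
  define E where "E = {x \<in> \<Omega>. k \<le> \<bar>w x\<bar> powr r}"
  have r: "r > 0" "1 / r = (real n - 1) / real n" using dim by (auto simp: r_def)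
  have Em: "E \<in> sets borel" unfolding E_def by measurable
  show ?thesis
  proof (cases "measure lborel E > 0")
    case False
    then have "measure lborel E \<le> 0" by simp
    also have "0 \<le> measure lborel \<Omega> * exp (real n - real n * k / trudinger_const n \<sigma>)" by simp
    finally show ?thesis by (simp add: E_def r_def)
  next
    case True
    have "emeasure lborel \<Omega> < \<infinity>" using emeasure_bounded_finite[OF \<Omega>(2)] .
    then have le: "measure lborel E \<le> measure lborel \<Omega>"
      using Em by (intro measure_mono_fmeasurable) (auto simp: fmeasurable_def E_def)
    define L where "L = ln (measure lborel \<Omega> / measure lborel E) / n"
    have L0: "L \<ge> 0" using True le by (simp add: L_def)
    have c: "(3 * \<sigma> + 2) / \<sigma> > 0" by (intro divide_pos_pos add_nonneg_pos) auto
    have lb: "k powr (1 / r) \<le> \<bar>w x\<bar>" if "x \<in> E" for x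
    proof -
      have "k powr (1 / r) \<le> (\<bar>w x\<bar> powr r) powr (1 / r)" using that k r(1) by (intro powr_mono2) (auto simp: E_def)
      then show ?thesis using r(1) by (simp add: powr_powr)
    qed
    have "k powr (1 / r) \<le> (3 * \<sigma> + 2) / \<sigma> * (1 + L) powr (1 / r)"
      unfolding L_def r(2) unfolding r(2)[symmetric]
      by (rule level_bound_log[OF Em _ True, unfolded r(2)[symmetric]]) (use lb in \<open>auto simp: E_def\<close>)
    then have "(k powr (1 / r)) powr r \<le> ((3 * \<sigma> + 2) / \<sigma> * (1 + L) powr (1 / r)) powr r"
      using r by (intro powr_mono2) auto
    also have "\<dots> = ((3 * \<sigma> + 2) / \<sigma>) powr r * ((1 + L) powr (1 / r)) powr r"
      by (rule powr_mult)
    also have "((1 + L) powr (1 / r)) powr r = 1 + L" using L0 r(1) by (simp add: powr_powr)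
    also have "((3 * \<sigma> + 2) / \<sigma>) powr r = trudinger_const n \<sigma>" by (simp add: trudinger_const_def r_def)
    finally have "k \<le> trudinger_const n \<sigma> * (1 + L)" using k r(1) by (simp add: powr_powr)
    then have "k / trudinger_const n \<sigma> \<le> 1 + L"
      using trudinger_const_pos[OF \<sigma>_pos(1)] by (simp add: pos_divide_le_eq mult.commute)
    then have *: "real n * (k / trudinger_const n \<sigma>) \<le> real n * (1 + L)" by (rule mult_left_mono) simp
    then have "ln (measure lborel E) \<le> ln (measure lborel \<Omega>) + (real n - real n * k / trudinger_const n \<sigma>)"
    proof -
      have "real n * L = ln (measure lborel \<Omega>) - ln (measure lborel E)"
        using True le dim by (simp add: L_def ln_div)
      then show ?thesis using * by (simp add: distrib_left)
    qed
    then have "exp (ln (measure lborel E)) \<le> exp (ln (measure lborel \<Omega>) + (real n - real n * k / trudinger_const n \<sigma>))" by simp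
    then show ?thesis using True le by (simp add: exp_add E_def r_def)
  qed
qed

text \<open>\<open>A\<close> is half the decay rate of \<open>level_measure\<close>. Cutting at
  integer values of the power of \<open>|w|\<close> bounds the integral by the sum of
  \<open>exp (A (k + 1)) |E k|\<close>, which is dominated by a geometric series with ratio
  \<open>exp (- A)\<close>.\<close>

lemma trudinger:
  defines "A \<equiv> real n / (2 * trudinger_const n \<sigma>)"
  shows "(\<integral>\<^sup>+x. ennreal (exp (A * \<bar>w x\<bar> powr (real n / (real n - 1)))) * indicator \<Omega> x \<partial>lborel)
    \<le> ennreal (exp (real n + A) / (1 - exp (- A)) * measure lborel \<Omega>)"
proof -
  define r where "r = real n / (real n - 1)"
  define E where "E k = {x \<in> \<Omega>. real k \<le> \<bar>w x\<bar> powr r}" for k :: nat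
  have [measurable]: "E k \<in> sets borel" for k unfolding E_def by measurable
  have A: "A > 0" using trudinger_const_pos[OF \<sigma>_pos(1)] dim by (auto simp: A_def)
  have fin: "emeasure lborel \<Omega> < \<infinity>" using emeasure_bounded_finite[OF \<Omega>(2)] .
  have em: "emeasure lborel (E k) \<le> ennreal (measure lborel \<Omega> * exp (real n - 2 * A * real k))" for k
  proof -
    have "emeasure lborel (E k) \<le> emeasure lborel \<Omega>" by (rule emeasure_mono) (auto simp: E_def)
    then have "emeasure lborel (E k) = ennreal (measure lborel (E k))"
      using fin by (intro emeasure_eq_ennreal_measure) auto
    also have "\<dots> \<le> ennreal (measure lborel \<Omega> * exp (real n - real n * real k / trudinger_const n \<sigma>))"
      unfolding E_def r_def by (intro ennreal_leI level_measure) auto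
    also have "real n * real k / trudinger_const n \<sigma> = 2 * A * real k" by (simp add: A_def)
    finally show ?thesis .
  qed
  have "(\<integral>\<^sup>+x. ennreal (exp (A * \<bar>w x\<bar> powr r)) * indicator \<Omega> x \<partial>lborel)
    \<le> (\<integral>\<^sup>+x. (\<Sum>k. ennreal (exp (A * (real k + 1))) * indicator (E k) x) \<partial>lborel)"
  proof (rule nn_integral_mono)
    fix x
    show "ennreal (exp (A * \<bar>w x\<bar> powr r)) * indicator \<Omega> x \<le> (\<Sum>k. ennreal (exp (A * (real k + 1))) * indicator (E k) x)"
    proof (cases "x \<in> \<Omega>")
      case True
      \<comment> \<open>The term of this index alone suffices: \<open>x\<close> lies in
        \<open>E k\<close>, and the exponent is rounded up to \<open>k + 1\<close>.\<close>
      define k where "k = nat \<lfloor>\<bar>w x\<bar> powr r\<rfloor>"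
      have k: "real k \<le> \<bar>w x\<bar> powr r" "\<bar>w x\<bar> powr r \<le> real k + 1"
        unfolding k_def by (simp add: of_nat_floor, linarith)
      have "ennreal (exp (A * \<bar>w x\<bar> powr r)) \<le> ennreal (exp (A * (real k + 1))) * indicator (E k) x"
        using k True A by (auto simp: E_def intro!: ennreal_leI)
      also have "\<dots> = sum (\<lambda>k. ennreal (exp (A * (real k + 1))) * indicator (E k) x) {k}"
        by (simp only: sum.insert sum.empty finite.emptyI empty_iff not_False_eq_True add_0_right)
      also have "\<dots> \<le> (\<Sum>k. ennreal (exp (A * (real k + 1))) * indicator (E k) x)"
        by (rule sum_le_suminf) auto
      finally show ?thesis using True by simp
    qed simp
  qed
  also have "\<dots> = (\<Sum>k. ennreal (exp (A * (real k + 1))) * emeasure lborel (E k))"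
    by (subst nn_integral_suminf) (auto simp: nn_integral_cmult)
  also have "\<dots> \<le> (\<Sum>k. ennreal (exp (real n + A) * measure lborel \<Omega> * exp (- A) ^ k))"
  proof (rule suminf_le)
    fix k
    have "ennreal (exp (A * (real k + 1))) * emeasure lborel (E k) \<le> ennreal (exp (A * (real k + 1))) * ennreal (measure lborel \<Omega> * exp (real n - 2 * A * real k))"
      by (intro mult_left_mono em) auto
    also have "\<dots> = ennreal (exp (real n + A) * measure lborel \<Omega> * exp (- A) ^ k)"
      by (simp add: exp_of_nat_mult[symmetric] exp_add[symmetric] ennreal_mult[symmetric] algebra_simps)
    finally show "ennreal (exp (A * (real k + 1))) * emeasure lborel (E k) \<le> ennreal (exp (real n + A) * measure lborel \<Omega> * exp (- A) ^ k)" .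
  qed auto
  also have "\<dots> = ennreal (\<Sum>k. exp (real n + A) * measure lborel \<Omega> * exp (- A) ^ k)"
    using A by (intro suminf_ennreal2 summable_mult summable_geometric) auto
  also have "(\<Sum>k. exp (real n + A) * measure lborel \<Omega> * exp (- A) ^ k) = exp (real n + A) / (1 - exp (- A)) * measure lborel \<Omega>"
    using A by (subst suminf_mult) (auto simp: suminf_geometric intro!: summable_geometric)
  finally show ?thesis by (simp add: r_def)
qed

end

section \<open>The inequality for positive exponents\<close>

lemma smooth_has_derivative:
  fixes u :: "real^'n \<Rightarrow> real"
  assumes "smooth u"
  shows "(u has_derivative (\<lambda>h. grad u x \<bullet> h)) (at x)" "continuous_on UNIV (grad u)"
proof -
  have C1: "C_class (Suc 0) u" using assms unfolding smooth_def by blast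
  define D where "D = frechet_derivative u (at x)"
  have D: "(u has_derivative D) (at x)"
    unfolding D_def using C1 frechet_derivative_works by (auto simp: differentiable_on_def)
  interpret D: linear D using D has_derivative_linear by blast
  have "D h = grad u x \<bullet> h" for h
  proof -
    have "D h = D (\<Sum>i\<in>UNIV. (h $ i) *\<^sub>R axis i 1)"
        using basis_expansion[of h] by (simp add: scalar_mult_eq_scaleR)
    also have "\<dots> = grad u x \<bullet> h"
      unfolding D.sum D.scale by (simp add: inner_vec_def grad_def pderivative_def D_def mult.commute)
    finally show ?thesis .
  qed
  then show "(u has_derivative (\<lambda>h. grad u x \<bullet> h)) (at x)" using D by presburger
  show "continuous_on UNIV (grad u)"
    unfolding grad_def[abs_def] using C1 by (intro continuous_on_vec_lambda) auto
qed

text \<open>Openness allows \<open>x\<close> to be pushed outwards by \<open>e / 2\<close> within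
  \<open>\<Omega>\<close>. Strictness places the supports of test functions in the open ball, where
  \<open>1 - ln (|x| / R) > 1\<close>.\<close>

lemma norm_less_radius:
  fixes \<Omega> :: "'a::real_normed_vector set"
  assumes "open \<Omega>" "bounded \<Omega>" "x \<in> \<Omega>" "x \<noteq> 0"
  shows "norm x < radius \<Omega>"
proof -
  obtain e where e: "e > 0" "ball x e \<subseteq> \<Omega>" using assms open_contains_ball by blast
  define y where "y = (1 + e / (2 * norm x)) *\<^sub>R x"
  have "dist x y = e / 2" using assms e by (simp add: y_def dist_norm algebra_simps)
  then have "y \<in> \<Omega>" using e by auto
  moreover have "bdd_above (norm ` \<Omega>)" using assms by (simp add: bounded_norm_comp bounded_imp_bdd_above)
  ultimately have "norm y \<le> radius \<Omega>" unfolding radius_def by (intro cSUP_upper)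
  moreover have "norm y = norm x + e / 2" using assms e by (simp add: y_def abs_of_pos add_pos_pos field_simps)
  ultimately show ?thesis using e by simp
qed

lemma radius_pos:
  fixes \<Omega> :: "'a::euclidean_space set"
  assumes "open \<Omega>" "bounded \<Omega>" "0 \<in> \<Omega>"
  shows "radius \<Omega> > 0"
proof -
  obtain e where e: "e > 0" "ball 0 e \<subseteq> \<Omega>" using assms open_contains_ball by blast
  obtain b :: 'a where b: "b \<in> Basis" using nonempty_Basis by blast
  have "(e / 2) *\<^sub>R b \<in> \<Omega>" using e b by (auto simp: subset_eq)
  moreover have "(e / 2) *\<^sub>R b \<noteq> 0" using e b by auto
  ultimately have "norm ((e / 2) *\<^sub>R b) < radius \<Omega>" by (intro norm_less_radius assms)
  then show ?thesis using norm_ge_zero order.strict_trans1 by blast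
qed

lemma set_integral_lebesgue_lborel:
  fixes f :: "'a::euclidean_space \<Rightarrow> real"
  assumes [measurable]: "f \<in> borel_measurable borel" "\<Omega> \<in> sets borel"
  shows "(LINT x:\<Omega>|lebesgue. f x) = (\<integral>x. indicator \<Omega> x *\<^sub>R f x \<partial>lborel)"
  unfolding set_lebesgue_integral_def by (rule integral_completion) measurable

section \<open>Test functions on a domain\<close>

locale hardy_test =
  fixes \<Omega> :: "(real^'n::finite) set" and u :: "real^'n \<Rightarrow> real"
  assumes card: "CARD('n) \<ge> 2"
    and \<Omega>: "bounded_domain \<Omega>" "0 \<in> \<Omega>"
    and u: "u \<in> test_functions (\<Omega> - {0})"
begin

definition K where "K = closure {x. u x \<noteq> 0}"

lemma \<Omega>': "open \<Omega>" "bounded \<Omega>" "\<Omega> \<in> sets borel"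
  using \<Omega> by (auto simp: bounded_domain_def)

lemma K_sub: "compact K" "K \<subseteq> \<Omega> - {0}" "K \<subseteq> ball 0 (radius \<Omega>) - {0}"
proof -
  show "compact K" "K \<subseteq> \<Omega> - {0}" using u by (auto simp: test_functions_def K_def)
  then show "K \<subseteq> ball 0 (radius \<Omega>) - {0}" using norm_less_radius[OF \<Omega>'(1,2)] by (auto dest!: subsetD[of K])
qed

lemma u_smooth: "smooth u" using u by (auto simp: test_functions_def)

sublocale punctured_function u "grad u" K "radius \<Omega>" "CARD('n)"
proof
  show "CARD('n) = DIM(real^'n)" by simp
  show "CARD('n) \<ge> 2" by (rule card)
  show "u x = 0" if "x \<notin> K" for x using that closure_subset[of "{x. u x \<noteq> 0}"] unfolding K_def by blast
  show "compact K" by (rule K_sub(1))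
  show "K \<subseteq> ball 0 (radius \<Omega>) - {0}" by (rule K_sub(3))
  show "radius \<Omega> > 0" by (rule radius_pos[OF \<Omega>'(1,2) \<Omega>(2)])
  show "(u has_derivative (\<lambda>h. grad u x \<bullet> h)) (at x)" for x by (rule smooth_has_derivative[OF u_smooth])
  show "continuous_on UNIV (grad u)" by (rule smooth_has_derivative[OF u_smooth])
qed

lemma integral_over_domain:
  fixes f :: "real^'n \<Rightarrow> real"
  assumes "integrable lborel f" "\<And>x. x \<notin> K \<Longrightarrow> f x = 0"
  shows "(LINT x:\<Omega>|lebesgue. f x) = (\<integral>x. f x \<partial>lborel)"
proof -
  have "f \<in> borel_measurable borel" using borel_measurable_integrable[OF assms(1)] by simp
  then have "(LINT x:\<Omega>|lebesgue. f x) = (\<integral>x. indicator \<Omega> x *\<^sub>R f x \<partial>lborel)"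
    by (rule set_integral_lebesgue_lborel) (rule \<Omega>')
  also have "(\<lambda>x. indicator \<Omega> x *\<^sub>R f x) = f"
  proof
    fix x
    show "indicator \<Omega> x *\<^sub>R f x = f x"
      using subsetD[OF K_sub(2), of x] assms(2)[of x] by (cases "x \<in> \<Omega>") auto
  qed
  finally show ?thesis .
qed

text \<open>The integrands vanish outside the support, which lies in \<open>\<Omega>\<close>, so
  integrals over the domain for the completed measure become Borel integrals over the whole
  space.\<close>

lemma hardy_functional_eq: "hardy_functional u \<Omega> = hardy_deficit"
proof -
  have 1: "(LINT x:\<Omega>|lebesgue. norm (grad u x) ^ CARD('n)) = (\<integral>x. norm (grad u x) ^ CARD('n) \<partial>lborel)"
    by (rule integral_over_domain[OF G_integrable]) (simp add: G0)
  have 2: "(LINT x:\<Omega>|lebesgue. \<bar>u x\<bar> ^ CARD('n) / norm x ^ CARD('n) * xi x ^ CARD('n))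
    = (\<integral>x. \<bar>u x\<bar> ^ CARD('n) / norm x ^ CARD('n) * xi x ^ CARD('n) \<partial>lborel)"
    by (rule integral_over_domain[OF potential_integrable]) (simp add: u0 power_0_left)
  show ?thesis
    unfolding hardy_functional_def hardy_deficit_def 1 2[unfolded xi_def] unfolding a_def xi_def ..
qed

end

text \<open>Trudinger's inequality is applied to \<open>w = u xi powr e / D\<close>, normalised to
  unit energy. Its constants \<open>A0\<close> and \<open>B\<close> come from the dimension alone;
  \<open>e\<close> enters through \<open>D\<close>, hence only through \<open>A\<close>, and so
  \<open>B\<close> can be fixed before \<open>\<epsilon>\<close>.\<close>

lemma leray_trudinger:
  assumes card: "CARD('n::finite) \<ge> 2"
  shows "\<exists>B>0. \<forall>\<epsilon>>0. \<exists>A>0.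
        \<forall>\<Omega> :: (real^'n) set. bounded_domain \<Omega> \<longrightarrow> 0 \<in> \<Omega> \<longrightarrow>
          (\<forall>u \<in> test_functions (\<Omega> - {0}). hardy_functional u \<Omega> \<le> 1 \<longrightarrow>
            (LINT x:\<Omega>|lebesgue.
               exp (A * (\<bar>u x\<bar> * X (norm x / radius \<Omega>) powr \<epsilon>)
                          powr (real CARD('n) / (real CARD('n) - 1))))
            \<le> B * measure lebesgue \<Omega>)"
proof -
  let ?n = "CARD('n)"
  define \<sigma> where "\<sigma> = measure lborel (shell :: (real^'n) set)"
  define A0 where "A0 = real ?n / (2 * trudinger_const ?n \<sigma>)"
  define B where "B = exp (real ?n + A0) / (1 - exp (- A0))"
  have A0: "A0 > 0" using card trudinger_const_pos[of \<sigma> ?n] shell_vol_pos[where 'a="real^'n"] by (auto simp: A0_def \<sigma>_def)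
  then have B: "B > 0" by (auto simp: B_def)
  define r where "r = real ?n / (real ?n - 1)"
  have "\<exists>A>0. \<forall>\<Omega> :: (real^'n) set. bounded_domain \<Omega> \<longrightarrow> 0 \<in> \<Omega> \<longrightarrow>
          (\<forall>u \<in> test_functions (\<Omega> - {0}). hardy_functional u \<Omega> \<le> 1 \<longrightarrow>
            (LINT x:\<Omega>|lebesgue. exp (A * (\<bar>u x\<bar> * X (norm x / radius \<Omega>) powr e) powr r))
            \<le> B * measure lebesgue \<Omega>)" if e: "e > 0" for e
  proof -
    define C0 where "C0 = 2 ^ ?n * (1 + \<bar>e - (real ?n - 1) / real ?n\<bar> ^ ?n * (2 / e) ^ ?n)"
    \<comment> \<open>The maximum with 1 gives \<open>D \<le> D ^ n\<close>, so \<open>D ^ n\<close>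
      bounds the energy of \<open>u xi powr e\<close> without taking an \<open>n\<close>-th
      root.\<close>
    define D where "D = max 1 (C0 / conv_const ?n)"
    have D: "D \<ge> 1" "C0 / conv_const ?n \<le> D ^ ?n"
      using self_le_power[of D ?n] by (auto simp: D_def)
    \<comment> \<open>Chosen so that \<open>A (|u| xi powr e) powr r\<close> equals
      \<open>A0 |w| powr r\<close>.\<close>
    define A where "A = A0 / D powr r"
    have A: "A > 0" using A0 D by (auto simp: A_def)
    show ?thesis
    proof (intro exI[of _ A] conjI A allI impI ballI)
      fix \<Omega> :: "(real^'n) set" and u
      assume asm: "bounded_domain \<Omega>" "0 \<in> \<Omega>" "u \<in> test_functions (\<Omega> - {0})" "hardy_functional u \<Omega> \<le> 1"
      interpret hardy_test \<Omega> u using card asm by unfold_locales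
      define w where "w x = (1 / D) * (u x * xi x powr e)" for x
      define Gw where "Gw x = (1 / D) *\<^sub>R w_grad e x" for x
      have P: "(\<integral>x. norm (p x) ^ ?n \<partial>lborel) \<le> 1 / conv_const ?n"
        using hardy_deficit_lower asm(4) conv_const_pos[OF card] by (simp add: hardy_functional_eq field_simps)
      have C0: "C0 \<ge> 0" using e by (auto simp: C0_def)
      interpret T: compact_C1 w Gw K \<Omega> ?n \<sigma>
      proof
        show "\<sigma> = measure lborel (shell :: (real^'n) set)" by (simp add: \<sigma>_def)
        show "(w has_derivative (\<lambda>h. Gw x \<bullet> h)) (at x)" for x
          using has_derivative_mult_right[OF w_der[of e x], of "1 / D"] by (simp add: w_def[abs_def] Gw_def)
        show "continuous_on UNIV Gw" unfolding Gw_def[abs_def] by (intro continuous_intros w_grad_cont)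
        have "(\<integral>x. norm (Gw x) ^ ?n \<partial>lborel) = (1 / D ^ ?n) * (\<integral>x. norm (w_grad e x) ^ ?n \<partial>lborel)"
          using D by (simp add: Gw_def power_divide)
        also have "\<dots> \<le> (1 / D ^ ?n) * (C0 * (1 / conv_const ?n))"
          using w_energy[OF e] mult_left_mono[OF P C0] D unfolding a_def C0_def[symmetric] by (intro mult_left_mono) auto
        also have "\<dots> = C0 / conv_const ?n / D ^ ?n" by simp
        also have "\<dots> \<le> 1" using D by (subst divide_le_eq_1_pos) auto
        finally show "(\<integral>x. norm (Gw x) ^ ?n \<partial>lborel) \<le> 1" .
      qed (use card K_sub \<Omega>' in \<open>auto simp: w_def Gw_def u0 w_grad0\<close>)
      have eq: "A * (\<bar>u x\<bar> * X (norm x / radius \<Omega>) powr e) powr r = A0 * \<bar>w x\<bar> powr r" for x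
        using D by (simp add: w_def abs_mult xi_def A_def powr_divide)
      have meas: "(\<lambda>x. exp (A0 * \<bar>w x\<bar> powr r)) \<in> borel_measurable borel"
        by measurable
      have "(LINT x:\<Omega>|lebesgue. exp (A0 * \<bar>w x\<bar> powr r)) = (\<integral>x. indicator \<Omega> x *\<^sub>R exp (A0 * \<bar>w x\<bar> powr r) \<partial>lborel)"
        by (rule set_integral_lebesgue_lborel[OF meas \<Omega>'(3)])
      also have "\<dots> = enn2real (\<integral>\<^sup>+x. ennreal (indicator \<Omega> x *\<^sub>R exp (A0 * \<bar>w x\<bar> powr r)) \<partial>lborel)"
        by (rule integral_eq_nn_integral) auto
      also have "(\<integral>\<^sup>+x. ennreal (indicator \<Omega> x *\<^sub>R exp (A0 * \<bar>w x\<bar> powr r)) \<partial>lborel) = (\<integral>\<^sup>+x. ennreal (exp (A0 * \<bar>w x\<bar> powr r)) * indicator \<Omega> x \<partial>lborel)"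
        by (intro nn_integral_cong) (auto simp: indicator_def)
      also have "enn2real \<dots> \<le> B * measure lborel \<Omega>"
        using T.trudinger B unfolding A0_def[symmetric] r_def[symmetric] B_def[symmetric] by (intro enn2real_leI) auto
      also have "measure lborel \<Omega> = measure lebesgue \<Omega>" using \<Omega>'(3) by simp
      finally show "(LINT x:\<Omega>|lebesgue. exp (A * (\<bar>u x\<bar> * X (norm x / radius \<Omega>) powr e) powr r)) \<le> B * measure lebesgue \<Omega>"
        unfolding eq .
    qed
  qed
  then show ?thesis using B unfolding r_def by blast
qed

section \<open>Smooth functions on open sets\<close>

text \<open>A version of \<open>C_class\<close> relative to an open set: formulas with
  \<open>ln (norm x)\<close> are differentiated on the punctured ball, where they are valid, and
  glued with zero afterwards.\<close>

primrec C_on :: "nat \<Rightarrow> (real^'n) set \<Rightarrow> (real^'n \<Rightarrow> real) \<Rightarrow> bool" where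
  "C_on 0 U f \<longleftrightarrow> continuous_on U f"
| "C_on (Suc k) U f \<longleftrightarrow> f differentiable_on U \<and> (\<forall>i. C_on k U (pderivative i f))"

lemma C_on_UNIV: "C_on k UNIV f \<longleftrightarrow> C_class k f"
  by (induction k arbitrary: f) auto

lemma pderivative_eq:
  assumes "(f has_derivative D) (at x)"
  shows "pderivative i f x = D (axis i 1)"
  using frechet_derivative_at[OF assms] by (simp add: pderivative_def)

lemma has_derivative_cong_open:
  assumes "open U" "x \<in> U" "\<And>x. x \<in> U \<Longrightarrow> f x = g x"
  shows "(f has_derivative D) (at x) \<longleftrightarrow> (g has_derivative D) (at x)"
  using has_derivative_transform_within_open[of f D x UNIV U g]
    has_derivative_transform_within_open[of g D x UNIV U f] assms by auto

lemma C_on_cong: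
  assumes "open U" "\<And>x. x \<in> U \<Longrightarrow> f x = g x" "C_on k U f"
  shows "C_on k U g"
  using assms(2,3)
proof (induction k arbitrary: f g)
  case 0
  then show ?case using continuous_on_cong[of U U f g] by simp
next
  case (Suc k)
  have eq: "pderivative i f x = pderivative i g x" if "x \<in> U" for i x
    unfolding pderivative_def frechet_derivative_def
    using has_derivative_cong_open[OF assms(1) that Suc.prems(1)] by simp
  have "g differentiable_on U"
    using Suc.prems has_derivative_cong_open[OF assms(1) _ Suc.prems(1)]
    by (auto simp: differentiable_on_eq_differentiable_at[OF assms(1)] differentiable_def)
  then show ?case using Suc.IH[OF eq] Suc.prems by auto
qed

lemma C_on_SucD: "C_on (Suc k) U f \<Longrightarrow> C_on k U f"
proof (induction k arbitrary: f)
  case 0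
  then show ?case by (simp add: differentiable_imp_continuous_on)
qed auto

lemma C_on_const: "open U \<Longrightarrow> C_on k U (\<lambda>x. c)"
proof (induction k arbitrary: c)
  case (Suc k)
  have "pderivative i (\<lambda>x. c) = (\<lambda>x. 0)" for i :: 'a
    by (rule ext, subst pderivative_eq[OF has_derivative_const]) simp
  then show ?case using Suc by simp
qed simp

lemma C_on_SucI:
  assumes "open U" "\<And>x. x \<in> U \<Longrightarrow> (f has_derivative D x) (at x)"
    and "\<And>i. C_on k U (\<lambda>x. D x (axis i 1))"
  shows "C_on (Suc k) U f"
proof -
  have "f differentiable_on U"
    using assms by (auto simp: differentiable_on_eq_differentiable_at differentiable_def)
  moreover have "C_on k U (pderivative i f)" for i
    by (rule C_on_cong[OF assms(1) _ assms(3)[of i]]) (simp add: pderivative_eq[OF assms(2)])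
  ultimately show ?thesis by simp
qed

lemma C_on_Suc_has_derivative:
  assumes "open U" "C_on (Suc k) U f" "x \<in> U"
  shows "(f has_derivative (\<lambda>h. frechet_derivative f (at x) h)) (at x)"
  using assms by (auto simp: differentiable_on_eq_differentiable_at frechet_derivative_works[symmetric])

lemma C_on_add:
  assumes "open U" "C_on k U f" "C_on k U g"
  shows "C_on k U (\<lambda>x. f x + g x)"
  using assms(2,3)
proof (induction k arbitrary: f g)
  case 0
  then show ?case by (auto intro: continuous_intros)
next
  case (Suc k)
  show ?case
  proof (rule C_on_SucI[OF assms(1)])
    fix x assume x: "x \<in> U"
    show "((\<lambda>x. f x + g x) has_derivative (\<lambda>h. frechet_derivative f (at x) h + frechet_derivative g (at x) h)) (at x)"
      by (intro has_derivative_add C_on_Suc_has_derivative[OF assms(1) Suc.prems(1) x]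
          C_on_Suc_has_derivative[OF assms(1) Suc.prems(2) x])
  next
    fix i
    show "C_on k U (\<lambda>x. frechet_derivative f (at x) (axis i 1) + frechet_derivative g (at x) (axis i 1))"
      using Suc.prems by (intro Suc.IH) (auto simp: pderivative_def[abs_def])
  qed
qed

lemma C_on_mult:
  assumes "open U" "C_on k U f" "C_on k U g"
  shows "C_on k U (\<lambda>x. f x * g x)"
  using assms(2,3)
proof (induction k arbitrary: f g)
  case 0
  then show ?case by (auto intro: continuous_intros)
next
  case (Suc k)
  show ?case
  proof (rule C_on_SucI[OF assms(1)])
    fix x assume x: "x \<in> U"
    show "((\<lambda>x. f x * g x) has_derivative (\<lambda>h. f x * frechet_derivative g (at x) h + frechet_derivative f (at x) h * g x)) (at x)"
      by (intro has_derivative_mult C_on_Suc_has_derivative[OF assms(1) Suc.prems(1) x]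
          C_on_Suc_has_derivative[OF assms(1) Suc.prems(2) x])
  next
    fix i
    show "C_on k U (\<lambda>x. f x * frechet_derivative g (at x) (axis i 1) + frechet_derivative f (at x) (axis i 1) * g x)"
      using Suc.prems C_on_SucD[OF Suc.prems(1)] C_on_SucD[OF Suc.prems(2)]
      by (intro C_on_add[OF assms(1)] Suc.IH) (auto simp: pderivative_def[abs_def])
  qed
qed

text \<open>By the chain rule, one more order for \<open>h \<circ> f\<close> only requires
  \<open>h' \<circ> f\<close> to have the lower order. Functions whose derivatives are built from
  the same family (inverse, exponential, \<open>flat\<close>) then follow by induction.\<close>

lemma C_on_compose:
  assumes "open U" "C_on (Suc k) U f"
    and "\<And>x. x \<in> U \<Longrightarrow> (h has_real_derivative h' (f x)) (at (f x))"
    and "C_on k U (\<lambda>x. h' (f x))"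
  shows "C_on (Suc k) U (\<lambda>x. h (f x))"
proof (rule C_on_SucI[OF assms(1)])
  fix x assume x: "x \<in> U"
  show "((\<lambda>x. h (f x)) has_derivative (\<lambda>v. h' (f x) * frechet_derivative f (at x) v)) (at x)"
    using has_derivative_compose[OF C_on_Suc_has_derivative[OF assms(1,2) x] assms(3)[OF x, THEN has_field_derivative_imp_has_derivative]] .
next
  fix i
  show "C_on k U (\<lambda>x. h' (f x) * frechet_derivative f (at x) (axis i 1))"
    using assms by (intro C_on_mult) (auto simp: pderivative_def[abs_def])
qed

lemma C_on_inverse:
  assumes "open U" "C_on k U f" "\<And>x. x \<in> U \<Longrightarrow> f x \<noteq> 0"
  shows "C_on k U (\<lambda>x. inverse (f x))"
  using assms(2)
proof (induction k)
  case 0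
  then show ?case using assms by (auto intro!: continuous_intros)
next
  case (Suc k)
  show ?case
  proof (rule C_on_compose[OF assms(1) Suc.prems])
    show "(inverse has_real_derivative (- 1) * (inverse (f x) * inverse (f x))) (at (f x))" if "x \<in> U" for x
      using assms(3)[OF that] by (auto intro!: derivative_eq_intros)
    show "C_on k U (\<lambda>x. (- 1) * (inverse (f x) * inverse (f x)))"
      by (intro C_on_mult C_on_const assms(1) Suc.IH C_on_SucD[OF Suc.prems])
  qed
qed

lemma C_on_ln:
  assumes "open U" "C_on k U f" "\<And>x. x \<in> U \<Longrightarrow> f x > 0"
  shows "C_on k U (\<lambda>x. ln (f x))"
proof (cases k)
  case 0
  have "f x \<noteq> 0" if "x \<in> U" for x using assms(3)[OF that] by simp
  then show ?thesis using assms(2) 0 by (auto intro!: continuous_intros)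
next
  case (Suc m)
  show ?thesis unfolding Suc
  proof (rule C_on_compose[OF assms(1) assms(2)[unfolded Suc]])
    show "(ln has_real_derivative inverse (f x)) (at (f x))" if "x \<in> U" for x
      using assms(3)[OF that] by (auto intro!: derivative_eq_intros simp: inverse_eq_divide)
    show "C_on m U (\<lambda>x. inverse (f x))"
      using assms(3) by (intro C_on_inverse assms(1) C_on_SucD[OF assms(2)[unfolded Suc]]) force
  qed
qed

lemma C_on_exp:
  assumes "open U" "C_on k U f"
  shows "C_on k U (\<lambda>x. exp (f x))"
  using assms(2)
proof (induction k)
  case 0
  then show ?case by (auto intro!: continuous_intros)
next
  case (Suc k)
  show ?case
    by (rule C_on_compose[OF assms(1) Suc.prems, of exp exp])
      (auto intro!: derivative_eq_intros Suc.IH C_on_SucD[OF Suc.prems])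
qed

section \<open>A family of flat functions\<close>

text \<open>\<open>flat 0\<close> is the classical \<open>exp (- 1 / y)\<close> extended by zero.
  The negative powers of \<open>y\<close> are included so that derivatives are linear combinations
  within the family.\<close>

definition flat :: "nat \<Rightarrow> real \<Rightarrow> real" where
  "flat m y = (if y > 0 then (1 / y) ^ m * exp (- (1 / y)) else 0)"

lemma flat_tendsto_0: "flat m \<midarrow>0\<rightarrow> 0"
proof -
  have "((\<lambda>x::real. x ^ m / exp x) \<longlongrightarrow> 0) at_top" by (rule tendsto_power_div_exp_0)
  then have "((\<lambda>y::real. inverse y ^ m / exp (inverse y)) \<longlongrightarrow> 0) (at_right 0)"
    by (rule filterlim_compose) (rule filterlim_inverse_at_top_right)
  then have "(flat m \<longlongrightarrow> 0) (at_right 0)"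
    by (rule Lim_transform_eventually)
      (auto simp: eventually_at_filter flat_def exp_minus divide_inverse)
  moreover have "(flat m \<longlongrightarrow> 0) (at_left 0)"
    by (rule Lim_transform_eventually[OF tendsto_const]) (auto simp: eventually_at_filter flat_def)
  ultimately show ?thesis by (simp add: filterlim_at_split)
qed

text \<open>At \<open>y = 0\<close> the difference quotient of \<open>flat m\<close> is exactly
  \<open>flat (m + 1)\<close>, which tends to 0. Elsewhere the formula is the product rule or
  trivial.\<close>

lemma flat_derivative:
  "(flat m has_real_derivative (flat (m + 2) y + (- real m) * flat (m + 1) y)) (at y)"
proof (cases "y = 0")
  case True
  have "(\<lambda>h. (flat m (0 + h) - flat m 0) / h) = flat (m + 1)"
    by (auto simp: flat_def fun_eq_iff)
  then show ?thesis using True flat_tendsto_0[of "m + 1"] by (simp add: DERIV_def flat_def)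
next
  case False
  show ?thesis
  proof (cases "y > 0")
    case True
    have "((\<lambda>y. (1 / y) ^ m * exp (- (1 / y))) has_real_derivative
        (1 / y) ^ m * (exp (- (1 / y)) * (1 / y\<^sup>2)) + real m * (1 / y) ^ (m - 1) * (- (1 / y\<^sup>2)) * exp (- (1 / y))) (at y)"
      using True by (auto intro!: derivative_eq_intros simp: power2_eq_square)
    also have "(1 / y) ^ m * (exp (- (1 / y)) * (1 / y\<^sup>2)) + real m * (1 / y) ^ (m - 1) * (- (1 / y\<^sup>2)) * exp (- (1 / y))
       = flat (m + 2) y + (- real m) * flat (m + 1) y"
      using True by (cases m) (auto simp: flat_def power2_eq_square field_simps)
    finally show ?thesis
      by (rule has_field_derivative_transform_within_open[of _ _ _ "{0<..}"]) (use True in \<open>auto simp: flat_def\<close>)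
  next
    case f: False
    have "(flat m has_real_derivative 0) (at y)"
      by (rule has_field_derivative_transform_within_open[of "\<lambda>_. 0" _ _ "{..<0}"]) (use f False in \<open>auto simp: flat_def\<close>)
    then show ?thesis using f by (simp add: flat_def)
  qed
qed

lemma flat_nonneg: "flat m y \<ge> 0" by (simp add: flat_def)

lemma flat_0_le: "flat 0 y \<le> 1" by (simp add: flat_def)

lemma flat_2_le: "flat 2 y \<le> 2"
proof (cases "y > 0")
  case True
  have "1 + 1 / y + (1 / y)\<^sup>2 / 2 \<le> exp (1 / y)" using True by (intro exp_lower_Taylor_quadratic) auto
  then have "(1 / y)\<^sup>2 \<le> 2 * exp (1 / y)" using True by (smt (verit) divide_pos_pos field_sum_of_halves)
  then show ?thesis using True by (simp add: flat_def exp_minus field_simps)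
qed (simp add: flat_def)

text \<open>The derivative of \<open>flat m\<close> involves \<open>flat (m + 1)\<close> and
  \<open>flat (m + 2)\<close>, hence the induction treats all \<open>m\<close> at once.\<close>

lemma C_on_flat:
  assumes "open U" "C_on k U f"
  shows "C_on k U (\<lambda>x. flat m (f x))"
  using assms(2)
proof (induction k arbitrary: m)
  case 0
  have "continuous_on UNIV (flat m)" using flat_derivative by (rule DERIV_continuous_on)
  then show ?case using 0 by (auto intro: continuous_on_compose2[of UNIV "flat m"])
next
  case (Suc k)
  show ?case
    by (rule C_on_compose[OF assms(1) Suc.prems flat_derivative])
      (intro C_on_add C_on_mult C_on_const assms(1) Suc.IH C_on_SucD[OF Suc.prems])
qed

section \<open>The squared norm, and gluing with zero\<close>

lemma C_on_component:
  assumes "open U"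
  shows "C_on k U (\<lambda>x. x $ j)"
proof (cases k)
  case 0
  then show ?thesis by (auto intro!: continuous_intros)
next
  case (Suc m)
  show ?thesis unfolding Suc
  proof (rule C_on_SucI[OF assms])
    show "((\<lambda>x. x $ j) has_derivative (\<lambda>h. h $ j)) (at x)" for x :: "real^'a"
      by (auto intro!: derivative_eq_intros bounded_linear_imp_has_derivative bounded_linear_vec_nth)
  qed (rule C_on_const[OF assms])
qed

lemma C_on_sum:
  assumes "open U" "finite I" "\<And>i. i \<in> I \<Longrightarrow> C_on k U (f i)"
  shows "C_on k U (\<lambda>x. \<Sum>i\<in>I. f i x)"
  using assms(2,3) by (induction I rule: finite_induct) (auto intro!: C_on_const C_on_add assms(1))

lemma C_on_norm_power2:
  assumes "open U"
  shows "C_on k U (\<lambda>x. (norm x)\<^sup>2)"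
proof -
  have "C_on k U (\<lambda>x. \<Sum>i\<in>UNIV. x $ i * x $ i)"
    by (intro C_on_sum C_on_mult C_on_component assms) auto
  then show ?thesis by (simp add: power2_norm_eq_inner inner_vec_def)
qed

lemma C_on_Un:
  assumes "open U" "open V" "C_on k U f" "C_on k V f"
  shows "C_on k (U \<union> V) f"
  using assms(3,4)
proof (induction k arbitrary: f)
  case 0
  then show ?case using assms by (auto intro: continuous_on_open_Un)
next
  case (Suc k)
  then show ?case using assms
    by (auto simp: differentiable_on_eq_differentiable_at open_Un)
qed

lemma C_class_extend_by_zero:
  assumes "open V" "closed A" "A \<subseteq> V" "C_on k V f" "\<And>x. x \<notin> A \<Longrightarrow> f x = 0"
  shows "C_class k f"
proof -
  have "open (- A)" using assms by auto
  then have "C_on k (- A) f" by (rule C_on_cong[of _ "\<lambda>x. 0"]) (auto simp: assms intro!: C_on_const)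
  then have "C_on k (V \<union> - A) f" using assms by (intro C_on_Un) auto
  also have "V \<union> - A = UNIV" using assms by auto
  finally show ?thesis by (simp add: C_on_UNIV)
qed

section \<open>Radial integration\<close>

lemma ball_annulus_measure:
  fixes y b :: real
  assumes "0 \<le> y" "y < b"
  shows "emeasure lborel {x::'a::euclidean_space. y < norm x \<and> norm x < b}
     = ennreal (unit_ball_vol DIM('a) * (b ^ DIM('a) - y ^ DIM('a)))"
proof -
  have "{x::'a. y < norm x \<and> norm x < b} = ball 0 b - cball 0 y" by auto
  also have "emeasure lborel (ball 0 b - cball (0::'a) y) = emeasure lborel (ball (0::'a) b) - emeasure lborel (cball (0::'a) y)"
    using assms by (intro emeasure_Diff) (auto simp: emeasure_cball)
  also have "\<dots> = ennreal (unit_ball_vol DIM('a) * b ^ DIM('a) - unit_ball_vol DIM('a) * y ^ DIM('a))"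
    using assms by (simp add: emeasure_ball emeasure_cball ennreal_minus)
  finally show ?thesis by (simp add: right_diff_distrib)
qed

text \<open>Both sides integrate \<open>h\<close> over the line: against the image of Lebesgue
  measure on the punctured ball under the norm, and against the density
  \<open>n \<omega> t^(n-1)\<close>, with \<open>\<omega>\<close> the volume of the unit ball. The
  two measures agree on half-lines by the volume of annuli, hence coincide.\<close>

lemma nn_integral_radial:
  fixes h :: "real \<Rightarrow> ennreal"
  assumes b: "b > 0" and [measurable]: "h \<in> borel_measurable borel"
  shows "(\<integral>\<^sup>+x. h (norm x) * indicator (ball 0 b - {0}) (x::'a::euclidean_space) \<partial>lborel)
    = (\<integral>\<^sup>+t. h t * (ennreal (unit_ball_vol DIM('a) * (DIM('a) * t ^ (DIM('a) - 1))) * indicator {0..b} t) \<partial>lborel)"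
proof -
  define n where "n = DIM('a)"
  have n: "n > 0" by (simp add: n_def)
  define M where "M = distr (density lborel (indicator (ball 0 b - {0::'a}))) borel (norm :: 'a \<Rightarrow> real)"
  define w where "w t = ennreal (unit_ball_vol n * (n * t ^ (n - 1))) * indicator {0..b} t" for t :: real
  define N where "N = density lborel w"
  have [measurable]: "w \<in> borel_measurable borel" unfolding w_def by measurable
  have [measurable]: "ball (0::'a) b - {0} \<in> sets borel" by simp
  have vm: "(norm :: 'a \<Rightarrow> real) -` {y<..} \<in> sets borel" for y
    by (intro borel_open open_vimage continuous_intros open_greaterThan)
  have M: "emeasure M {y<..} = ennreal (unit_ball_vol n * (b ^ n - max 0 y ^ n))" if "y < b" for y
  proof -
    have "emeasure M {y<..} = (\<integral>\<^sup>+x. indicator (ball 0 b - {0}) x * indicator (norm -` {y<..}) (x::'a) \<partial>lborel)"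
      unfolding M_def by (subst emeasure_distr) (simp_all add: emeasure_density vm)
    also have "\<dots> = (\<integral>\<^sup>+x. indicator {x. max 0 y < norm x \<and> norm x < b} (x::'a) \<partial>lborel)"
      by (intro nn_integral_cong) (auto simp: indicator_def)
    also have "\<dots> = emeasure lborel {x::'a. max 0 y < norm x \<and> norm x < b}"
      by (intro nn_integral_indicator) measurable
    finally show ?thesis using ball_annulus_measure[of "max 0 y" b, where 'a='a] b that by (simp add: n_def)
  qed
  have N: "emeasure N {y<..} = ennreal (unit_ball_vol n * (b ^ n - max 0 y ^ n))" if "y < b" for y
  proof -
    have "emeasure N {y<..} = (\<integral>\<^sup>+t. w t * indicator {y<..} t \<partial>lborel)"
      unfolding N_def by (subst emeasure_density) auto
    also have "\<dots> = (\<integral>\<^sup>+t. ennreal (unit_ball_vol n * (n * t ^ (n - 1))) * indicator {max 0 y..b} t \<partial>lborel)"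
    proof (rule nn_integral_cong_AE)
      show "AE t in lborel. w t * indicator {y<..} t = ennreal (unit_ball_vol n * (n * t ^ (n - 1))) * indicator {max 0 y..b} t"
        \<comment> \<open>The half-line is open and the interval closed; this matters only at the
          single point \<open>y\<close>.\<close>
        using AE_lborel_singleton[of y] by eventually_elim (auto simp: w_def indicator_def)
    qed
    also have "\<dots> = ennreal (unit_ball_vol n * b ^ n - unit_ball_vol n * max 0 y ^ n)"
      using b that by (intro nn_integral_FTC_Icc) (auto intro!: derivative_eq_intros)
    finally show ?thesis by (simp add: right_diff_distrib)
  qed
  have b0: "emeasure M {y<..} = 0" "emeasure N {y<..} = 0" if "y \<ge> b" for y
  proof -
    have "emeasure M {y<..} = (\<integral>\<^sup>+x. indicator (ball 0 b - {0}) x * indicator (norm -` {y<..}) (x::'a) \<partial>lborel)"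
      unfolding M_def by (subst emeasure_distr) (simp_all add: emeasure_density vm)
    also have "\<dots> = (\<integral>\<^sup>+x. 0 \<partial>(lborel :: 'a measure))"
      using that by (intro nn_integral_cong) (auto simp: indicator_def)
    finally show "emeasure M {y<..} = 0" by simp
    have "emeasure N {y<..} = (\<integral>\<^sup>+t. w t * indicator {y<..} t \<partial>lborel)"
      unfolding N_def by (subst emeasure_density) auto
    also have "\<dots> = (\<integral>\<^sup>+x. 0 \<partial>(lborel :: real measure))"
      using that by (intro nn_integral_cong) (auto simp: indicator_def w_def)
    finally show "emeasure N {y<..} = 0" by simp
  qed
  have "M = N"
  proof (rule measure_eqI_lessThan)
    show "sets M = sets borel" "sets N = sets borel" by (auto simp: M_def N_def)
    show "emeasure M {x<..} < \<infinity>" for x using M[of x] b0(1)[of x] by (cases "x < b") auto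
    show "emeasure M {x<..} = emeasure N {x<..}" for x using M[of x] N[of x] b0[of x] by (cases "x < b") auto
  qed
  have "(\<integral>\<^sup>+x. h (norm x) * indicator (ball 0 b - {0}) (x::'a) \<partial>lborel) = (\<integral>\<^sup>+t. h t \<partial>M)"
    unfolding M_def by (simp add: nn_integral_distr nn_integral_density mult.commute)
  also have "\<dots> = (\<integral>\<^sup>+t. h t * w t \<partial>lborel)"
    unfolding \<open>M = N\<close> N_def by (simp add: nn_integral_density mult.commute)
  finally show ?thesis by (simp add: w_def n_def)
qed

section \<open>Failure for the exponent zero\<close>

text \<open>This is the bump \<open>\<chi>\<close>. It vanishes outside \<open>(1, 4)\<close>; the
  interval \<open>[2, 3]\<close>, on which it is bounded below, is where the exponential integral
  will be made large.\<close>

definition cutoff :: "real \<Rightarrow> real" where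
  "cutoff y = flat 0 (y - 1) * flat 0 (4 - y)"

definition cutoff_deriv :: "real \<Rightarrow> real" where
  "cutoff_deriv y = flat 2 (y - 1) * flat 0 (4 - y) - flat 0 (y - 1) * flat 2 (4 - y)"

lemma cutoff_derivative: "(cutoff has_real_derivative cutoff_deriv y) (at y)"
proof -
  have f: "(flat 0 has_real_derivative flat 2 y) (at y)" for y using flat_derivative[of 0 y] by (simp add: numeral_2_eq_2)
  have 1: "((\<lambda>y. flat 0 (y - 1)) has_real_derivative flat 2 (y - 1) * 1) (at y)"
    by (rule DERIV_chain2[OF f]) (auto intro!: derivative_eq_intros)
  have 2: "((\<lambda>y. flat 0 (4 - y)) has_real_derivative flat 2 (4 - y) * (-1)) (at y)"
    by (rule DERIV_chain2[OF f]) (auto intro!: derivative_eq_intros)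
  show ?thesis using DERIV_mult[OF 1 2] by (simp add: cutoff_def[abs_def] cutoff_deriv_def algebra_simps)
qed

lemma cutoff_bounds: "0 \<le> cutoff y" "cutoff y \<le> 1"
  unfolding cutoff_def by (auto intro!: mult_nonneg_nonneg mult_le_one flat_nonneg flat_0_le)

lemma cutoff_deriv_bound: "\<bar>cutoff_deriv y\<bar> \<le> 4"
proof -
  have b: "0 \<le> flat 2 u * flat 0 v" "flat 2 u * flat 0 v \<le> 2 * 1" for u v
    using mult_mono[OF flat_2_le[of u] flat_0_le[of v]] flat_nonneg by auto
  show ?thesis unfolding cutoff_deriv_def
    using b[of "y - 1" "4 - y"] b[of "4 - y" "y - 1"] by (simp add: mult.commute)
qed

lemma cutoff_lower:
  assumes "2 \<le> y" "y \<le> 3"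
  shows "exp (- 2) \<le> cutoff y"
proof -
  have "exp (- 1) \<le> flat 0 v" if "v \<ge> 1" for v using that by (simp add: flat_def)
  then have "exp (- 1) * exp (- 1) \<le> cutoff y" unfolding cutoff_def using assms
    by (intro mult_mono) (auto simp: flat_nonneg)
  then show ?thesis by (simp add: exp_add[symmetric])
qed

lemma cutoff_support: "cutoff y \<noteq> 0 \<Longrightarrow> 1 < y \<and> y < 4"
  by (auto simp: cutoff_def flat_def split: if_splits)

text \<open>
  The case distinction discards the junk values of \<open>ln\<close> where \<open>1 - ln (|x| / R) \<le> 0\<close>.
\<close>

definition trial :: "real \<Rightarrow> real \<Rightarrow> real \<Rightarrow> real^'n \<Rightarrow> real" where
  "trial R c d x = (if x \<in> ball 0 R - {0} then
     c * exp ((real CARD('n) - 1) / real CARD('n) * ln (1 - ln (norm x / R))) * cutoff (d * ln (1 - ln (norm x / R)))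
     else 0)"

text \<open>In the variable \<open>s = 1 - ln (|x| / R)\<close> this reads
  \<open>1 \<le> d * ln s \<le> 4\<close>, the range in which the cutoff can be nonzero.\<close>

definition annulus :: "real \<Rightarrow> real \<Rightarrow> (real^'n) set" where
  "annulus R d = {x. R * exp (1 - exp (4 / d)) \<le> norm x \<and> norm x \<le> R * exp (1 - exp (1 / d))}"

context
  fixes R c d :: real
  assumes R: "R > 0" and c: "c > 0" and d: "0 < d" "d \<le> 1"
begin

lemma radii: "0 < R * exp (1 - exp (4 / d))" "R * exp (1 - exp (4 / d)) \<le> R * exp (1 - exp (1 / d))" "R * exp (1 - exp (1 / d)) < R"
  using R d by (auto simp: divide_le_cancel)

lemma annulus_sub: "annulus R d \<subseteq> ball 0 R - {0}"
  using radii by (auto simp: annulus_def)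

lemma annulus_compact: "compact (annulus R d :: (real^'n) set)"
proof -
  have "(annulus R d :: (real^'n) set) = cball 0 (R * exp (1 - exp (1 / d))) - ball 0 (R * exp (1 - exp (4 / d)))"
    by (auto simp: annulus_def)
  then show ?thesis by (simp add: compact_diff)
qed

lemma log_radius:
  assumes "0 < t" "t < R"
  shows "1 - ln (t / R) > 1"
  using assms by (auto simp: ln_less_zero)

lemma trial_zero:
  assumes "x \<notin> annulus R d"
  shows "trial R c d x = 0"
proof (rule ccontr)
  assume nz: "trial R c d x \<noteq> 0"
  then have x: "0 < norm x" "norm x < R" by (auto simp: trial_def split: if_splits)
  define s where "s = 1 - ln (norm x / R)"
  have s: "s > 1" using log_radius[OF x] by (simp add: s_def)
  have "cutoff (d * ln s) \<noteq> 0" using nz by (auto simp: trial_def s_def split: if_splits)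
  then have "1 < d * ln s" "d * ln s < 4" using cutoff_support by auto
  then have "1 / d < ln s" "ln s < 4 / d" using d by (auto simp: field_simps)
  then have "exp (1 / d) < exp (ln s)" "exp (ln s) < exp (4 / d)" by auto
  then have b: "exp (1 / d) < s" "s < exp (4 / d)" using s by auto
  have nx: "norm x = R * exp (1 - s)" using x R by (simp add: s_def)
  show False using assms b R by (simp add: annulus_def nx)
qed

lemma trial_smooth: "smooth (trial R c d :: real^'n \<Rightarrow> real)"
  unfolding smooth_def
proof
  fix k
  let ?V = "ball 0 R - {0} :: (real^'n) set"
  have V: "open ?V" by auto
  define s where "s x = 1 - ln (norm x / R)" for x :: "real^'n"
  have spos: "s x > 1" if "x \<in> ?V" for x using that log_radius[of "norm x"] by (auto simp: s_def)
  \<comment> \<open>\<open>ln (norm x)\<close> is written as half of \<open>ln\<close> of the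
    squared norm, because the latter is a polynomial.\<close>
  have "C_on k ?V (\<lambda>x. (1 + ln R) + (- 1 / 2) * ln ((norm x)\<^sup>2))"
    by (intro C_on_add C_on_mult C_on_const C_on_ln C_on_norm_power2 V) auto
  then have S: "C_on k ?V s"
  proof (rule C_on_cong[OF V, rotated])
    fix x assume "x \<in> ?V"
    then have "norm x > 0" by simp
    then show "(1 + ln R) + (- 1 / 2) * ln ((norm x)\<^sup>2) = s x"
      using R by (simp add: s_def ln_div ln_realpow)
  qed
  have L: "C_on k ?V (\<lambda>x. ln (s x))" using spos by (intro C_on_ln V S) (meson less_trans zero_less_one)
  have "C_on k ?V (\<lambda>x. (c * exp ((real CARD('n) - 1) / real CARD('n) * ln (s x)))
     * (flat 0 (d * ln (s x) + (- 1)) * flat 0 (4 + (- 1) * (d * ln (s x)))))"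
    by (intro C_on_mult C_on_exp C_on_flat C_on_add C_on_const V L)
  then have "C_on k ?V (trial R c d)"
    by (rule C_on_cong[OF V, rotated]) (auto simp: trial_def cutoff_def s_def)
  then show "C_class k (trial R c d :: real^'n \<Rightarrow> real)"
    by (rule C_class_extend_by_zero[OF V compact_imp_closed[OF annulus_compact] annulus_sub])
       (rule trial_zero)
qed

lemma trial_support: "closure {x. trial R c d x \<noteq> 0} \<subseteq> annulus R d"
  using trial_zero by (intro closure_minimal compact_imp_closed annulus_compact) auto

lemma trial_test_function:
  assumes "cball 0 (R * exp (1 - exp (1 / d))) \<subseteq> \<Omega>"
  shows "trial R c d \<in> test_functions (\<Omega> - {0})"
proof -
  have sub: "annulus R d \<subseteq> \<Omega> - {0}" using assms annulus_sub by (auto simp: annulus_def)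
  have "closure {x. trial R c d x \<noteq> 0} \<subseteq> \<Omega> - {0}" using trial_support sub by (rule order_trans)
  moreover have "compact (closure {x. trial R c d x \<noteq> 0})"
    unfolding compact_closure
    by (rule bounded_subset[OF compact_imp_bounded[OF annulus_compact]]) (use trial_zero in auto)
  ultimately show ?thesis using trial_smooth by (auto simp: test_functions_def)
qed

text \<open>With \<open>s = 1 - ln (t / R)\<close> and \<open>dt / t = - ds\<close>, the radial
  integral of \<open>X / |x|^n\<close> is a constant times that of \<open>ds / s\<close>, that is,
  the length \<open>3 / d\<close> of the interval covered by \<open>ln s\<close>.\<close>

lemma annulus_integral:
  assumes n: "n = CARD('n)" and "C \<ge> 0"
  defines "h \<equiv> \<lambda>x::real^'n. indicator (annulus R d) x *\<^sub>R (C * X (norm x / R) / norm x ^ n)"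
  shows "integrable lborel h" "(\<integral>x. h x \<partial>lborel) \<le> 3 * real n * unit_ball_vol n * C / d"
proof -
  have pos: "1 - ln (norm x / R) > 0" "norm x > 0" if "x \<in> annulus R d" for x :: "real^'n"
    using log_radius[of "norm x"] subsetD[OF annulus_sub that] by auto
  have nz: "1 - ln (norm x / R) \<noteq> 0" "norm x \<noteq> 0" "norm x / R \<noteq> 0" if "x \<in> annulus R d" for x :: "real^'n"
    using pos[OF that] R by auto
  show int: "integrable lborel h" unfolding h_def X_def
    using nz R by (intro borel_integrable_compact annulus_compact continuous_intros) auto
  define r1 r2 where "r1 = R * exp (1 - exp (4 / d))" and "r2 = R * exp (1 - exp (1 / d))"
  have r: "0 < r1" "r1 \<le> r2" "r2 < R" using radii by (auto simp: r1_def r2_def)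
  have X0: "C * X (norm x / R) / norm x ^ n \<ge> 0" if "x \<in> annulus R d" for x :: "real^'n"
    using pos[OF that] assms(2) by (simp add: X_def)
  have "(\<integral>x. h x \<partial>lborel) = enn2real (\<integral>\<^sup>+x. ennreal (h x) \<partial>lborel)"
    using X0 int by (intro integral_eq_nn_integral AE_I2) (auto simp: h_def indicator_def)
  also have "(\<integral>\<^sup>+x. ennreal (h x) \<partial>lborel) = (\<integral>\<^sup>+x. (ennreal (C * X (norm x / R) / norm x ^ n) * indicator {r1..r2} (norm x)) * indicator (ball 0 R - {0}) (x::real^'n) \<partial>lborel)"
    using annulus_sub by (intro nn_integral_cong) (auto simp: h_def indicator_def annulus_def r1_def r2_def)
  also have "\<dots> = (\<integral>\<^sup>+t. (ennreal (C * X (t / R) / t ^ n) * indicator {r1..r2} t) * (ennreal (unit_ball_vol n * (n * t ^ (n - 1))) * indicator {0..R} t) \<partial>lborel)"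
    using nn_integral_radial[OF R, of "\<lambda>t. ennreal (C * X (t / R) / t ^ n) * indicator {r1..r2} t", where 'a="real^'n"]
    by (simp add: n X_def)
  also have "\<dots> = (\<integral>\<^sup>+t. ennreal (C * unit_ball_vol n * n * (1 / (t * (1 - ln (t / R))))) * indicator {r1..r2} t \<partial>lborel)"
  proof (rule nn_integral_cong)
    fix t :: real
    show "(ennreal (C * X (t / R) / t ^ n) * indicator {r1..r2} t) * (ennreal (unit_ball_vol n * (n * t ^ (n - 1))) * indicator {0..R} t)
      = ennreal (C * unit_ball_vol n * n * (1 / (t * (1 - ln (t / R))))) * indicator {r1..r2} t"
    proof (cases "t \<in> {r1..r2}")
      case True
      then have t: "0 < t" "t < R" using r by auto
      define z where "z = 1 - ln (t / R)"
      have z: "z > 0" using log_radius[OF t] by (simp add: z_def)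
      have tn: "t ^ n = t ^ (n - 1) * t" using n by (metis power_minus_mult zero_less_card_finite)
      have "C * X (t / R) / t ^ n * (unit_ball_vol n * (n * t ^ (n - 1))) = C * unit_ball_vol n * n * (1 / (t * (1 - ln (t / R))))"
        unfolding X_def z_def[symmetric] tn using t z by (simp add: divide_inverse)
      moreover have "C * X (t / R) / t ^ n \<ge> 0" unfolding X_def z_def[symmetric] using t assms(2) z by simp
      moreover have "unit_ball_vol n * (n * t ^ (n - 1)) \<ge> 0" using t by simp
      ultimately show ?thesis using True t by (simp add: ennreal_mult[symmetric])
    qed simp
  qed
  also have "\<dots> = ennreal (- (C * unit_ball_vol n * n * ln (1 - ln (r2 / R))) - - (C * unit_ball_vol n * n * ln (1 - ln (r1 / R))))"
  proof (rule nn_integral_FTC_Icc[where F = "\<lambda>t. - (C * unit_ball_vol n * n * ln (1 - ln (t / R)))"])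
    fix t assume "t \<in> {r1..r2}"
    then have t: "0 < t" "t < R" using r by auto
    have ln: "((\<lambda>t. ln (t / R)) has_real_derivative 1 / t) (at t)"
      using t R by (auto intro!: derivative_eq_intros)
    have "((\<lambda>t. ln (1 - ln (t / R))) has_real_derivative 1 / (1 - ln (t / R)) * (0 - 1 / t)) (at t)"
      using log_radius[OF t] by (intro DERIV_chain2[OF DERIV_ln_divide] DERIV_diff DERIV_const ln) linarith
    then have "((\<lambda>t. - (C * unit_ball_vol n * n * ln (1 - ln (t / R)))) has_real_derivative
        - (C * unit_ball_vol n * n * (1 / (1 - ln (t / R)) * (0 - 1 / t)))) (at t)"
      by (intro DERIV_minus DERIV_cmult)
    also have "- (C * unit_ball_vol n * n * (1 / (1 - ln (t / R)) * (0 - 1 / t))) = C * unit_ball_vol n * n * (1 / (t * (1 - ln (t / R))))"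
      by (simp add: mult.commute)
    finally show "((\<lambda>t. - (C * unit_ball_vol n * n * ln (1 - ln (t / R)))) has_real_derivative
        C * unit_ball_vol n * n * (1 / (t * (1 - ln (t / R))))) (at t)" .
    show "0 \<le> C * unit_ball_vol n * n * (1 / (t * (1 - ln (t / R))))"
      using t assms(2) order.strict_trans[OF zero_less_one log_radius[OF t]] by (simp del: diff_gt_0_iff_gt)
  qed (use r in auto)
  also have "- (C * unit_ball_vol n * n * ln (1 - ln (r2 / R))) - - (C * unit_ball_vol n * n * ln (1 - ln (r1 / R))) = 3 * real n * unit_ball_vol n * C / d"
    using R d by (simp add: r1_def r2_def field_simps)
  finally show "(\<integral>x. h x \<partial>lborel) \<le> 3 * real n * unit_ball_vol n * C / d"
    using assms(2) d by (simp add: enn2real_ennreal)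
qed

end

section \<open>Deficit of the trial functions\<close>

text \<open>The trial function is radial, so \<open>p\<close> and \<open>q\<close> are multiples of
  \<open>x\<close> and the integrand is a scalar Taylor remainder. Only the derivative of the cutoff
  enters \<open>p\<close>, with a factor \<open>d\<close>; so the remainder is of order
  \<open>d^2\<close>, and integration over the annulus costs one factor
  \<open>1 / d\<close>.\<close>

lemma trial_hardy:
  fixes \<Omega> :: "(real^'n::finite) set"
  assumes card: "CARD('n) \<ge> 2" and \<Omega>: "bounded_domain \<Omega>" "0 \<in> \<Omega>"
    and c: "c > 0" and d: "0 < d" "d \<le> 1"
    and sub: "cball 0 (radius \<Omega> * exp (1 - exp (1 / d))) \<subseteq> \<Omega>"
    and R: "radius \<Omega> > 0"
  shows "hardy_functional (trial (radius \<Omega>) c d) \<Omega> \<le> 3 * real CARD('n) * unit_ball_vol CARD('n) * (16 * c) ^ CARD('n) * d"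
proof -
  let ?R = "radius \<Omega>" and ?n = "CARD('n)"
  let ?u = "trial ?R c d :: real^'n \<Rightarrow> real"
  interpret hardy_test \<Omega> ?u
    using card \<Omega> trial_test_function[OF R c d sub] by unfold_locales
  have Ksub: "K \<subseteq> annulus ?R d" unfolding K_def by (rule trial_support[OF R c d])
  \<comment> \<open>The profile in the variable \<open>t = xi\<close>, where
    \<open>s = 1 / t\<close> and \<open>ln s = - ln t\<close>, so that \<open>xi_der\<close> yields
    the gradient.\<close>
  define Psi where "Psi t = c * t powr (- a) * cutoff (- (d * ln t))" for t
  define Psi' where "Psi' t = - a * c * t powr (- a - 1) * cutoff (- (d * ln t)) - d * c * t powr (- a - 1) * cutoff_deriv (- (d * ln t))" for t
  have lnxi: "ln (xi x) = - ln (1 - ln (norm x / ?R))" if "x \<in> V" for x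
    using s_gt[OF that] by (simp add: xi_def X_def ln_inverse)
  have u_eq: "?u x = Psi (xi x)" if "x \<in> V" for x
    using that xi_pos[OF that] by (simp add: trial_def Psi_def a_def powr_def lnxi)
  have Psi_der: "(Psi has_real_derivative Psi' t) (at t)" if "t > 0" for t
  proof -
    have 1: "((\<lambda>t. cutoff (- (d * ln t))) has_real_derivative cutoff_deriv (- (d * ln t)) * (- (d / t))) (at t)"
      by (rule DERIV_chain2[OF cutoff_derivative]) (use that in \<open>auto intro!: derivative_eq_intros\<close>)
    have 2: "((\<lambda>t. c * t powr (- a)) has_real_derivative c * (- a * t powr (- a - 1))) (at t)"
      by (rule DERIV_cmult) (use that in \<open>auto intro!: derivative_eq_intros\<close>)
    have 3: "t powr (- a - 1) = t powr (- a) / t" using that by (simp add: powr_diff)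
    show ?thesis unfolding Psi_def[abs_def]
      by (rule DERIV_cong[OF DERIV_mult[OF 2 1]]) (simp add: Psi'_def 3 algebra_simps)
  qed
  have grad_eq: "grad ?u x = (Psi' (xi x) * ((xi x)\<^sup>2 / (norm x)\<^sup>2)) *\<^sub>R x" if "x \<in> V" for x
  proof -
    have "((\<lambda>x. Psi (xi x)) has_derivative (\<lambda>h. Psi' (xi x) * (((xi x)\<^sup>2 / (norm x)\<^sup>2) *\<^sub>R x \<bullet> h))) (at x)"
      using has_derivative_compose[OF xi_der[OF that] Psi_der[OF xi_pos[OF that], THEN has_field_derivative_imp_has_derivative]] .
    then have "(?u has_derivative (\<lambda>h. Psi' (xi x) * (((xi x)\<^sup>2 / (norm x)\<^sup>2) *\<^sub>R x \<bullet> h))) (at x)"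
      using has_derivative_cong_open[OF openV that, of "\<lambda>x. Psi (xi x)" ?u] u_eq by simp
    then have "(\<lambda>h. grad ?u x \<bullet> h) = (\<lambda>h. Psi' (xi x) * (((xi x)\<^sup>2 / (norm x)\<^sup>2) *\<^sub>R x \<bullet> h))"
      using der has_derivative_unique by blast
    then have "grad ?u x \<bullet> h = ((Psi' (xi x) * ((xi x)\<^sup>2 / (norm x)\<^sup>2)) *\<^sub>R x) \<bullet> h" for h
      by (simp add: fun_eq_iff mult.assoc)
    then show ?thesis by (metis inner_commute vector_eq_rdot)
  qed
  \<comment> \<open>The 16 is \<open>4 * 4\<close>: one factor from the remainder
    \<open>4 ^ n\<close>, the other from the bound \<open>m = 4 * b\<close> in
    \<open>abs_add_power_upper\<close>.\<close>
  define C where "C = (16 * c) ^ ?n * d\<^sup>2"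
  define h where "h x = indicator (annulus ?R d) x *\<^sub>R (C * X (norm x / ?R) / norm x ^ ?n)" for x :: "real^'n"
  have C0: "C \<ge> 0" using c by (simp add: C_def)
  have hint: "integrable lborel h" "(\<integral>x. h x \<partial>lborel) \<le> 3 * real ?n * unit_ball_vol ?n * C / d"
    unfolding h_def[abs_def] using annulus_integral[where 'n='n, OF R c d refl C0] by auto
  have "hardy_deficit \<le> (\<integral>x. h x \<partial>lborel)"
    unfolding hardy_deficit_eq
  proof (rule integral_mono)
    show "integrable lborel (\<lambda>x. norm (grad ?u x) ^ ?n - a ^ ?n * (\<bar>?u x\<bar> ^ ?n / norm x ^ ?n * xi x ^ ?n) + a ^ (?n - 1) * J (real ?n - 1) x)"
      by (intro Bochner_Integration.integrable_add Bochner_Integration.integrable_diff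
          integrable_mult_right G_integrable potential_integrable J_integrable)
    show "integrable lborel h" by (rule hint(1))
    fix x
    show "norm (grad ?u x) ^ ?n - a ^ ?n * (\<bar>?u x\<bar> ^ ?n / norm x ^ ?n * xi x ^ ?n) + a ^ (?n - 1) * J (real ?n - 1) x \<le> h x"
    proof (cases "x \<in> annulus ?R d")
      case False
      then have "x \<notin> K" using Ksub by auto
      then show ?thesis using False by (simp add: h_def G0 u0 J_def power_0_left)
    next
      case True
      then have x: "x \<in> V" using annulus_sub[OF R c d] by auto
      have pos: "norm x > 0" "xi x > 0" using x xi_pos by auto
      \<comment> \<open>The power \<open>b ^ n\<close> equals \<open>c ^ n * xi / |x| ^ n\<close>,
        the shape of integrand that \<open>annulus_integral\<close> treats. Below, \<open>P\<close>
        and \<open>Q\<close> are the radial components of \<open>p\<close> and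
        \<open>q\<close>.\<close>
      define b where "b = c * xi x powr (1 / real ?n) / norm x"
      define y where "y = - (d * ln (xi x))"
      define P Q where "P = - (d * b * cutoff_deriv y)" and "Q = - (a * b * cutoff y)"
      have b0: "b \<ge> 0" using pos c by (simp add: b_def)
      have one_a: "1 - a = 1 / real ?n" using card by (simp add: a_def field_simps)
      have pw: "xi x powr (- a) * xi x = xi x powr (1 / real ?n)" "xi x powr (- a - 1) * (xi x)\<^sup>2 = xi x powr (1 / real ?n)"
      proof -
        have "xi x powr (- a) * xi x powr 1 = xi x powr (1 - a)" unfolding powr_add[symmetric] by simp
        then show 1: "xi x powr (- a) * xi x = xi x powr (1 / real ?n)" using pos one_a by simp
        have "xi x powr (- a - 1) = xi x powr (- a) / xi x" using pos by (simp add: powr_diff)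
        then show "xi x powr (- a - 1) * (xi x)\<^sup>2 = xi x powr (1 / real ?n)" using 1 pos by (simp add: power2_eq_square)
      qed
      have u_x: "?u x * xi x = c * xi x powr (1 / real ?n) * cutoff y"
        unfolding u_eq[OF x] Psi_def y_def[symmetric] pw(1)[symmetric] by simp
      have q_eq: "q x = (Q / norm x) *\<^sub>R x"
      proof -
        have "a * ?u x * xi x / (norm x)\<^sup>2 = - (Q / norm x)"
          using u_x by (simp add: Q_def b_def power2_eq_square mult.assoc)
        then show ?thesis by (simp add: q_def)
      qed
      have G_eq: "grad ?u x = ((P + Q) / norm x) *\<^sub>R x"
      proof -
        have "Psi' (xi x) * (xi x)\<^sup>2 = - (a * c * cutoff y + d * c * cutoff_deriv y) * (xi x powr (- a - 1) * (xi x)\<^sup>2)"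
          by (simp add: Psi'_def y_def algebra_simps)
        then have "Psi' (xi x) * (xi x)\<^sup>2 = (P + Q) * norm x"
          unfolding pw(2) using pos by (simp add: P_def Q_def b_def algebra_simps)
        then have "Psi' (xi x) * ((xi x)\<^sup>2 / (norm x)\<^sup>2) = (P + Q) / norm x"
          using pos by (simp add: power2_eq_square)
        then show ?thesis by (simp add: grad_eq[OF x])
      qed
      have p_eq: "p x = (P / norm x) *\<^sub>R x"
        using p_plus_q[of x] by (simp add: q_eq G_eq add_divide_distrib scaleR_add_left)
      have nG: "norm (grad ?u x) = \<bar>Q + P\<bar>" and nq: "norm (q x) = \<bar>Q\<bar>" and qp: "q x \<bullet> p x = Q * P"
        using pos by (simp_all add: G_eq q_eq p_eq add.commute power2_norm_eq_inner[symmetric] power2_eq_square)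
      have "\<bar>Q\<bar> \<le> 4 * b"
      proof -
        have "a * b * cutoff y \<le> 1 * b * 1" using cutoff_bounds[of y] a_nonneg a_le b0 by (intro mult_mono) auto
        then show ?thesis using b0 a_nonneg cutoff_bounds[of y] by (simp add: Q_def abs_mult)
      qed
      moreover have "\<bar>P\<bar> \<le> d * (4 * b)"
        using mult_left_mono[OF cutoff_deriv_bound[of y], of "d * b"] b0 d by (simp add: P_def abs_mult algebra_simps)
      ultimately have "\<bar>Q + P\<bar> ^ ?n \<le> \<bar>Q\<bar> ^ ?n + real ?n * \<bar>Q\<bar> ^ (?n - 2) * (Q * P) + 4 ^ ?n * d\<^sup>2 * (4 * b) ^ ?n"
        using card d by (intro abs_add_power_upper) auto
      moreover have "\<bar>Q\<bar> ^ ?n + real ?n * \<bar>Q\<bar> ^ (?n - 2) * (Q * P) = a ^ ?n * (\<bar>?u x\<bar> ^ ?n / norm x ^ ?n * xi x ^ ?n) - a ^ (?n - 1) * J (real ?n - 1) x"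
        using cross_term[OF x] unfolding nq qp .
      moreover have "4 ^ ?n * d\<^sup>2 * (4 * b) ^ ?n = h x"
      proof -
        have "(xi x powr (1 / real ?n)) ^ ?n = xi x" using pos by (simp add: powr_powr flip: powr_realpow)
        then have "(4 * b) ^ ?n = 4 ^ ?n * c ^ ?n * xi x / norm x ^ ?n"
          by (simp add: b_def power_mult_distrib power_divide)
        then show ?thesis using True by (simp add: h_def C_def xi_def power_mult_distrib flip: power_mult_distrib[of 4 4])
      qed
      ultimately show ?thesis unfolding nG by linarith
    qed
  qed
  also have "\<dots> \<le> 3 * real ?n * unit_ball_vol ?n * C / d" by (rule hint(2))
  also have "\<dots> = 3 * real ?n * unit_ball_vol ?n * (16 * c) ^ ?n * d"
    using d by (simp add: C_def power2_eq_square)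
  finally show ?thesis by (simp add: hardy_functional_eq)
qed

section \<open>Unbounded exponential integrals\<close>

text \<open>The height \<open>c\<close> is fixed first, from \<open>A\<close> and the dimension.
  Only then is \<open>d\<close> made small, which brings the deficit below 1 and pushes
  \<open>s1\<close> so far out that the factor \<open>exp s1\<close> beats \<open>B\<close>.\<close>

lemma trudinger_fails:
  fixes \<Omega> :: "(real^'n::finite) set"
  assumes card: "CARD('n) \<ge> 2" and \<Omega>: "bounded_domain \<Omega>" "0 \<in> \<Omega>" and A: "A > 0" and B: "B > 0"
  shows "\<exists>u \<in> test_functions (\<Omega> - {0}). hardy_functional u \<Omega> \<le> 1 \<and>
    (LINT x:\<Omega>|lebesgue. exp (A * \<bar>u x\<bar> powr (real CARD('n) / (real CARD('n) - 1)))) > B * measure lebesgue \<Omega>"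
proof -
  have \<Omega>': "open \<Omega>" "bounded \<Omega>" "\<Omega> \<in> sets borel" using \<Omega> by (auto simp: bounded_domain_def)
  define n where "n = CARD('n)"
  define R where "R = radius \<Omega>"
  have R: "R > 0" unfolding R_def using \<Omega>' \<Omega> by (intro radius_pos)
  obtain r0 where r0: "r0 > 0" "cball 0 r0 \<subseteq> \<Omega>" using \<Omega>'(1) \<Omega>(2) open_contains_cball by blast
  define r where "r = real n / (real n - 1)"
  have n2: "n \<ge> 2" using card by (simp add: n_def)
  have r: "r > 0" "1 / r = (real n - 1) / real n" using n2 by (auto simp: r_def)
  \<comment> \<open>The factor \<open>exp 2\<close> offsets the lower bound \<open>exp (- 2)\<close>
    of the cutoff; the other factor makes \<open>A * |u| powr r\<close> at least
    \<open>(n + 1) * s\<close> on \<open>S0\<close>.\<close>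
  define c where "c = exp 2 * ((real n + 1) / A) powr (1 / r)"
  have c: "c > 0" using A by (simp add: c_def)
  define \<omega> where "\<omega> = unit_ball_vol n"
  have \<omega>: "\<omega> > 0" by (simp add: \<omega>_def)
  define C where "C = 3 * real n * \<omega> * (16 * c) ^ n"
  have C0: "C \<ge> 0" using \<omega> c by (simp add: C_def)
  define v where "v = B * measure lborel \<Omega> / (\<omega> * R ^ n)"
  have v0: "v \<ge> 0" using B \<omega> R by (simp add: v_def)
  \<comment> \<open>The summands collect the requirements on \<open>1 / d\<close>: support within
    \<open>cball 0 r0\<close>, deficit at most 1, and an integral above \<open>B\<close> times the
    volume. The summand 1 gives \<open>d \<le> 1\<close> and makes \<open>N > v\<close>
    strict.\<close>
  define N where "N = 1 + \<bar>1 - ln (r0 / R)\<bar> + C + v"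
  have N: "N \<ge> 1" "N \<ge> 1 - ln (r0 / R)" "N \<ge> C" "N > v"
    using C0 v0 by (auto simp: N_def)
  define d where "d = 1 / N"
  have d: "0 < d" "d \<le> 1" "1 / d = N" using N by (auto simp: d_def)
  have rad: "R * exp (1 - s) \<le> r0" if "s \<ge> N" for s
  proof -
    have "exp (1 - s) \<le> exp (ln (r0 / R))" using N that by simp
    then show ?thesis using r0 R by (simp add: field_simps)
  qed
  have eN: "exp t \<ge> t" for t :: real using exp_ge_add_one_self[of t] by linarith
  have sub: "cball 0 (R * exp (1 - exp (1 / d))) \<subseteq> \<Omega>"
  proof (rule order_trans[OF _ r0(2)])
    have "R * exp (1 - exp N) \<le> r0" by (rule rad) (rule eN)
    then show "cball 0 (R * exp (1 - exp (1 / d))) \<subseteq> cball (0::real^'n) r0" unfolding d(3) by (rule subset_cball)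
  qed
  let ?u = "trial R c d :: real^'n \<Rightarrow> real"
  have test: "?u \<in> test_functions (\<Omega> - {0})" by (rule trial_test_function[OF R c d(1,2) sub])
  have hardy: "hardy_functional ?u \<Omega> \<le> 1"
  proof -
    have "hardy_functional ?u \<Omega> \<le> C * d"
      using trial_hardy[OF card \<Omega> c d(1,2) sub[unfolded R_def] R[unfolded R_def]]
      by (simp add: R_def C_def n_def \<omega>_def)
    also have "\<dots> \<le> 1" using N by (simp add: d_def field_simps)
    finally show ?thesis .
  qed
  \<comment> \<open>Thus \<open>d * ln s1 = 2\<close>, the left end of the interval in which the
    cutoff is bounded below; \<open>S0\<close> is the shell \<open>s1 < s < s1 + 1\<close>.\<close>
  define s1 where "s1 = exp (2 * N)"
  define S0 where "S0 = {x::real^'n. R * exp (- s1) < norm x \<and> norm x < R * exp (1 - s1)}"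
  have s1N: "s1 \<ge> N" using eN[of "2 * N"] N by (simp add: s1_def)
  have s1pos: "s1 > 0" by (simp add: s1_def)
  have emS0: "emeasure lborel S0 = ennreal (\<omega> * ((R * exp (1 - s1)) ^ n - (R * exp (- s1)) ^ n))"
    unfolding S0_def \<omega>_def n_def using ball_annulus_measure[of "R * exp (- s1)" "R * exp (1 - s1)", where 'a="real^'n"] R by simp
  have diff: "(R * exp (1 - s1)) ^ n - (R * exp (- s1)) ^ n \<ge> R ^ n * exp (- (real n * s1))"
  proof -
    have e: "exp (- s1) ^ n = exp (- (real n * s1))" by (simp add: exp_of_nat_mult[symmetric])
    have "exp (1 - s1) = exp 1 * exp (- s1)" by (simp add: exp_add[symmetric])
    then have 1: "(R * exp (1 - s1)) ^ n - (R * exp (- s1)) ^ n = R ^ n * exp (- (real n * s1)) * (exp 1 ^ n - 1)"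
      by (simp add: power_mult_distrib e right_diff_distrib)
    have "(2::real) ^ 1 \<le> 2 ^ n" using n2 by (intro power_increasing) auto
    also have "(2::real) ^ n \<le> exp 1 ^ n" using exp_ge_add_one_self[of 1] by (intro power_mono) auto
    finally have "1 \<le> exp (1::real) ^ n - 1" by simp
    from mult_left_mono[OF this, of "R ^ n * exp (- (real n * s1))"] R show ?thesis unfolding 1 by simp
  qed
  have mS0: "measure lborel S0 \<ge> \<omega> * (R ^ n * exp (- (real n * s1)))"
  proof -
    have "measure lborel S0 = \<omega> * ((R * exp (1 - s1)) ^ n - (R * exp (- s1)) ^ n)"
      unfolding measure_def emS0
    proof (intro enn2real_ennreal mult_nonneg_nonneg)
      show "(R * exp (1 - s1)) ^ n - (R * exp (- s1)) ^ n \<ge> 0"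
        using R by (intro order_trans[OF _ diff]) auto
    qed (use \<omega> in auto)
    then show ?thesis using \<omega> diff by simp
  qed
  have S0_sub: "S0 \<subseteq> \<Omega>"
    using rad[OF s1N] r0(2) by (auto simp: S0_def subset_eq)
  have u_lower: "real n * s1 + s1 \<le> A * \<bar>?u x\<bar> powr r" if "x \<in> S0" for x
  proof -
    have x: "0 < norm x" "norm x < R"
    proof -
      have "0 < R * exp (- s1)" using R by simp
      then show "0 < norm x" using that unfolding S0_def mem_Collect_eq by linarith
      have "R * exp (1 - s1) \<le> R * 1" using R N s1N by (intro mult_left_mono) auto
      then show "norm x < R" using that by (simp add: S0_def)
    qed
    define s where "s = 1 - ln (norm x / R)"
    have nx: "norm x = R * exp (1 - s)" using x R by (simp add: s_def)
    have s: "s1 < s" "s < s1 + 1" using that R by (auto simp: S0_def nx)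
    have s0: "s > 0" using s s1pos by simp
    \<comment> \<open>This keeps \<open>d * ln s \<le> 3\<close> on the whole shell.\<close>
    have "s1 + 1 \<le> exp (3 * N)"
    proof -
      have "exp (3 * N) = exp (2 * N) * exp N" by (simp add: exp_add[symmetric])
      moreover have "exp (2 * N) * (1 + N) \<le> exp (2 * N) * exp N" by (intro mult_left_mono exp_ge_add_one_self) auto
      moreover have "1 \<le> exp (2 * N) * N" using N one_le_exp_iff[of "2 * N"] mult_mono[of 1 "exp (2 * N)" 1 N] by auto
      ultimately show ?thesis by (simp add: s1_def distrib_left)
    qed
    then have "s \<le> exp (3 * N)" using s by simp
    then have "ln s \<le> 3 * N" using s0 by (metis ln_exp ln_le_cancel_iff exp_gt_zero)
    moreover have "2 * N \<le> ln s" using s s1pos by (metis ln_exp ln_le_cancel_iff exp_gt_zero less_imp_le s0 s1_def)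
    ultimately have "2 \<le> d * ln s" "d * ln s \<le> 3" using N by (auto simp: d_def field_simps)
    then have cut: "exp (- 2) \<le> cutoff (d * ln s)" by (rule cutoff_lower)
    have u_eq: "?u x = c * s powr (1 / r) * cutoff (d * ln s)"
      using x s0 by (simp add: trial_def s_def[symmetric] r(2) n_def powr_def)
    have "((real n + 1) / A) powr (1 / r) * s powr (1 / r) = c * s powr (1 / r) * exp (- 2)"
      by (simp add: c_def exp_minus)
    also have "\<dots> \<le> \<bar>?u x\<bar>" unfolding u_eq using c cut cutoff_bounds(1)[of "d * ln s"]
      by (simp add: abs_mult mult_left_mono)
    finally have "(((real n + 1) / A) powr (1 / r) * s powr (1 / r)) powr r \<le> \<bar>?u x\<bar> powr r"
      using r(1) by (intro powr_mono2) auto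
    moreover have "(((real n + 1) / A) powr (1 / r) * s powr (1 / r)) powr r = (real n + 1) / A * s"
      using r(1) A s0 by (simp add: powr_mult powr_powr)
    ultimately have "(real n + 1) / A * s \<le> \<bar>?u x\<bar> powr r" by simp
    then have "(real n + 1) * s \<le> A * \<bar>?u x\<bar> powr r" using A by (simp add: pos_divide_le_eq mult.commute)
    moreover have "(real n + 1) * s1 \<le> (real n + 1) * s" using s by (intro mult_left_mono) auto
    ultimately show ?thesis by (simp add: distrib_right)
  qed
  have u_meas: "?u \<in> borel_measurable borel" and u_bounded: "\<exists>M. \<forall>x. \<bar>?u x\<bar> \<le> M"
  proof -
    interpret hardy_test \<Omega> ?u using card \<Omega> test by unfold_locales
    show "?u \<in> borel_measurable borel" using ucont by (rule borel_measurable_continuous_onI)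
    have "compact (?u ` K)" using ucont K(1) by (intro compact_continuous_image) (auto intro: continuous_on_subset)
    then have "bounded (?u ` K)" by (rule compact_imp_bounded)
    then obtain M where "\<forall>y \<in> ?u ` K. norm y \<le> M" unfolding bounded_iff by blast
    then have M: "\<bar>?u x\<bar> \<le> M" if "x \<in> K" for x using that by simp
    have "\<bar>?u x\<bar> \<le> max M 0" for x using M[of x] u0[of x] by (cases "x \<in> K") auto
    then show "\<exists>M. \<forall>x. \<bar>?u x\<bar> \<le> M" by blast
  qed
  then obtain M where M: "\<And>x. \<bar>?u x\<bar> \<le> M" by blast
  define f where "f x = exp (A * \<bar>?u x\<bar> powr r)" for x
  have f_meas [measurable]: "f \<in> borel_measurable borel" unfolding f_def[abs_def] using u_meas by measurable
  have finO: "emeasure lborel \<Omega> < \<infinity>" by (rule emeasure_bounded_finite[OF \<Omega>'(2)])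
  \<comment> \<open>Without integrability the integral would be 0 by default and no lower bound
    could hold. Here the integrand is bounded and \<open>\<Omega>\<close> has finite volume.\<close>
  have f_int: "integrable lborel (\<lambda>x. indicator \<Omega> x *\<^sub>R f x)"
  proof (rule integrableI_bounded_set[where A = \<Omega> and B = "exp (A * M powr r)"])
    show "(\<lambda>x. indicator \<Omega> x *\<^sub>R f x) \<in> borel_measurable lborel" using \<Omega>'(3) by simp
    have "f x \<le> exp (A * M powr r)" for x
      unfolding f_def using A r(1) M[of x] by (simp add: powr_mono2)
    then show "AE x\<in>\<Omega> in lborel. norm (indicator \<Omega> x *\<^sub>R f x) \<le> exp (A * M powr r)"
      by (intro AE_I2) (auto simp: indicator_def f_def)
  qed (use finO \<Omega>'(3) in auto)
  have S0_meas: "S0 \<in> sets borel" unfolding S0_def by measurable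
  have "B * measure lborel \<Omega> = v * (\<omega> * R ^ n)" using \<omega> R by (simp add: v_def)
  also have "\<dots> < N * (\<omega> * R ^ n)" using N \<omega> R by (intro mult_strict_right_mono) auto
  also have "\<dots> \<le> exp s1 * (\<omega> * R ^ n)"
    using s1N eN[of s1] \<omega> R by (intro mult_right_mono) auto
  also have "\<dots> = exp (real n * s1 + s1) * (\<omega> * (R ^ n * exp (- (real n * s1))))"
    by (simp add: exp_add exp_minus)
  also have "\<dots> \<le> exp (real n * s1 + s1) * measure lborel S0"
    by (intro mult_left_mono mS0) auto
  also have "\<dots> = (\<integral>x. exp (real n * s1 + s1) * indicator S0 x \<partial>lborel)"
    using S0_meas by simp
  also have "\<dots> \<le> (\<integral>x. indicator \<Omega> x *\<^sub>R f x \<partial>lborel)"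
  proof (rule integral_mono[OF _ f_int])
    show "integrable lborel (\<lambda>x. exp (real n * s1 + s1) * indicator S0 x)"
      using S0_meas emS0 by (intro integrable_mult_right integrable_real_indicator) auto
    show "exp (real n * s1 + s1) * indicator S0 x \<le> indicator \<Omega> x *\<^sub>R f x" for x
      using u_lower[of x] S0_sub by (auto simp: indicator_def f_def)
  qed
  also have "\<dots> = (LINT x:\<Omega>|lebesgue. f x)" by (rule set_integral_lebesgue_lborel[symmetric, OF f_meas \<Omega>'(3)])
  finally have "B * measure lebesgue \<Omega> < (LINT x:\<Omega>|lebesgue. f x)" using \<Omega>'(3) by simp
  then show ?thesis using test hardy unfolding f_def r_def n_def by blast
qed

theorem theorem1p1:
  assumes "CARD('n::finite) \<ge> 2"
  shows
    "(\<exists>B>0. \<forall>\<epsilon>>0. \<exists>A>0.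
        \<forall>\<Omega> :: (real^'n) set. bounded_domain \<Omega> \<longrightarrow> 0 \<in> \<Omega> \<longrightarrow>
          (\<forall>u \<in> test_functions (\<Omega> - {0}). hardy_functional u \<Omega> \<le> 1 \<longrightarrow>
            (LINT x:\<Omega>|lebesgue.
               exp (A * (\<bar>u x\<bar> * X (norm x / radius \<Omega>) powr \<epsilon>)
                          powr (real CARD('n) / (real CARD('n) - 1))))
            \<le> B * measure lebesgue \<Omega>))
     \<and>
     (\<forall>\<Omega> :: (real^'n) set. bounded_domain \<Omega> \<longrightarrow> 0 \<in> \<Omega> \<longrightarrow>
        \<not> (\<exists>A>0. \<exists>B>0.
          \<forall>u \<in> test_functions (\<Omega> - {0}). hardy_functional u \<Omega> \<le> 1 \<longrightarrow>
            (LINT x:\<Omega>|lebesgue.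
               exp (A * \<bar>u x\<bar> powr (real CARD('n) / (real CARD('n) - 1))))
            \<le> B * measure lebesgue \<Omega>))"
  using leray_trudinger[OF assms] trudinger_fails[OF assms] by (meson not_less)

end
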